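(* Let $k$ be an algebraically closed field of characteristic zero, let $R=k[x,y,z]$ and let $d\ge4$. Consider $$J_d=\bigl(x^d,\ y^{d-1}z-(d-2)xyz^{d-2},\ y^d-(d-1)xy^{d-2}z+x^{d-2}z^2\bigr).$$ Then $\mathrm{ht}(J_d)=2$, $\deg(R/J_d)=2d-2$ and $\mathrm{indeg}(\mathrm{Syz}(J_d))=d$. Consequently, $$\mathrm{Bour}(J_d)=(d-1)^2+1.$$
   Context: For an ideal $J=(f_1,f_2,f_3)\subseteq R$ of height $2$ minimally generated by three forms of degree $d$, $\mathrm{Syz}(J)=\{(a_1,a_2,a_3)\in R^3:\sum a_if_i=0\}$ is graded as a submodule of $R^3$ (standard grading), and $\mathrm{indeg}(\mathrm{Syz}(J))$ is the least degree of a nonzero homogeneous syzygy (the common degree of its nonzero coordinates). $\deg(R/J)$ is the multiplicity of $R/J$. Bourbaki degree: let $\nu$ be a minimal generator of $\mathrm{Syz}(J)$ of degree $e=\mathrm{indeg}(\mathrm{Syz}(J))$. If $J$ is perfect of height two (i.e. $R/J$ is Cohen--Macaulay), put $\mathrm{Bour}(J)=0$. Otherwise $\mathrm{Syz}(J)/R\nu$ is isomorphic, up to shift, to an unmixed homogeneous ideal $I_\nu\subseteq R$ of height $2$, and $\mathrm{Bour}(J)=\deg(R/I_\nu)$. This is independent of $\nu$, and in all cases $\mathrm{Bour}(J)=d^2-ed+e^2-\deg(R/J)$. *)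

theory Defs
  imports
    "HOL-Library.Extended_Nat"
    "HOL-Library.Product_Plus"
    "HOL-Computational_Algebra.Polynomial"
    "HOL-Algebra.QuotRing"
    "HOL-Algebra.Ring_Divisibility"
    "HOL-Algebra.Algebraic_Closure_Type"
begin

section \<open>Height, unmixedness and Cohen--Macaulayness of rings\<close>

text \<open>The height of a prime is the supremum of the lengths of strictly ascending chains of primes
  ending in it; the height of the unit ideal is \<open>\<infinity>\<close>.\<close>

definition prime_height :: "('a, 'm) ring_scheme \<Rightarrow> 'a set \<Rightarrow> enat" where
  "prime_height A P =
     Sup {enat n | n. \<exists>C :: nat \<Rightarrow> 'a set.
            (\<forall>i\<le>n. primeideal (C i) A) \<and> (\<forall>i<n. C i \<subset> C (Suc i)) \<and> C n = P}"

definition ideal_height :: "('a, 'm) ring_scheme \<Rightarrow> 'a set \<Rightarrow> enat" where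
  "ideal_height A I = Inf (prime_height A ` {P. primeideal P A \<and> I \<subseteq> P})"

definition ass_primes :: "('a, 'm) ring_scheme \<Rightarrow> 'a set \<Rightarrow> 'a set set" where
  "ass_primes A I =
     {P. primeideal P A \<and> (\<exists>f\<in>carrier A. P = {a \<in> carrier A. a \<otimes>\<^bsub>A\<^esub> f \<in> I})}"

definition unmixed :: "('a, 'm) ring_scheme \<Rightarrow> 'a set \<Rightarrow> bool" where
  "unmixed A I \<longleftrightarrow> (\<forall>P\<in>ass_primes A I. prime_height A P = ideal_height A I)"

definition regular_seq :: "('a, 'm) ring_scheme \<Rightarrow> 'a list \<Rightarrow> bool" where
  "regular_seq A xs \<longleftrightarrow>
     set xs \<subseteq> carrier A \<and> genideal A (set xs) \<noteq> carrier A \<and>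
     (\<forall>i<length xs. \<forall>a\<in>carrier A.
        xs ! i \<otimes>\<^bsub>A\<^esub> a \<in> genideal A (set (take i xs)) \<longrightarrow> a \<in> genideal A (set (take i xs)))"

definition ideal_depth :: "('a, 'm) ring_scheme \<Rightarrow> 'a set \<Rightarrow> enat" where
  "ideal_depth A I = Sup {enat (length xs) | xs. regular_seq A xs \<and> set xs \<subseteq> I}"

definition cohen_macaulay :: "('a, 'm) ring_scheme \<Rightarrow> bool" where
  "cohen_macaulay A \<longleftrightarrow>
     cring A \<and> noetherian_ring A \<and>
     (\<forall>M. maximalideal M A \<longrightarrow> ideal_depth A M = ideal_height A M)"


section \<open>The standard graded ring $k[x,y,z]$\<close>

text \<open>$k[x,y,z]$ is represented as $k[x][y][z]$: the coefficient of $x^i y^j z^l$ in \<open>p\<close> is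
  \<open>coeff (coeff (coeff p l) j) i\<close>.\<close>

type_synonym 'k poly3 = "'k poly poly poly"

abbreviation R3 :: "('k::field) poly3 ring" where
  "R3 \<equiv> ring_of_type_algebra"

definition var_x :: "('k::field) poly3" where "var_x = [:[:[:0, 1:]:]:]"
definition var_y :: "('k::field) poly3" where "var_y = [:[:0, 1:]:]"
definition var_z :: "('k::field) poly3" where "var_z = [:0, 1:]"

definition kscale :: "'k::field \<Rightarrow> 'k poly3 \<Rightarrow> 'k poly3" where
  "kscale c p = smult [:[:c:]:] p"

interpretation kvs: vector_space "kscale :: 'k::field \<Rightarrow> 'k poly3 \<Rightarrow> 'k poly3"
  by unfold_locales
    (simp_all add: kscale_def smult_add_right smult_add_left[symmetric] one_pCons[symmetric])

text \<open>Graded pieces are indexed by integers so that degree shifts need no truncation; the piece in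
  a negative degree is \<open>{0}\<close>.\<close>

definition forms :: "int \<Rightarrow> ('k::field) poly3 set" where
  "forms n = {p. \<forall>i j l. Polynomial.coeff (Polynomial.coeff (Polynomial.coeff p l) j) i \<noteq> 0
                  \<longrightarrow> int (i + j + l) = n}"

definition homogeneous_ideal :: "('k::field) poly3 set \<Rightarrow> bool" where
  "homogeneous_ideal I \<longleftrightarrow> ideal I R3 \<and> I = genideal R3 {p \<in> I. \<exists>n. p \<in> forms n}"

text \<open>For a homogeneous ideal \<open>I\<close> this is $\dim_k (R/I)_n = \dim_k (R_n/I_n)$.\<close>

definition hilbert_fun :: "('k::field) poly3 set \<Rightarrow> nat \<Rightarrow> nat" where
  "hilbert_fun I n = kvs.dim (forms (int n) :: 'k poly3 set) - kvs.dim (I \<inter> forms (int n))"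

definition hilbert_poly :: "('k::field) poly3 set \<Rightarrow> rat poly" where
  "hilbert_poly I =
     (THE P. \<forall>\<^sub>F n in sequentially. poly P (of_nat n) = of_nat (hilbert_fun I n))"

text \<open>The multiplicity of $R/I$: with $D = \dim R/I$ it is $(D-1)!$ times the leading coefficient
  of the Hilbert polynomial (which has degree $D-1$) if $D > 0$, and the length of $R/I$
  if $D = 0$.\<close>

definition quot_multiplicity :: "('k::field) poly3 set \<Rightarrow> rat" where
  "quot_multiplicity I =
     (if hilbert_poly I = 0 then of_nat (\<Sum>n | hilbert_fun I n \<noteq> 0. hilbert_fun I n)
      else fact (Polynomial.degree (hilbert_poly I)) * Polynomial.lead_coeff (hilbert_poly I))"


section \<open>Graded submodules of $R^3$ and syzygies\<close>

type_synonym 'k vec3 = "'k poly3 \<times> 'k poly3 \<times> 'k poly3"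

definition scale3 :: "('k::field) poly3 \<Rightarrow> 'k vec3 \<Rightarrow> 'k vec3" where
  "scale3 r = (\<lambda>(a, b, c). (r * a, r * b, r * c))"

interpretation fm: Modules.module "scale3 :: ('k::field) poly3 \<Rightarrow> 'k vec3 \<Rightarrow> 'k vec3"
  by unfold_locales (auto simp: scale3_def algebra_simps)

definition forms3 :: "int \<Rightarrow> ('k::field) vec3 set" where
  "forms3 n = forms n \<times> forms n \<times> forms n"

definition syz :: "('k::field) vec3 \<Rightarrow> 'k vec3 set" where
  "syz = (\<lambda>(f1, f2, f3). {(a1, a2, a3). a1 * f1 + a2 * f2 + a3 * f3 = 0})"

definition gen_ideal3 :: "('k::field) vec3 \<Rightarrow> 'k poly3 set" where
  "gen_ideal3 = (\<lambda>(f1, f2, f3). genideal R3 {f1, f2, f3})"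

definition indeg :: "('k::field) vec3 set \<Rightarrow> nat" where
  "indeg M = (LEAST n. \<exists>s \<in> M \<inter> forms3 (int n). s \<noteq> 0)"

definition minimal_gen_set :: "('k::field) vec3 set \<Rightarrow> 'k vec3 set \<Rightarrow> bool" where
  "minimal_gen_set M S \<longleftrightarrow>
     (\<forall>s\<in>S. \<exists>n. s \<in> forms3 n) \<and> fm.span S = M \<and> (\<forall>T. T \<subset> S \<longrightarrow> fm.span T \<noteq> M)"

definition minimal_generator :: "('k::field) vec3 set \<Rightarrow> 'k vec3 \<Rightarrow> bool" where
  "minimal_generator M \<nu> \<longleftrightarrow> (\<exists>S. minimal_gen_set M S \<and> \<nu> \<in> S)"

definition coset3 :: "('k::field) vec3 \<Rightarrow> 'k vec3 \<Rightarrow> 'k vec3 set" where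
  "coset3 \<nu> s = range (\<lambda>r. s + scale3 r \<nu>)"

text \<open>There is an isomorphism of \<open>R\<close>-modules $M/R\nu \to I$ that is homogeneous of some degree
  \<open>c\<close>.\<close>

definition quot_iso_shift :: "('k::field) vec3 set \<Rightarrow> 'k vec3 \<Rightarrow> 'k poly3 set \<Rightarrow> bool" where
  "quot_iso_shift M \<nu> I \<longleftrightarrow>
     (\<exists>(\<psi> :: 'k vec3 set \<Rightarrow> 'k poly3) (c :: int).
        bij_betw \<psi> (coset3 \<nu> ` M) I \<and>
        (\<forall>s\<in>M. \<forall>t\<in>M. \<psi> (coset3 \<nu> (s + t)) = \<psi> (coset3 \<nu> s) + \<psi> (coset3 \<nu> t)) \<and>
        (\<forall>r. \<forall>s\<in>M. \<psi> (coset3 \<nu> (scale3 r s)) = r * \<psi> (coset3 \<nu> s)) \<and>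
        (\<forall>n. \<forall>s\<in>M \<inter> forms3 n. \<psi> (coset3 \<nu> s) \<in> forms (n + c)))"


section \<open>The Bourbaki degree\<close>

text \<open>Meant for an ideal of height two minimally generated by three forms \<open>f\<close> of the same degree.
  Under that assumption $R/J$ is Cohen--Macaulay iff \<open>J\<close> is perfect of height two. The definite
  description is over all choices of \<open>\<nu>\<close> and \<open>I\<^sub>\<nu>\<close>, so it denotes a value only if some choice
  exists and all choices yield the same degree.\<close>

definition bourbaki_degree :: "('k::field) vec3 \<Rightarrow> rat" where
  "bourbaki_degree f =
     (if cohen_macaulay (R3 Quot (gen_ideal3 f)) then 0
      else (THE b. \<exists>\<nu> I.
              minimal_generator (syz f) \<nu> \<and> \<nu> \<in> forms3 (int (indeg (syz f))) \<and>
              homogeneous_ideal I \<and> ideal_height R3 I = 2 \<and> unmixed R3 I \<and>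
              quot_iso_shift (syz f) \<nu> I \<and> b = quot_multiplicity I))"

definition J_gens :: "nat \<Rightarrow> ('k::field) vec3" where
  "J_gens d =
     (var_x ^ d,
      var_y ^ (d - 1) * var_z - of_nat (d - 2) * var_x * var_y * var_z ^ (d - 2),
      var_y ^ d - of_nat (d - 1) * var_x * var_y ^ (d - 2) * var_z + var_x ^ (d - 2) * var_z ^ 2)"

end

theory Submission
  imports Defs
begin

text \<open>The only point of \<open>V(J\<^sub>d)\<close> is \<open>(0 : 0 : 1)\<close>, and the local ring of \<open>R/J\<^sub>d\<close> there has an
  explicit basis with $2d-2$ elements; this gives the degree. Modulo $x^d$ a syzygy is a solution of a
  linear recursion for coefficients, and a weight argument excludes solutions of degree less than
  \<open>d\<close>, so the Koszul syzygies have minimal degree. Since $x^{d-1}$ lies in \<open>J\<^sub>d\<close> locally but not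
  globally, $R/J_d$ has depth zero in the vertex and is not Cohen--Macaulay.

  For the Bourbaki degree, let \<open>g\<close> be the triple of generators. The cross product of a syzygy \<open>s\<close>
  with \<open>\<nu>\<close> is a multiple \<open>h(s) g\<close>, and every graded embedding of $\mathrm{Syz}/R\nu$ into \<open>R\<close> is a
  rational multiple of \<open>h\<close>. If it has positive degree, its image lies in a principal prime, so an
  image of height two forces degree zero, and its Hilbert function is then determined by
  those of $\mathrm{Syz}$ and $R\nu$. Existence follows from the Koszul syzygy of \<open>g\<^sub>1\<close> and \<open>g\<^sub>2\<close>, whose
  Bourbaki ideal is \<open>(g\<^sub>1, g\<^sub>2) : g\<^sub>3\<close>.\<close>

section \<open>Ideals of a ring given by a type class\<close>

text \<open>In the chart z = 1 the second generator gives (d-2) x y = y^(d-1). Substituted into y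
  times the third generator, it yields y^(d+1) times a factor with nonzero value at the origin, so
  y^(d+1) vanishes locally; the other relations follow from this.

  The case d = 4 is special twice. Only there does the term x y^(d-2) z of the third generator
  survive locally, which changes the constant \<open>ccoeff\<close>; and the weights that separate
  the terms of the recursion for d \<ge> 5 coincide, so this case is solved as a list of small
  linear systems. For d \<ge> 5 the recursion does have a solution of degree d, the Koszul one,
  which has to be normalised away.

  The number (d-1)^2 + 1 is d^2 - (2d-2): the second difference of dim R_n with step d is d^2, and
  the degree of R/J_d corrects it.

  The Bourbaki degree is a definite description over all pairs of a generator and an ideal, so
  uniqueness concerns an arbitrary isomorphism of unknown shift. Growth of Hilbert functions bounds
  the shift from below, height two bounds it from above. The upper bound rests on factoriality of
  k[x,y,z] and on principal primes having height at most one.\<close>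

lemma ring_of_type_algebra_simps [simp]:
  "carrier ring_of_type_algebra = UNIV"
  "monoid.mult ring_of_type_algebra = (*)"
  "one ring_of_type_algebra = 1"
  "ring.zero ring_of_type_algebra = 0"
  "add ring_of_type_algebra = (+)"
  by (simp_all add: ring_of_type_algebra_def)

text \<open>The definitions use the ideals of HOL-Algebra; this and the next lemmas trade them for
  closure conditions in type-class arithmetic. Closure under negation is multiplication by
  -1.\<close>

lemma type_ideal_iff:
  fixes I :: "'a::comm_ring_1 set"
  shows "ideal I ring_of_type_algebra \<longleftrightarrow>
    0 \<in> I \<and> (\<forall>a\<in>I. \<forall>b\<in>I. a + b \<in> I) \<and> (\<forall>r. \<forall>a\<in>I. r * a \<in> I)"
proof
  assume "ideal I ring_of_type_algebra"
  then interpret ideal I "ring_of_type_algebra :: 'a ring" .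
  show "0 \<in> I \<and> (\<forall>a\<in>I. \<forall>b\<in>I. a + b \<in> I) \<and> (\<forall>r. \<forall>a\<in>I. r * a \<in> I)"
    using additive_subgroup.zero_closed[OF is_additive_subgroup]
      additive_subgroup.a_closed[OF is_additive_subgroup] I_l_closed by simp
next
  assume I: "0 \<in> I \<and> (\<forall>a\<in>I. \<forall>b\<in>I. a + b \<in> I) \<and> (\<forall>r. \<forall>a\<in>I. r * a \<in> I)"
  interpret R: cring "ring_of_type_algebra :: 'a ring" by (rule cring_from_type_algebra)
  have inv_in: "\<ominus>\<^bsub>ring_of_type_algebra\<^esub> a \<in> I" if "a \<in> I" for a
  proof -
    have "\<ominus>\<^bsub>ring_of_type_algebra\<^esub> a = - a"
      using R.minus_equality[of "- a" a] by simp
    moreover have "- 1 * a \<in> I" using I that by blast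
    ultimately show ?thesis by simp
  qed
  show "ideal I ring_of_type_algebra"
  proof (rule idealI)
    show "subgroup I (add_monoid (ring_of_type_algebra :: 'a ring))"
      by (rule R.add.subgroupI) (use I inv_in in auto)
  next
    fix a x assume "a \<in> I"
    then have "x * a \<in> I" using I by blast
    then show "x \<otimes>\<^bsub>ring_of_type_algebra\<^esub> a \<in> I" "a \<otimes>\<^bsub>ring_of_type_algebra\<^esub> x \<in> I"
      by (simp_all add: mult.commute)
  qed (rule R.ring_axioms)
qed

lemma type_idealD:
  fixes I :: "'a::comm_ring_1 set"
  assumes "ideal I ring_of_type_algebra"
  shows "0 \<in> I" "a \<in> I \<Longrightarrow> b \<in> I \<Longrightarrow> a + b \<in> I" "a \<in> I \<Longrightarrow> r * a \<in> I"
    "a \<in> I \<Longrightarrow> a * r \<in> I" "a \<in> I \<Longrightarrow> - a \<in> I" "a \<in> I \<Longrightarrow> b \<in> I \<Longrightarrow> a - b \<in> I"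
proof -
  have I: "0 \<in> I" "\<And>a b. a \<in> I \<Longrightarrow> b \<in> I \<Longrightarrow> a + b \<in> I" "\<And>a r. a \<in> I \<Longrightarrow> r * a \<in> I"
    using assms by (auto simp: type_ideal_iff)
  have neg: "- a \<in> I" if "a \<in> I" for a using I(3)[OF that, of "- 1"] by simp
  show "0 \<in> I" "a \<in> I \<Longrightarrow> b \<in> I \<Longrightarrow> a + b \<in> I" "a \<in> I \<Longrightarrow> r * a \<in> I"
    "a \<in> I \<Longrightarrow> a * r \<in> I" "a \<in> I \<Longrightarrow> - a \<in> I"
    using I neg by (auto simp: mult.commute)
  show "a \<in> I \<Longrightarrow> b \<in> I \<Longrightarrow> a - b \<in> I" using I(2)[of a "- b"] neg by simp
qed

lemma type_ideal_sum:
  fixes I :: "'a::comm_ring_1 set"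
  assumes "ideal I ring_of_type_algebra" "\<And>i. i \<in> A \<Longrightarrow> f i \<in> I"
  shows "sum f A \<in> I"
  using assms(2) by (induction A rule: infinite_finite_induct) (auto simp: type_idealD[OF assms(1)])

lemma type_ideal_UNIV_iff:
  fixes I :: "'a::comm_ring_1 set"
  assumes "ideal I ring_of_type_algebra"
  shows "I = UNIV \<longleftrightarrow> 1 \<in> I"
  using type_idealD(4)[OF assms, of 1] by auto

lemma type_primeideal_iff:
  fixes P :: "'a::comm_ring_1 set"
  shows "primeideal P ring_of_type_algebra \<longleftrightarrow>
    ideal P ring_of_type_algebra \<and> 1 \<notin> P \<and> (\<forall>a b. a * b \<in> P \<longrightarrow> a \<in> P \<or> b \<in> P)"
proof
  assume "primeideal P ring_of_type_algebra"
  then interpret primeideal P "ring_of_type_algebra :: 'a ring" .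
  show "ideal P ring_of_type_algebra \<and> 1 \<notin> P \<and> (\<forall>a b. a * b \<in> P \<longrightarrow> a \<in> P \<or> b \<in> P)"
    using I_notcarr I_prime is_ideal type_ideal_UNIV_iff[OF is_ideal] by auto
next
  assume P: "ideal P ring_of_type_algebra \<and> 1 \<notin> P \<and> (\<forall>a b. a * b \<in> P \<longrightarrow> a \<in> P \<or> b \<in> P)"
  then show "primeideal P ring_of_type_algebra"
    using type_ideal_UNIV_iff[of P] by (intro primeidealI cring_from_type_algebra) auto
qed

lemma type_primeidealD:
  fixes P :: "'a::comm_ring_1 set"
  assumes "primeideal P ring_of_type_algebra"
  shows "ideal P ring_of_type_algebra" "1 \<notin> P" "a * b \<in> P \<Longrightarrow> a \<in> P \<or> b \<in> P"
  using assms by (auto simp: type_primeideal_iff)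

lemma type_primeideal_powerD:
  fixes P :: "'a::comm_ring_1 set"
  assumes "primeideal P ring_of_type_algebra" "a ^ n \<in> P"
  shows "a \<in> P"
  using assms(2) by (induction n) (use type_primeidealD[OF assms(1)] in auto)

lemma type_principal_ideal: "ideal {a. p dvd a} (ring_of_type_algebra :: 'a::comm_ring_1 ring)"
  by (auto simp: type_ideal_iff)

lemma type_principal_primeideal:
  assumes "prime_elem (p :: 'a::comm_ring_1)"
  shows "primeideal {a. p dvd a} ring_of_type_algebra"
  using assms by (auto simp: type_primeideal_iff type_principal_ideal prime_elem_def)

lemma type_zero_primeideal: "primeideal {0 :: 'a::idom} ring_of_type_algebra"
  by (auto simp: type_primeideal_iff type_ideal_iff)

lemma type_genideal:
  fixes S :: "'a::comm_ring_1 set"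
  shows "ideal (genideal ring_of_type_algebra S) ring_of_type_algebra"
    and "S \<subseteq> genideal ring_of_type_algebra S"
    and "ideal I ring_of_type_algebra \<Longrightarrow> S \<subseteq> I \<Longrightarrow> genideal ring_of_type_algebra S \<subseteq> I"
proof -
  interpret R: cring "ring_of_type_algebra :: 'a ring" by (rule cring_from_type_algebra)
  show "ideal (genideal ring_of_type_algebra S) ring_of_type_algebra"
    by (rule R.genideal_ideal) auto
  show "S \<subseteq> genideal ring_of_type_algebra S"
    by (rule R.genideal_self) auto
  show "ideal I ring_of_type_algebra \<Longrightarrow> S \<subseteq> I \<Longrightarrow> genideal ring_of_type_algebra S \<subseteq> I"
    by (rule R.genideal_minimal) auto
qed

lemma type_genideal_insert3:
  "genideal ring_of_type_algebra {a, b, c} = {u * a + v * b + w * c | u v w. True}"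
  for a b c :: "'a::comm_ring_1"
proof (rule antisym)
  have "ideal {u * a + v * b + w * c | u v w. True} ring_of_type_algebra"
  proof -
    have "0 = 0 * a + 0 * b + 0 * c" by simp
    moreover have "u * a + v * b + w * c + (u' * a + v' * b + w' * c)
        = (u + u') * a + (v + v') * b + (w + w') * c"
      "r * (u * a + v * b + w * c) = (r * u) * a + (r * v) * b + (r * w) * c" for u v w u' v' w' r
      by (simp_all add: algebra_simps)
    ultimately show ?thesis unfolding type_ideal_iff by blast
  qed
  moreover have "a = 1 * a + 0 * b + 0 * c" "b = 0 * a + 1 * b + 0 * c" "c = 0 * a + 0 * b + 1 * c"
    by simp_all
  then have "{a, b, c} \<subseteq> {u * a + v * b + w * c | u v w. True}" by blast
  ultimately show "genideal ring_of_type_algebra {a, b, c} \<subseteq> {u * a + v * b + w * c | u v w. True}"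
    by (rule type_genideal)
  have "a \<in> genideal ring_of_type_algebra {a, b, c}" "b \<in> genideal ring_of_type_algebra {a, b, c}"
    "c \<in> genideal ring_of_type_algebra {a, b, c}"
    using type_genideal(2)[of "{a, b, c}"] by auto
  then show "{u * a + v * b + w * c | u v w. True} \<subseteq> genideal ring_of_type_algebra {a, b, c}"
    by (auto intro!: type_idealD(2,3)[OF type_genideal(1)])
qed

section \<open>Gauss' lemma\<close>

text \<open>Factoriality as a predicate on types, so that it can be iterated through
  \<open>'k poly poly poly\<close>. Existence of factorizations into prime elements is enough: their
  uniqueness is automatic.\<close>

definition factorial_type :: "'a::idom itself \<Rightarrow> bool" where
  "factorial_type _ \<longleftrightarrow> (\<forall>a::'a. a \<noteq> 0 \<longrightarrow>
     (\<exists>u ps. u dvd 1 \<and> (\<forall>p\<in>#ps. prime_elem p) \<and> a = u * prod_mset ps))"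

lemma factorial_typeE:
  assumes "factorial_type TYPE('a::idom)" "(a::'a) \<noteq> 0"
  obtains u ps where "u dvd 1" "\<forall>p\<in>#ps. prime_elem p" "a = u * prod_mset ps"
  using assms unfolding factorial_type_def by blast

lemma factorial_type_field: "factorial_type TYPE('a::field)"
  unfolding factorial_type_def
proof (intro allI impI)
  fix a :: 'a assume "a \<noteq> 0"
  then have "a dvd 1" by (simp add: dvd_field_iff)
  then show "\<exists>u ps. u dvd 1 \<and> (\<forall>p\<in>#ps. prime_elem p) \<and> a = u * prod_mset ps"
    by (intro exI[of _ a] exI[of _ "{#}"]) auto
qed

lemma factorial_type_prime_divisor:
  assumes "factorial_type TYPE('a::idom)" "(a::'a) \<noteq> 0" "\<not> a dvd 1"
  shows "\<exists>p. prime_elem p \<and> p dvd a"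
proof -
  obtain u ps where u: "u dvd 1" "\<forall>p\<in>#ps. prime_elem p" "a = u * prod_mset ps"
    using factorial_typeE[OF assms(1,2)] .
  then have "ps \<noteq> {#}" using assms(3) by auto
  then obtain p ps' where "ps = add_mset p ps'" by (cases ps) auto
  then show ?thesis using u by (intro exI[of _ p]) auto
qed

lemma const_poly_prime_elem: "prime_elem [:p:]" if "prime_elem p" for p :: "'a::idom"
  using that by (rule lift_prime_elem_poly)

text \<open>Gauss' lemma by induction on the primes of the constant: each stays prime as a constant
  polynomial, so it divides \<open>g\<close> or \<open>q\<close> and is cancelled there. The
  constants \<open>e\<close> and \<open>e'\<close> collect what was removed; the unit goes to
  \<open>q\<close>.\<close>

lemma smult_prod_mset_eq_mult:
  fixes b g q :: "'a::idom poly"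
  assumes "u dvd 1" "\<forall>p\<in>#ps. prime_elem p" "smult (u * prod_mset ps) b = g * q"
  shows "\<exists>e e' g' q'. e \<noteq> 0 \<and> e' \<noteq> 0 \<and> g = smult e g' \<and> q = smult e' q' \<and> b = g' * q'"
  using assms(2,3)
proof (induction ps arbitrary: g q)
  case empty
  obtain v where v: "1 = u * v" using assms(1) by (auto elim: dvdE)
  then have "u \<noteq> 0" by auto
  have "b = smult v (smult u b)" using v by (simp add: mult.commute)
  also have "\<dots> = g * smult v q" using empty by simp
  finally have "b = g * smult v q" .
  moreover have "q = smult u (smult v q)" using v by (metis smult_1_left smult_smult)
  ultimately show ?case using \<open>u \<noteq> 0\<close>
    by (intro exI[of _ 1] exI[of _ u] exI[of _ g] exI[of _ "smult v q"]) simp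
next
  case (add p ps)
  have p: "prime_elem p" "p \<noteq> 0" using add.prems by auto
  have eq: "[:p:] * smult (u * prod_mset ps) b = g * q"
    using add.prems(2) by (simp add: mult_ac)
  then have "[:p:] dvd g * q" by (metis dvd_triv_left)
  then consider "[:p:] dvd g" | "[:p:] dvd q"
    using prime_elem_dvd_multD[OF const_poly_prime_elem[OF p(1)]] by blast
  then show ?case
  proof cases
    case 1
    then obtain g1 where g1: "g = [:p:] * g1" by (auto elim: dvdE)
    then have "[:p:] * smult (u * prod_mset ps) b = [:p:] * (g1 * q)"
      using eq by (simp only: mult.assoc)
    then have "smult (u * prod_mset ps) b = g1 * q" using p(2)
      by (metis mult_cancel_left pCons_eq_0_iff)
    moreover have "\<forall>p\<in>#ps. prime_elem p" using add.prems(1) by simp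
    ultimately have "\<exists>e e' g' q'. e \<noteq> 0 \<and> e' \<noteq> 0 \<and> g1 = smult e g' \<and> q = smult e' q' \<and> b = g' * q'"
      using add.IH by blast
    then obtain e e' g' q' where "e \<noteq> 0" "e' \<noteq> 0" "g1 = smult e g'" "q = smult e' q'" "b = g' * q'"
      by blast
    then show ?thesis using g1 p(2)
      by (intro exI[of _ "e * p"] exI[of _ e'] exI[of _ g'] exI[of _ q']) (auto simp: mult.commute)
  next
    case 2
    then obtain q1 where q1: "q = [:p:] * q1" by (auto elim: dvdE)
    then have "[:p:] * smult (u * prod_mset ps) b = [:p:] * (g * q1)"
      using eq by (simp only: mult.left_commute)
    then have "smult (u * prod_mset ps) b = g * q1" using p(2)
      by (metis mult_cancel_left pCons_eq_0_iff)
    moreover have "\<forall>p\<in>#ps. prime_elem p" using add.prems(1) by simp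
    ultimately have "\<exists>e e' g' q'. e \<noteq> 0 \<and> e' \<noteq> 0 \<and> g = smult e g' \<and> q1 = smult e' q' \<and> b = g' * q'"
      using add.IH by blast
    then obtain e e' g' q' where "e \<noteq> 0" "e' \<noteq> 0" "g = smult e g'" "q1 = smult e' q'" "b = g' * q'"
      by blast
    then show ?thesis using q1 p(2)
      by (intro exI[of _ e] exI[of _ "e' * p"] exI[of _ g'] exI[of _ q']) (auto simp: mult.commute)
  qed
qed

lemma smult_eq_mult_factor:
  fixes b g q :: "'a::idom poly"
  assumes "factorial_type TYPE('a)" "c \<noteq> 0" "smult c b = g * q"
  obtains e e' g' q' where "e \<noteq> 0" "e' \<noteq> 0" "g = smult e g'" "q = smult e' q'" "b = g' * q'"
proof -
  obtain u ps where u: "u dvd 1" "\<forall>p\<in>#ps. prime_elem p" "c = u * prod_mset ps"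
    using factorial_typeE[OF assms(1,2)] .
  have "smult (u * prod_mset ps) b = g * q" using assms(3) u(3) by simp
  from smult_prod_mset_eq_mult[OF u(1,2) this] that show thesis by blast
qed

text \<open>By Gauss' lemma \<open>b\<close> is a constant \<open>e\<close> times a divisor of
  \<open>v\<close>. A prime factor of \<open>e\<close> would contradict primitivity, so
  \<open>e\<close> is a unit.\<close>

lemma primitive_dvd_smult:
  fixes b v :: "'a::idom poly"
  assumes f: "factorial_type TYPE('a)" and prim: "\<And>p. prime_elem p \<Longrightarrow> \<not> [:p:] dvd b"
    and c: "c \<noteq> 0" "b dvd smult c v"
  shows "b dvd v"
proof -
  obtain w where w: "smult c v = b * w" using c(2) by (auto elim: dvdE)
  obtain e e' b' w' where e: "e \<noteq> 0" "b = smult e b'" "v = b' * w'"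
    by (rule smult_eq_mult_factor[OF f c(1) w])
  have "e dvd 1"
  proof (rule ccontr)
    assume "\<not> e dvd 1"
    then obtain p where p: "prime_elem p" "p dvd e"
      using factorial_type_prime_divisor[OF f e(1)] by blast
    then obtain e1 where "e = p * e1" by (auto elim: dvdE)
    then have "b = [:p:] * smult e1 b'" using e(2) by (simp add: mult.commute)
    then show False using prim[OF p(1)] by (metis dvd_triv_left)
  qed
  then obtain e1 where "1 = e * e1" by (auto elim: dvdE)
  then have "v = b * smult e1 w'" using e by (simp add: mult.commute[of e1])
  then show ?thesis by (metis dvd_triv_left)
qed

text \<open>Euclid over the fraction field, done with pseudo-division: an element \<open>g\<close>
  of least degree in the ideal (b, u) divides \<open>b\<close> and \<open>u\<close> up to nonzero
  constants. As \<open>b\<close> has no proper factor of positive degree, there are two cases.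
  Either \<open>g\<close> agrees with \<open>b\<close> up to constants, and \<open>b\<close> divides
  \<open>u\<close> by primitivity; or \<open>g\<close> is a nonzero constant, and its Bezout
  relation multiplied by \<open>v\<close> shows that \<open>b\<close> divides
  \<open>v\<close>.\<close>

lemma irreducible_primitive_prime_elem:
  fixes b :: "'a::idom poly"
  assumes f: "factorial_type TYPE('a)" and prim: "\<And>p. prime_elem p \<Longrightarrow> \<not> [:p:] dvd b"
    and deg: "Polynomial.degree b > 0"
    and irr: "\<And>g q. b = g * q \<Longrightarrow> Polynomial.degree g = 0 \<or> Polynomial.degree q = 0"
  shows "prime_elem b"
proof (rule prime_elemI)
  show b0: "b \<noteq> 0" using deg by auto
  show "\<not> b dvd 1" using deg b0 by (auto dest: divides_degree)
  fix u v assume uv: "b dvd u * v"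
  show "b dvd u \<or> b dvd v"
  proof (rule ccontr)
    assume neg: "\<not> (b dvd u \<or> b dvd v)"
    define S where "S = {s * b + t * u | s t. True}"
    have "b \<in> S" unfolding S_def by (rule CollectI, intro exI[of _ 1] exI[of _ 0]) simp
    have "u \<in> S" unfolding S_def by (rule CollectI, rule exI[of _ 0], rule exI[of _ 1]) simp
    have S: "h - w * g \<in> S" if hg: "h \<in> S" "g \<in> S" for g h w
    proof -
      obtain s t s' t' where "h = s * b + t * u" "g = s' * b + t' * u"
        using hg unfolding S_def by blast
      then have "h - w * g = (s - w * s') * b + (t - w * t') * u" by (simp add: algebra_simps)
      then show ?thesis unfolding S_def by blast
    qed
    have Ss: "smult a h \<in> S" if h: "h \<in> S" for a h
    proof -
      obtain s t where "h = s * b + t * u" using h unfolding S_def by blast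
      then have "smult a h = smult a s * b + smult a t * u" by (simp add: smult_add_right)
      then show ?thesis unfolding S_def by blast
    qed
    obtain g where g: "g \<in> S" "g \<noteq> 0"
        "\<And>h. h \<in> S \<Longrightarrow> h \<noteq> 0 \<Longrightarrow> Polynomial.degree g \<le> Polynomial.degree h"
    proof -
      have "\<exists>g. (g \<in> S \<and> g \<noteq> 0) \<and>
          (\<forall>h. h \<in> S \<and> h \<noteq> 0 \<longrightarrow> Polynomial.degree g \<le> Polynomial.degree h)"
        using \<open>b \<in> S\<close> b0 by (intro ex_has_least_nat[of _ b]) simp
      then show thesis using that by blast
    qed
    have div: "\<exists>a q. a \<noteq> 0 \<and> smult a h = g * q" if "h \<in> S" for h
    proof -
      obtain a q where a: "a \<noteq> 0" "smult a h = g * q + pseudo_mod h g"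
        using pseudo_mod(1)[OF g(2)] by blast
      then have "pseudo_mod h g = smult a h - q * g" by (simp add: algebra_simps)
      then have "pseudo_mod h g \<in> S" using S[OF Ss[OF that] g(1)] by simp
      then have "pseudo_mod h g = 0" using pseudo_mod(2)[OF g(2), of h] g(3)[of "pseudo_mod h g"] by linarith
      then show ?thesis using a by auto
    qed
    obtain a q where a: "a \<noteq> 0" "smult a b = g * q" using div[OF \<open>b \<in> S\<close>] by blast
    obtain a' q2 where a': "a' \<noteq> 0" "smult a' u = g * q2" using div[OF \<open>u \<in> S\<close>] by blast
    obtain e e' g' q' where e: "e \<noteq> 0" "e' \<noteq> 0" "g = smult e g'" "q = smult e' q'" "b = g' * q'"
      by (rule smult_eq_mult_factor[OF f a])
    from irr[OF e(5)] show False
    proof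
      assume "Polynomial.degree q' = 0"
      then obtain k where k: "q' = [:k:]" by (rule degree_eq_zeroE)
      then have "k \<noteq> 0" using e(5) b0 by auto
      have "smult (a' * k) u = b * smult e q2"
      proof -
        have "b = smult k g'" using e(5) k by simp
        have "smult (a' * k) u = smult k (smult a' u)" by (simp add: mult.commute)
        also have "\<dots> = smult k (smult e g' * q2)" using a'(2) e(3) by simp
        also have "\<dots> = smult k g' * smult e q2" by (simp add: mult.commute)
        finally show ?thesis using \<open>b = smult k g'\<close> by simp
      qed
      then have dvd: "b dvd smult (a' * k) u" by (metis dvd_triv_left)
      have "a' * k \<noteq> 0" using a'(1) \<open>k \<noteq> 0\<close> by simp
      from primitive_dvd_smult[OF f _ this dvd] have "b dvd u" using prim by blast
      then show False using neg by simp
    next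
      assume "Polynomial.degree g' = 0"
      then obtain k where k: "g' = [:k:]" by (rule degree_eq_zeroE)
      then have gc: "g = [:e * k:]" "e * k \<noteq> 0" using e(3) g(2) by auto
      obtain s t where "g = s * b + t * u" using g(1) unfolding S_def by blast
      then have "smult (e * k) v = (s * v) * b + t * (u * v)"
      proof -
        have "smult (e * k) v = g * v" using gc(1) by simp
        also have "\<dots> = (s * v) * b + t * (u * v)"
          using \<open>g = s * b + t * u\<close> by (simp add: algebra_simps)
        finally show ?thesis .
      qed
      then have "b dvd smult (e * k) v" using uv by simp
      from primitive_dvd_smult[OF f _ gc(2) this] have "b dvd v" using prim by blast
      then show False using neg by simp
    qed
  qed
qed

section \<open>Factoriality passes from a domain to its polynomial ring\<close>

definition prime_product :: "'a::idom \<Rightarrow> bool" where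
  "prime_product a \<longleftrightarrow> (\<exists>u ps. u dvd 1 \<and> (\<forall>p\<in>#ps. prime_elem p) \<and> a = u * prod_mset ps)"

lemma prime_product_mult: "prime_product a \<Longrightarrow> prime_product b \<Longrightarrow> prime_product (a * b)"
  unfolding prime_product_def
proof (elim exE conjE)
  fix u v ps qs
  assume "u dvd 1" "v dvd 1" "\<forall>p\<in>#ps. prime_elem p" "\<forall>p\<in>#qs. prime_elem p"
    "a = u * prod_mset ps" "b = v * prod_mset qs"
  then show "\<exists>u ps. u dvd 1 \<and> (\<forall>p\<in>#ps. prime_elem p) \<and> a * b = u * prod_mset ps"
    using mult_dvd_mono[of u 1 v 1]
    by (intro exI[of _ "u * v"] exI[of _ "ps + qs"]) (auto simp: mult_ac)
qed

lemma prime_product_prime: "prime_elem a \<Longrightarrow> prime_product a"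
  unfolding prime_product_def by (intro exI[of _ 1] exI[of _ "{#a#}"]) auto

lemma prime_product_unit: "a dvd 1 \<Longrightarrow> prime_product a"
  unfolding prime_product_def by (intro exI[of _ a] exI[of _ "{#}"]) auto

lemma prime_dvd_prod_mset_prime_elems:
  fixes p :: "'a::idom"
  assumes "prime_elem p" "u dvd 1" "p dvd u * prod_mset ps"
  shows "\<exists>q\<in>#ps. p dvd q"
  using assms(3)
proof (induction ps)
  case empty
  then have "p dvd 1" using assms(2) by (metis dvd_trans mult_1_right prod_mset_empty)
  then show ?case using assms(1) by (auto simp: prime_elem_def)
next
  case (add q ps)
  then have "p dvd q * (u * prod_mset ps)" by (simp add: mult_ac)
  then show ?case using prime_elem_dvd_multD[OF assms(1)] add.IH by auto
qed

text \<open>The outer induction is on the degree, the inner one on the number of primes in the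
  leading coefficient. A constant prime dividing \<open>k\<close> uses up one of these primes. A
  primitive \<open>k\<close> splits into factors of smaller degree, or is a unit, or is prime by
  \<open>irreducible_primitive_prime_elem\<close>.\<close>

theorem factorial_type_poly:
  assumes f: "factorial_type TYPE('a::idom)"
  shows "factorial_type TYPE('a poly)"
proof -
  have "prime_product h" if "h \<noteq> 0" for h :: "'a poly"
    using that
  proof (induction "Polynomial.degree h" arbitrary: h rule: less_induct)
    case (less h)
    note IH = less.hyps
    have main: "prime_product k"
      if "Polynomial.degree k = Polynomial.degree h" "u dvd 1" "\<forall>p\<in>#ps. prime_elem p"
        "Polynomial.lead_coeff k = u * prod_mset ps" "k \<noteq> 0" for k :: "'a poly" and u ps
      using that
    proof (induction "size ps" arbitrary: k ps u rule: less_induct)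
      case (less ps k u)
      note n = less.prems
      show ?case
      proof (cases "\<exists>p. prime_elem p \<and> [:p:] dvd k")
        case True
        then obtain p where p: "prime_elem p" "[:p:] dvd k" by blast
        then have p0: "p \<noteq> 0" by auto
        obtain k1 where k1: "k = [:p:] * k1" using p(2) by (auto elim: dvdE)
        then have k10: "k1 \<noteq> 0" using n by auto
        have deg: "Polynomial.degree k1 = Polynomial.degree k" using k1 p0 by simp
        have lc: "Polynomial.lead_coeff k = p * Polynomial.lead_coeff k1" using k1 p0 by simp
        then have "p dvd u * prod_mset ps" using n by (metis dvd_triv_left)
        then obtain q where q: "q \<in># ps" "p dvd q"
          using prime_dvd_prod_mset_prime_elems[OF p(1) n(2)] by blast
        then obtain w where w: "q = p * w" by (auto elim: dvdE)
        have "prime_elem q" using q(1) n by auto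
        then have "q dvd p \<or> q dvd w" using w by (metis dvd_refl prime_elem_dvd_multD)
        \<comment> \<open>The prime q = p w divides p or w. In the first case w is a unit; in the
          second p would be one.\<close>
        have "w dvd 1"
        proof -
          from \<open>q dvd p \<or> q dvd w\<close> consider r where "p = q * r" | r where "w = q * r"
            by (auto elim: dvdE)
          then show ?thesis
          proof cases
            case 1
            then have "p * 1 = p * (w * r)" using w by (simp add: mult.assoc)
            then show ?thesis using p0 by (metis dvd_triv_left mult_cancel_left)
          next
            case 2
            have "w \<noteq> 0" using \<open>prime_elem q\<close> w by auto
            have "w * 1 = p * w * r" using w 2 by simp
            also have "\<dots> = w * (p * r)" by (simp only: mult_ac)
            finally have "w * 1 = w * (p * r)" .
            then have "p dvd 1" using \<open>w \<noteq> 0\<close> by (metis dvd_triv_left mult_cancel_left)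
            then show ?thesis using p(1) by (auto simp: prime_elem_def)
          qed
        qed
        define ps' where "ps' = ps - {#q#}"
        have ps: "ps = add_mset q ps'" using q(1) by (simp add: ps'_def)
        have "p * Polynomial.lead_coeff k1 = p * (u * w * prod_mset ps')"
          using lc n(4) ps w by (metis mult.assoc mult.left_commute prod_mset.add_mset)
        then have "Polynomial.lead_coeff k1 = u * w * prod_mset ps'" using p0 by simp
        moreover have "u * w dvd 1" using n(2) \<open>w dvd 1\<close> mult_dvd_mono[of u 1 w 1] by simp
        ultimately have "prime_product k1" using less.hyps[of ps' k1 "u * w"] n ps deg k10 by auto
        then show ?thesis
          using k1 prime_product_mult prime_product_prime[OF const_poly_prime_elem[OF p(1)]] by blast
      next
        case prim: False
        show ?thesis
        proof (cases "\<exists>g q. k = g * q \<and> Polynomial.degree g > 0 \<and> Polynomial.degree q > 0")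
          case True
          then obtain g q where gq: "k = g * q" "Polynomial.degree g > 0" "Polynomial.degree q > 0" by blast
          then have "g \<noteq> 0" "q \<noteq> 0" by auto
          then have "Polynomial.degree k = Polynomial.degree g + Polynomial.degree q"
            using gq(1) by (simp add: degree_mult_eq)
          then show ?thesis using IH[of g] IH[of q] gq n(1) \<open>g \<noteq> 0\<close> \<open>q \<noteq> 0\<close>
            by (auto intro: prime_product_mult)
        next
          case False
          show ?thesis
          proof (cases "Polynomial.degree k = 0")
            case True
            then obtain c where c: "k = [:c:]" by (rule degree_eq_zeroE)
            then have "c \<noteq> 0" using n by auto
            have "c dvd 1"
            proof (rule ccontr)
              assume "\<not> c dvd 1"
              then obtain p where "prime_elem p" "p dvd c"
                using factorial_type_prime_divisor[OF f \<open>c \<noteq> 0\<close>] by blast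
              then show False using prim c by (auto simp: const_poly_dvd_const_poly_iff)
            qed
            then have "k dvd 1" using c by (simp add: is_unit_const_poly_iff)
            then show ?thesis by (rule prime_product_unit)
          next
            case nz: False
            show ?thesis

            proof (rule prime_product_prime, rule irreducible_primitive_prime_elem[OF f])
              show "\<not> [:p:] dvd k" if "prime_elem p" for p using prim that by blast
              show "Polynomial.degree g = 0 \<or> Polynomial.degree q = 0" if "k = g * q" for g q
                using False that by (metis neq0_conv)
            qed (use nz in simp)
          qed
        qed
      qed
    qed
    have "Polynomial.lead_coeff h \<noteq> 0" using less.prems by simp
    from factorial_typeE[OF f this] obtain u ps where "u dvd 1" "\<forall>p\<in>#ps. prime_elem p"
      "Polynomial.lead_coeff h = u * prod_mset ps" .
    then show ?case using main[of h u ps] less.prems by auto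
  qed
  then show ?thesis unfolding factorial_type_def prime_product_def by blast
qed

lemma factorial_type_poly3: "factorial_type TYPE(('k::field) poly3)"
  by (intro factorial_type_poly factorial_type_field)

section \<open>Heights of primes\<close>

text \<open>A longer chain is cut to its last \<open>Suc n\<close> steps, so it suffices to refute
  chains of exactly that length.\<close>

lemma prime_height_le:
  assumes "\<And>C. \<forall>i\<le>Suc n. primeideal (C i) A \<Longrightarrow> \<forall>i\<le>n. C i \<subset> C (Suc i) \<Longrightarrow> C (Suc n) = P \<Longrightarrow> False"
  shows "prime_height A P \<le> enat n"
  unfolding prime_height_def
proof (rule Sup_least, clarify)
  fix m C
  assume C: "\<forall>i\<le>m. primeideal (C i) A" "\<forall>i<m. C i \<subset> C (Suc i)" "P = C m"
  show "enat m \<le> enat n"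
  proof (rule ccontr)
    assume "\<not> enat m \<le> enat n"
    then have m: "Suc n \<le> m" by simp
    show False
    proof (rule assms[of "\<lambda>i. C (i + (m - Suc n))"])
      show "\<forall>i\<le>n. C (i + (m - Suc n)) \<subset> C (Suc i + (m - Suc n))"
        using C(2) m by simp
    qed (use C m in auto)
  qed
qed

lemma prime_height_ge:
  assumes "\<forall>i\<le>n. primeideal (C i) A" "\<forall>i<n. C i \<subset> C (Suc i)" "C n = P"
  shows "enat n \<le> prime_height A P"
  unfolding prime_height_def using assms by (intro Sup_upper) blast

lemma prime_height_ge_2:
  assumes "primeideal Q0 A" "primeideal Q1 A" "primeideal Q2 A" "primeideal P A"
    "Q0 \<subset> Q1" "Q1 \<subset> Q2" "Q2 \<subseteq> P"
  shows "2 \<le> prime_height A P"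
proof (cases "Q2 = P")
  case True
  have "enat 2 \<le> prime_height A P"
    by (rule prime_height_ge[of _ "\<lambda>i. if i = 0 then Q0 else if i = 1 then Q1 else Q2"])
      (use assms True in \<open>auto simp: less_Suc_eq numeral_2_eq_2\<close>)
  then show ?thesis by (simp add: numeral_eq_enat)
next
  case False
  have "enat 3 \<le> prime_height A P"
    by (rule prime_height_ge[of _ "\<lambda>i. if i = 0 then Q0 else if i = 1 then Q1 else if i = 2 then Q2 else P"])
      (use assms False in \<open>auto simp: less_Suc_eq numeral_3_eq_3 numeral_2_eq_2\<close>)
  then show ?thesis by (auto simp: numeral_eq_enat intro: order_trans[rotated])
qed

text \<open>A nonzero prime inside (p) contains a prime factor \<open>r\<close> of one of its
  elements. Then p divides r, two such primes are associated, and the smaller prime is already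
  (p).\<close>

lemma prime_height_principal_le:
  fixes p :: "'a::idom"
  assumes f: "factorial_type TYPE('a)" and p: "prime_elem p"
  shows "prime_height ring_of_type_algebra {a. p dvd a} \<le> 1"
proof -
  have "prime_height ring_of_type_algebra {a. p dvd a} \<le> enat 1"
  proof (rule prime_height_le)
    fix C :: "nat \<Rightarrow> 'a set"
    assume C: "\<forall>i\<le>Suc 1. primeideal (C i) ring_of_type_algebra" "\<forall>i\<le>1. C i \<subset> C (Suc i)"
      "C (Suc 1) = {a. p dvd a}"
    have C0: "primeideal (C 0) ring_of_type_algebra" and C1: "primeideal (C 1) ring_of_type_algebra"
      using C(1) by auto
    have ss: "C 0 \<subset> C 1" "C 1 \<subset> {a. p dvd a}" using C(2,3) by (auto simp: le_Suc_eq)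
    obtain q where q: "q \<in> C 1" "q \<noteq> 0"
      using ss(1) type_idealD(1)[OF type_primeidealD(1)[OF C0]] by blast
    obtain u ps where u: "u dvd 1" "\<forall>r\<in>#ps. prime_elem r" "q = u * prod_mset ps"
      using factorial_typeE[OF f q(2)] .
    have "u * prod_mset qs \<in> C 1 \<Longrightarrow> \<exists>r\<in>#qs. r \<in> C 1" for qs
    proof (induction qs)
      case empty
      then have "u \<in> C 1" by simp
      moreover obtain v where "1 = u * v" using u(1) by (auto elim: dvdE)
      ultimately show ?case
        using type_idealD(4)[OF type_primeidealD(1)[OF C1], of u v] type_primeidealD(2)[OF C1] by simp
    next
      case (add r qs)
      then have "r * (u * prod_mset qs) \<in> C 1" by (simp add: mult.left_commute)
      then show ?case using type_primeidealD(3)[OF C1] add.IH by auto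
    qed
    then obtain r where r: "prime_elem r" "r \<in> C 1" using u q(1) by blast
    then obtain w where w: "r = p * w" using ss(2) by (auto elim: dvdE)
    have "r dvd p"
    proof (rule ccontr)
      assume "\<not> r dvd p"
      then have "r dvd w" using r(1) w by (metis dvd_refl prime_elem_dvd_multD)
      then obtain t where "w = r * t" by (auto elim: dvdE)
      then have "r * 1 = r * (p * t)" using w by (metis mult.assoc mult.commute mult_1_right)
      moreover have "r \<noteq> 0" using r(1) by auto
      ultimately have "p dvd 1" by (metis dvd_triv_left mult_cancel_left)
      then show False using p by (simp add: prime_elem_def)
    qed
    then have "p \<in> C 1" using type_idealD(4)[OF type_primeidealD(1)[OF C1] r(2)] by (auto elim: dvdE)
    then have "{a. p dvd a} \<subseteq> C 1"
      using type_idealD(4)[OF type_primeidealD(1)[OF C1]] by (auto elim: dvdE)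
    then show False using ss(2) by blast
  qed
  then show ?thesis by (simp add: one_enat_def)
qed

text \<open>A prime of \<open>A[t]\<close> meeting \<open>A\<close> trivially corresponds to a prime of the principal ideal
  domain \<open>Frac(A)[t]\<close>, so it cannot properly contain a nonzero prime.\<close>

lemma prime_chain_elimination:
  fixes P Q :: "'a::idom poly set"
  assumes P: "primeideal P ring_of_type_algebra" and Q: "primeideal Q ring_of_type_algebra"
    and "Q \<subset> P" and "\<exists>q\<in>Q. q \<noteq> 0"
  shows "\<exists>c. c \<noteq> 0 \<and> [:c:] \<in> P"
proof (rule ccontr)
  assume neg: "\<nexists>c. c \<noteq> 0 \<and> [:c:] \<in> P"
  note PI = type_idealD[OF type_primeidealD(1)[OF P]]
  note QI = type_idealD[OF type_primeidealD(1)[OF Q]]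
  have least: thesis if "q \<in> S" "q \<noteq> 0" "\<And>g. g \<in> S \<Longrightarrow> g \<noteq> 0 \<Longrightarrow>
      (\<And>h. h \<in> S \<Longrightarrow> h \<noteq> 0 \<Longrightarrow> Polynomial.degree g \<le> Polynomial.degree h) \<Longrightarrow> thesis"
    for q and S :: "'a poly set" and thesis
    using that ex_has_least_nat[of "\<lambda>g. g \<in> S \<and> g \<noteq> 0" q Polynomial.degree] by auto
  obtain q0 where q0: "q0 \<in> Q" "q0 \<noteq> 0" using assms(4) by blast
  obtain q where q: "q \<in> Q" "q \<noteq> 0" "\<And>h. h \<in> Q \<Longrightarrow> h \<noteq> 0 \<Longrightarrow> Polynomial.degree q \<le> Polynomial.degree h"
    by (rule least[OF q0]) (rule that)
  have "q \<in> P" using q(1) \<open>Q \<subset> P\<close> by blast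
  obtain g where g: "g \<in> P" "g \<noteq> 0" "\<And>h. h \<in> P \<Longrightarrow> h \<noteq> 0 \<Longrightarrow> Polynomial.degree g \<le> Polynomial.degree h"
    by (rule least[OF \<open>q \<in> P\<close> q(2)]) (rule that)
  have div: "\<exists>a u. a \<noteq> 0 \<and> smult a p = g * u" if "p \<in> P" for p
  proof -
    obtain a u where a: "a \<noteq> 0" "smult a p = g * u + pseudo_mod p g"
      using pseudo_mod(1)[OF g(2)] by blast
    then have "pseudo_mod p g = [:a:] * p - u * g" by (simp add: algebra_simps)
    then have "pseudo_mod p g \<in> P" using PI(6)[OF PI(3)[OF that] PI(3)[OF g(1)], of "[:a:]" u] by simp
    then have "pseudo_mod p g = 0"
      using pseudo_mod(2)[OF g(2), of p] g(3)[of "pseudo_mod p g"] by linarith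
    then show ?thesis using a by auto
  qed
  obtain a u where a: "a \<noteq> 0" "smult a q = g * u" using div q(1) \<open>Q \<subset> P\<close> by blast
  have "Polynomial.degree g > 0"
  proof (rule ccontr)
    assume "\<not> Polynomial.degree g > 0"
    then obtain c where "g = [:c:]" by (auto elim: degree_eq_zeroE)
    then show False using neg g by auto
  qed
  have "u \<noteq> 0" using a q(2) by auto
  have "Polynomial.degree (smult a q) = Polynomial.degree g + Polynomial.degree u"
    using a \<open>u \<noteq> 0\<close> g(2) by (simp add: degree_mult_eq)
  \<comment> \<open>\<open>u\<close> has smaller degree than \<open>q\<close>, whose degree is least
    in \<open>Q\<close>.\<close>
  then have "u \<notin> Q" using q(3)[of u] a(1) \<open>u \<noteq> 0\<close> \<open>Polynomial.degree g > 0\<close> by auto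
  moreover have "[:a:] * q \<in> Q" using QI(3)[OF q(1)] .
  then have "g * u \<in> Q" using a(2) by simp
  ultimately have "g \<in> Q" using type_primeidealD(3)[OF Q] by blast
  have "p \<in> Q" if p: "p \<in> P" for p
  proof -
    obtain a u where a: "a \<noteq> 0" "smult a p = g * u" using div[OF p] by blast
    then have "[:a:] * p \<in> Q" using QI(4)[OF \<open>g \<in> Q\<close>, of u] by simp
    moreover have "[:a:] \<notin> Q" using neg a(1) \<open>Q \<subset> P\<close> by blast
    ultimately show ?thesis using type_primeidealD(3)[OF Q] by blast
  qed
  then show False using \<open>Q \<subset> P\<close> by blast
qed

section \<open>Coefficients and coordinate primes of $k[x,y,z]$\<close>

abbreviation cf :: "('k::field) poly3 \<Rightarrow> nat \<Rightarrow> nat \<Rightarrow> nat \<Rightarrow> 'k" where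
  "cf p i j l \<equiv> Polynomial.coeff (Polynomial.coeff (Polynomial.coeff p l) j) i"

lemma poly3_eqI: "(\<And>i j l. cf p i j l = cf q i j l) \<Longrightarrow> p = q"
  by (intro poly_eqI)

lemma cf_var_x: "cf (var_x * p) i j l = (case i of 0 \<Rightarrow> 0 | Suc i' \<Rightarrow> cf p i' j l)"
  by (simp add: var_x_def coeff_pCons split: nat.split)

lemma cf_var_y: "cf (var_y * p) i j l = (case j of 0 \<Rightarrow> 0 | Suc j' \<Rightarrow> cf p i j' l)"
  by (simp add: var_y_def coeff_pCons split: nat.split)

lemma cf_var_z: "cf (var_z * p) i j l = (case l of 0 \<Rightarrow> 0 | Suc l' \<Rightarrow> cf p i j l')"
  by (simp add: var_z_def coeff_pCons split: nat.split)

text \<open>Division by a variable that drops the terms it does not divide; subtracting the variable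
  times the shift reduces modulo that variable.\<close>

definition shift_x :: "('k::field) poly3 \<Rightarrow> 'k poly3" where
  "shift_x = map_poly (map_poly (poly_shift 1))"
definition shift_y :: "('k::field) poly3 \<Rightarrow> 'k poly3" where
  "shift_y = map_poly (poly_shift 1)"
definition shift_z :: "('k::field) poly3 \<Rightarrow> 'k poly3" where
  "shift_z = poly_shift 1"

lemma cf_shift:
  "cf (shift_x p) i j l = cf p (Suc i) j l"
  "cf (shift_y p) i j l = cf p i (Suc j) l"
  "cf (shift_z p) i j l = cf p i j (Suc l)"
  by (simp_all add: shift_x_def shift_y_def shift_z_def coeff_map_poly coeff_poly_shift)

section \<open>The coordinate primes (x), (x,y) and (x,z), described by vanishing
  coefficients\<close>

definition prime_x :: "('k::field) poly3 set" where "prime_x = {p. var_x dvd p}"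
definition prime_xy :: "('k::field) poly3 set" where "prime_xy = {p. \<forall>l. cf p 0 0 l = 0}"
definition prime_xz :: "('k::field) poly3 set" where "prime_xz = {p. \<forall>j. cf p 0 j 0 = 0}"

lemma prime_elem_pCons_0_1: "prime_elem ([:0, 1:] :: 'a::idom poly)"
proof (rule prime_elemI)
  have dvd: "[:0, 1:] dvd p \<longleftrightarrow> poly p 0 = 0" for p :: "'a poly"
    using poly_eq_0_iff_dvd[of p 0] by simp
  show "\<not> ([:0, 1:] :: 'a poly) dvd 1" by (simp add: dvd)
  show "[:0, 1:] dvd a \<or> [:0, 1:] dvd b" if "[:0, 1:] dvd a * b" for a b :: "'a poly"
    using that by (simp add: dvd)
qed simp

lemma prime_elem_var:
  "prime_elem (var_x :: ('k::field) poly3)" "prime_elem (var_y :: ('k::field) poly3)"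
  "prime_elem (var_z :: ('k::field) poly3)"
  unfolding var_x_def var_y_def var_z_def
  by (intro lift_prime_elem_poly prime_elem_pCons_0_1)+

lemma mem_prime_x_iff: "p \<in> prime_x \<longleftrightarrow> (\<forall>j l. cf p 0 j l = 0)"
proof
  assume "\<forall>j l. cf p 0 j l = 0"
  then have "p = var_x * shift_x p"
    by (intro poly3_eqI) (auto simp: cf_var_x cf_shift split: nat.split)
  then show "p \<in> prime_x" unfolding prime_x_def by (metis CollectI dvd_triv_left)
qed (auto simp: prime_x_def cf_var_x elim!: dvdE)

lemma var_z_dvd_iff: "var_z dvd p \<longleftrightarrow> (\<forall>i j. cf p i j 0 = 0)"
proof
  assume "\<forall>i j. cf p i j 0 = 0"
  then have "p = var_z * shift_z p"
    by (intro poly3_eqI) (auto simp: cf_var_z cf_shift split: nat.split)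
  then show "var_z dvd p" by (metis dvd_triv_left)
qed (auto simp: cf_var_z elim!: dvdE)

lemma var_y_dvd_iff: "var_y dvd p \<longleftrightarrow> (\<forall>i l. cf p i 0 l = 0)"
proof
  assume "\<forall>i l. cf p i 0 l = 0"
  then have "p = var_y * shift_y p"
    by (intro poly3_eqI) (auto simp: cf_var_y cf_shift split: nat.split)
  then show "var_y dvd p" by (metis dvd_triv_left)
qed (auto simp: cf_var_y elim!: dvdE)

lemma mem_prime_xy_iff: "p \<in> prime_xy \<longleftrightarrow> (\<exists>u v. p = var_x * u + var_y * v)"
proof
  assume "p \<in> prime_xy"
  then have "p = var_x * shift_x p + var_y * shift_y (p - var_x * shift_x p)"
    by (intro poly3_eqI) (auto simp: cf_var_x cf_var_y cf_shift prime_xy_def split: nat.split)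
  then show "\<exists>u v. p = var_x * u + var_y * v" by blast
qed (auto simp: cf_var_x cf_var_y prime_xy_def)

lemma mem_prime_xz_iff: "p \<in> prime_xz \<longleftrightarrow> (\<exists>u v. p = var_x * u + var_z * v)"
proof
  assume "p \<in> prime_xz"
  then have "p = var_x * shift_x p + var_z * shift_z (p - var_x * shift_x p)"
    by (intro poly3_eqI) (auto simp: cf_var_x cf_var_z cf_shift prime_xz_def split: nat.split)
  then show "\<exists>u v. p = var_x * u + var_z * v" by blast
qed (auto simp: cf_var_x cf_var_z prime_xz_def)

lemma primeideal_prime_x: "primeideal (prime_x :: ('k::field) poly3 set) R3"
  unfolding prime_x_def by (rule type_principal_primeideal[OF prime_elem_var(1)])

text \<open>Setting x = y = 0 is a ring homomorphism \<open>h\<close> to the domain k[z], and this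
  is its kernel.\<close>

lemma primeideal_prime_xy: "primeideal (prime_xy :: ('k::field) poly3 set) R3"
proof -
  have "p \<in> prime_xy \<or> q \<in> prime_xy" if pq: "p * q \<in> prime_xy" for p q :: "'k poly3"
  proof -
    define h :: "'k poly3 \<Rightarrow> 'k poly" where
      "h = map_poly (\<lambda>q. Polynomial.coeff (Polynomial.coeff q 0) 0)"
    have h: "p \<in> prime_xy \<longleftrightarrow> h p = 0" for p
      by (auto simp: prime_xy_def h_def poly_eq_iff coeff_map_poly)
    have "h (p * q) = h p * h q"
      by (intro poly_eqI) (simp add: h_def coeff_map_poly coeff_mult coeff_sum coeff_mult_0)
    then show ?thesis using pq by (simp add: h)
  qed
  moreover have "ideal (prime_xy :: 'k poly3 set) R3"
    unfolding type_ideal_iff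
    by (auto simp: prime_xy_def coeff_mult coeff_sum intro!: sum.neutral)
  moreover have "(1 :: 'k poly3) \<notin> prime_xy" by (auto simp: prime_xy_def intro!: exI[of _ 0])
  ultimately show ?thesis by (auto simp: type_primeideal_iff)
qed

text \<open>Exchanges the two outer variables, which are y and z for \<open>poly3\<close>; it
  carries chains of primes between (x,y) and (x,z).\<close>

definition swap_yz :: "'a::comm_semiring_0 poly poly \<Rightarrow> 'a poly poly" where
  "swap_yz p = (\<Sum>l\<le>Polynomial.degree p. map_poly (\<lambda>a. Polynomial.monom a l) (Polynomial.coeff p l))"

lemma coeff_swap_yz [simp]:
  "Polynomial.coeff (Polynomial.coeff (swap_yz p) i) j = Polynomial.coeff (Polynomial.coeff p j) i"
proof -
  have "Polynomial.coeff (Polynomial.coeff (swap_yz p) i) j =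
      (\<Sum>l\<le>Polynomial.degree p. if l = j then Polynomial.coeff (Polynomial.coeff p l) i else 0)"
    by (auto simp: swap_yz_def coeff_sum coeff_map_poly intro!: sum.cong)
  also have "\<dots> = Polynomial.coeff (Polynomial.coeff p j) i"
    by (auto simp: coeff_eq_0)
  finally show ?thesis .
qed

lemma swap_yz_swap_yz [simp]: "swap_yz (swap_yz p) = p"
  by (intro poly_eqI) simp

lemma swap_yz_add: "swap_yz (p + q) = swap_yz p + swap_yz q"
  by (intro poly_eqI) simp

lemma swap_yz_mult: "swap_yz (p * q) = swap_yz p * swap_yz q"
  by (intro poly_eqI) (simp add: coeff_mult coeff_sum, rule sum.swap)

lemma swap_yz_0_1 [simp]: "swap_yz 0 = 0" "swap_yz (1 :: 'a::comm_semiring_1 poly poly) = 1"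
  by (auto intro!: poly_eqI)

lemma swap_yz_primeideal:
  fixes P :: "'a::comm_ring_1 poly poly set"
  assumes "primeideal P ring_of_type_algebra"
  shows "primeideal (swap_yz -` P) ring_of_type_algebra"
  using assms unfolding type_primeideal_iff type_ideal_iff
  by (simp add: swap_yz_add swap_yz_mult)

lemma swap_yz_prime: "swap_yz -` prime_xy = prime_xz" "swap_yz -` prime_xz = prime_xy"
  by (auto simp: prime_xy_def prime_xz_def)

lemma primeideal_prime_xz: "primeideal (prime_xz :: ('k::field) poly3 set) R3"
  using swap_yz_primeideal[OF primeideal_prime_xy] by (simp add: swap_yz_prime)

lemma prime_x_psubset: "{0} \<subset> (prime_x :: ('k::field) poly3 set)"
  "prime_x \<subset> (prime_xy :: 'k poly3 set)" "prime_x \<subset> (prime_xz :: 'k poly3 set)"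
proof -
  have "var_x \<in> (prime_x :: 'k poly3 set)" "var_x \<noteq> (0 :: 'k poly3)" "(0 :: 'k poly3) \<in> prime_x"
    by (simp_all add: prime_x_def var_x_def)
  then show "{0} \<subset> (prime_x :: 'k poly3 set)" by blast
  have "cf var_y 0 1 0 = (1::'k)" "cf var_z 0 0 1 = (1::'k)" by (simp_all add: var_y_def var_z_def)
  then have nx: "var_y \<notin> (prime_x :: 'k poly3 set)" "var_z \<notin> (prime_x :: 'k poly3 set)"
    unfolding mem_prime_x_iff by (metis zero_neq_one)+
  have "var_y \<in> (prime_xy :: 'k poly3 set)" "var_z \<in> (prime_xz :: 'k poly3 set)"
    by (auto simp: prime_xy_def prime_xz_def var_y_def var_z_def coeff_pCons split: nat.splits)
  moreover have "prime_x \<subseteq> (prime_xy :: 'k poly3 set)" "prime_x \<subseteq> (prime_xz :: 'k poly3 set)"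
    by (auto simp: mem_prime_x_iff prime_xy_def prime_xz_def)
  ultimately show "prime_x \<subset> (prime_xy :: 'k poly3 set)" "prime_x \<subset> (prime_xz :: 'k poly3 set)"
    using nx by blast+
qed

lemma prime_height_supset_ge_2:
  fixes P :: "('k::field) poly3 set"
  assumes "primeideal P R3" "prime_xy \<subseteq> P \<or> prime_xz \<subseteq> P"
  shows "2 \<le> prime_height R3 P"
  using assms(2) prime_height_ge_2[OF type_zero_primeideal primeideal_prime_x _ assms(1)]
    prime_x_psubset primeideal_prime_xy primeideal_prime_xz by blast

text \<open>A nonzero element of $k[x,y]$ lying in $(x,z)$ is divisible by \<open>x\<close>.\<close>

lemma var_x_mem_of_const_mem:
  fixes P :: "('k::field) poly3 set"
  assumes P: "primeideal P R3" "P \<subseteq> prime_xz" and c: "c \<noteq> 0" "[:c:] \<in> P"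
  shows "var_x \<in> P"
  using c
\<comment> \<open>The measure is the degree in x of the coefficient of the highest power of y;
  dividing by x lowers it by one.\<close>
proof (induction "Polynomial.degree (Polynomial.lead_coeff c)" arbitrary: c rule: less_induct)
  case (less c)
  then have "[:c:] \<in> prime_xz" using P(2) by blast
  then have "Polynomial.coeff (Polynomial.coeff c j) 0 = 0" for j
    unfolding prime_xz_def by simp
  then have c: "c = smult [:0, 1:] (map_poly (poly_shift 1) c)"
    by (intro poly_eqI) (simp add: coeff_map_poly coeff_poly_shift coeff_pCons split: nat.splits)
  define c' where "c' = map_poly (poly_shift 1) c"
  have eq: "[:c:] = var_x * [:c':]" by (subst c) (simp add: var_x_def c'_def)
  have "c' \<noteq> 0" using less.prems c by (auto simp: c'_def)
  have "Polynomial.degree c = Polynomial.degree c'" using c by (metis c'_def degree_smult_eq pCons_eq_0_iff zero_neq_one)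
  then have "Polynomial.lead_coeff c = [:0, 1:] * Polynomial.lead_coeff c'"
    by (metis c c'_def coeff_smult)
  moreover have "Polynomial.lead_coeff c' \<noteq> 0" using \<open>c' \<noteq> 0\<close> by simp
  ultimately have "Polynomial.degree (Polynomial.lead_coeff c') < Polynomial.degree (Polynomial.lead_coeff c)"
    by (simp add: degree_mult_eq)
  moreover have "var_x \<in> P \<or> [:c':] \<in> P" using less.prems(2) type_primeidealD(3)[OF P(1)] eq by simp
  ultimately show ?case using less.hyps[of c'] \<open>c' \<noteq> 0\<close> by blast
qed

text \<open>Modulo x every element of \<open>P\<close> is a multiple of z, and z is not in
  \<open>P\<close>, since otherwise \<open>P\<close> would be (x,z). So z can be cancelled, which
  lowers the degree in z.\<close>

lemma prime_between_x_xz: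
  fixes P :: "('k::field) poly3 set"
  assumes P: "primeideal P R3" "P \<subset> prime_xz" and x: "var_x \<in> P"
  shows "P = prime_x"
proof (rule antisym)
  note PI = type_idealD[OF type_primeidealD(1)[OF P(1)]]
  show "prime_x \<subseteq> P" using PI(4)[OF x] by (auto simp: prime_x_def elim: dvdE)
  have z: "var_z \<notin> P"
  proof
    assume z: "var_z \<in> P"
    have "prime_xz \<subseteq> P"
      using PI(2)[OF PI(4)[OF x] PI(4)[OF z]] by (auto simp: mem_prime_xz_iff)
    then show False using P(2) by blast
  qed
  show "P \<subseteq> prime_x"
  proof
    fix p assume "p \<in> P"
    then show "p \<in> prime_x"
    proof (induction "Polynomial.degree p" arbitrary: p rule: less_induct)
      case (less p)
      show ?case
      proof (rule ccontr)
        assume np: "p \<notin> prime_x"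
        define p' where "p' = p - var_x * shift_x p"
        have cf': "cf p' i j l = (if i = 0 then cf p 0 j l else 0)" for i j l
          by (simp add: p'_def cf_var_x cf_shift split: nat.split)
        have p': "p' \<in> P" using PI(6)[OF less.prems PI(4)[OF x]] by (simp add: p'_def)
        then have "p' \<in> prime_xz" using P(2) by blast
        then have "var_z dvd p'" unfolding var_z_dvd_iff by (auto simp: cf' prime_xz_def)
        then obtain q where q: "p' = var_z * q" by (auto elim: dvdE)
        have "q \<in> P" using type_primeidealD(3)[OF P(1)] p' q z by blast
        have "q \<noteq> 0" using np q cf' by (auto simp: mem_prime_x_iff) (metis coeff_0)
        have "Polynomial.degree p' \<le> Polynomial.degree p"
          by (rule degree_le) (auto intro!: poly_eqI simp: cf' coeff_eq_0)
        moreover have "Polynomial.degree p' = Suc (Polynomial.degree q)"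
          using q \<open>q \<noteq> 0\<close> by (simp add: var_z_def)
        ultimately have "q \<in> prime_x" using less.hyps[of q] \<open>q \<in> P\<close> by simp
        then have "p' \<in> prime_x" using q by (simp add: prime_x_def)
        then have "p \<in> prime_x" using cf' by (simp add: mem_prime_x_iff)
        then show False using np by simp
      qed
    qed
  qed
qed

text \<open>In a chain of three steps, elimination of z puts a nonzero element of k[x,y] into
  \<open>C 2\<close>. This forces x into \<open>C 2\<close> and hence \<open>C 2\<close> = (x),
  which is principal and has no chain of length two below it.\<close>

lemma prime_height_prime_xz: "prime_height R3 (prime_xz :: ('k::field) poly3 set) = 2"
proof (rule antisym)
  have "prime_height R3 (prime_xz :: 'k poly3 set) \<le> enat 2"
  proof (rule prime_height_le)
    fix C :: "nat \<Rightarrow> 'k poly3 set"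
    assume C: "\<forall>i\<le>Suc 2. primeideal (C i) R3" "\<forall>i\<le>2. C i \<subset> C (Suc i)" "C (Suc 2) = prime_xz"
    have pr: "primeideal (C 0) R3" "primeideal (C 1) R3" "primeideal (C 2) R3" using C(1) by auto
    have ss: "C 0 \<subset> C 1" "C 1 \<subset> C 2" "C 2 \<subset> prime_xz"
      using C(2)[rule_format, of 0] C(2)[rule_format, of 1] C(2)[rule_format, of 2] C(3)
      by (simp_all add: numeral_2_eq_2)
    have "0 \<in> C 0" using type_idealD(1)[OF type_primeidealD(1)[OF pr(1)]] .
    then have ne: "\<exists>q\<in>C 1. q \<noteq> 0" using ss(1) by (metis psubset_imp_ex_mem Diff_iff)
    obtain c where "c \<noteq> 0" "[:c:] \<in> C 2"
      by (rule exE[OF prime_chain_elimination[OF pr(3,2) ss(2) ne]]) (erule conjE, rule that)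
    then have "var_x \<in> C 2" using var_x_mem_of_const_mem[OF pr(3)] ss(3) by blast
    then have eq: "C 2 = prime_x" using prime_between_x_xz[OF pr(3) ss(3)] by blast
    have "2 \<le> prime_height R3 (C 2)"
      using prime_height_ge_2[OF pr pr(3)] ss by blast
    moreover have "prime_height R3 (C 2) \<le> 1"
      unfolding eq prime_x_def
      by (rule prime_height_principal_le[OF factorial_type_poly3 prime_elem_var(1)])
    ultimately have "(2::enat) \<le> 1" by (rule order_trans)
    then show False by (simp add: numeral_eq_enat one_enat_def)
  qed
  then show "prime_height R3 (prime_xz :: 'k poly3 set) \<le> 2" by (simp add: numeral_eq_enat)
  show "2 \<le> prime_height R3 (prime_xz :: 'k poly3 set)"
    by (rule prime_height_supset_ge_2[OF primeideal_prime_xz]) simp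
qed

text \<open>Exchanging y and z turns chains below (x,y) into chains below (x,z), where z is the
  variable to be eliminated.\<close>

lemma prime_height_prime_xy: "prime_height R3 (prime_xy :: ('k::field) poly3 set) = 2"
proof (rule antisym)
  have "prime_height R3 (prime_xy :: 'k poly3 set) \<le> prime_height R3 (prime_xz :: 'k poly3 set)"
    unfolding prime_height_def
  proof (rule Sup_mono)
    fix a assume "a \<in> {enat n |n. \<exists>C. (\<forall>i\<le>n. primeideal (C i) R3) \<and> (\<forall>i<n. C i \<subset> C (Suc i)) \<and>
        C n = (prime_xy :: 'k poly3 set)}"
    then obtain n and C :: "nat \<Rightarrow> 'k poly3 set" where a: "a = enat n"
      and C: "\<forall>i\<le>n. primeideal (C i) R3" "\<forall>i<n. C i \<subset> C (Suc i)" "C n = prime_xy" by blast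
    let ?D = "\<lambda>i. swap_yz -` C i"
    have mono: "swap_yz -` S \<subset> swap_yz -` T" if ST: "S \<subset> T" for S T :: "'k poly3 set"
    proof -
      obtain t where "t \<in> T" "t \<notin> S" using ST by blast
      then have "swap_yz t \<in> swap_yz -` T" "swap_yz t \<notin> swap_yz -` S" by simp_all
      then show ?thesis using ST by blast
    qed
    have "primeideal (?D i) R3" if "i \<le> n" for i
      by (rule swap_yz_primeideal) (use C(1) that in simp)
    moreover have "?D i \<subset> ?D (Suc i)" if "i < n" for i
      by (rule mono) (use C(2) that in simp)
    moreover have "?D n = prime_xz" unfolding C(3) by (rule swap_yz_prime(1))
    ultimately have "(\<forall>i\<le>n. primeideal (?D i) R3) \<and> (\<forall>i<n. ?D i \<subset> ?D (Suc i)) \<and> ?D n = prime_xz"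
      by simp
    then show "\<exists>b\<in>{enat n |n. \<exists>C. (\<forall>i\<le>n. primeideal (C i) R3) \<and> (\<forall>i<n. C i \<subset> C (Suc i)) \<and>
        C n = (prime_xz :: 'k poly3 set)}. a \<le> b"
      unfolding a by (intro bexI[of _ "enat n"] CollectI exI[of _ n] conjI refl exI[of _ ?D]) simp_all
  qed
  then show "prime_height R3 (prime_xy :: 'k poly3 set) \<le> 2" by (simp add: prime_height_prime_xz)
  show "2 \<le> prime_height R3 (prime_xy :: 'k poly3 set)"
    by (rule prime_height_supset_ge_2[OF primeideal_prime_xy]) simp
qed

section \<open>Dimension counts\<close>

text \<open>The spaces in play sit inside infinite-dimensional ones, and \<open>dim\<close> is a
  \<open>card\<close> that collapses to 0 on infinite bases, so finiteness is carried along. The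
  span is a parameter because several scalar actions occur.\<close>

definition finitely_spanned :: "('b set \<Rightarrow> 'b set) \<Rightarrow> 'b set \<Rightarrow> bool" where
  "finitely_spanned sp V \<longleftrightarrow> (\<exists>B. finite B \<and> V \<subseteq> sp B)"

context vector_space
begin

lemma finite_span_mono: "finitely_spanned span W \<Longrightarrow> V \<subseteq> W \<Longrightarrow> finitely_spanned span V"
  by (auto simp: finitely_spanned_def)

lemma finite_span_basis:
  assumes "finitely_spanned span V"
  obtains B where "B \<subseteq> V" "independent B" "V \<subseteq> span B" "card B = dim V" "finite B"
proof -
  obtain B where B: "B \<subseteq> V" "independent B" "V \<subseteq> span B" "card B = dim V"
    using basis_exists .
  obtain A where A: "finite A" "V \<subseteq> span A" using assms by (auto simp: finitely_spanned_def)
  then have "finite B" using independent_span_bound[OF A(1) B(2)] B(1) by blast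
  then show thesis using that B by blast
qed

lemma dim_mono_finite_span:
  assumes "finitely_spanned span W" "V \<subseteq> W"
  shows "dim V \<le> dim W"
proof -
  obtain B where B: "B \<subseteq> V" "independent B" "V \<subseteq> span B" "card B = dim V" "finite B"
    using finite_span_basis[OF finite_span_mono[OF assms]] .
  obtain A where A: "A \<subseteq> W" "W \<subseteq> span A" "card A = dim W" "finite A"
    using finite_span_basis[OF assms(1)] by metis
  have "B \<subseteq> span A" using A B assms(2) by blast
  then show ?thesis using independent_span_bound[OF A(4) B(2)] A B by simp
qed

lemma span_Int_span_disjoint:
  assumes "independent (A \<union> B)" "A \<inter> B = {}" "v \<in> span A" "v \<in> span B"
  shows "v = 0"
proof -
  have "representation (A \<union> B) v = representation A v" "representation (A \<union> B) v = representation B v"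
    using assms by (auto intro!: representation_extend)
  then have r: "representation A v = representation B v" by simp
  have "representation A v b = 0" for b
  proof (cases "b \<in> A")
    case True
    then have "b \<notin> B" using assms(2) by blast
    then show ?thesis using r representation_ne_zero[of B v b] by metis
  qed (use representation_ne_zero[of A v b] in blast)
  moreover have "independent A" using assms(1) by (rule independent_mono) blast
  ultimately show ?thesis using sum_nonzero_representation_eq[of A v] assms(3) by simp
qed

end

context vector_space_pair
begin

text \<open>A basis of the kernel is extended to one of \<open>V\<close>; the added vectors
  \<open>C\<close> span a complement on which \<open>f\<close> is injective.\<close>

lemma rank_nullity:
  assumes f: "Vector_Spaces.linear s1 s2 f" and V: "vs1.subspace V" and fin: "finitely_spanned vs1.span V"
  shows "vs1.dim V = vs1.dim {v \<in> V. f v = 0} + vs2.dim (f ` V)"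
proof -
  interpret f: Vector_Spaces.linear s1 s2 f by (rule f)
  define K where "K = {v \<in> V. f v = 0}"
  have K: "vs1.subspace K"
    using V unfolding K_def vs1.subspace_def by (auto simp: f.add f.scale f.zero)
  obtain BK where BK: "BK \<subseteq> K" "vs1.independent BK" "K \<subseteq> vs1.span BK" "card BK = vs1.dim K" "finite BK"
  proof -
    have "finitely_spanned vs1.span K" using fin by (rule vs1.finite_span_mono) (simp add: K_def)
    from vs1.finite_span_basis[OF this] that show thesis by metis
  qed
  obtain B where B: "BK \<subseteq> B" "B \<subseteq> V" "vs1.independent B" "V \<subseteq> vs1.span B"
  proof -
    have "BK \<subseteq> V" using BK(1) K_def by blast
    then show thesis using BK(2) by (rule vs1.maximal_independent_subset_extend) (rule that)
  qed
  obtain A where "finite A" "V \<subseteq> vs1.span A" using fin by (auto simp: finitely_spanned_def)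
  then have "finite B" using vs1.independent_span_bound[of A B] B by blast
  define C where "C = B - BK"
  have BC: "B = C \<union> BK" "C \<inter> BK = {}" using B(1) by (auto simp: C_def)
  have "vs1.independent C" using B(3) by (rule vs1.independent_mono) (auto simp: C_def)
  have "C \<subseteq> V" using B(2) by (auto simp: C_def)
  then have sC: "vs1.span C \<subseteq> V" using V by (rule vs1.span_minimal)
  have ker: "v = 0" if "v \<in> vs1.span C" "f v = 0" for v
  proof -
    have "v \<in> K" using that sC by (auto simp: K_def)
    then have "v \<in> vs1.span BK" using BK(3) by blast
    then show ?thesis using vs1.span_Int_span_disjoint[of C BK v] B(3) BC that(1) by simp
  qed
  have inj: "inj_on f (vs1.span C)"
  proof (rule inj_onI)
    fix u v assume uv: "u \<in> vs1.span C" "v \<in> vs1.span C" "f u = f v"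
    then have "u - v \<in> vs1.span C" "f (u - v) = 0" by (auto simp: vs1.span_diff f.diff)
    then have "u - v = 0" by (rule ker)
    then show "u = v" by simp
  qed
  then have "inj_on f C" by (rule inj_on_subset) (rule vs1.span_superset)
  have ind: "vs2.independent (f ` C)"
    by (rule f.independent_injective_image[OF \<open>vs1.independent C\<close> inj])
  have "f ` V \<subseteq> vs2.span (f ` C)"
  proof
    fix w assume "w \<in> f ` V"
    then have "w \<in> f ` vs1.span B" using B(4) by blast
    then have "w \<in> vs2.span (f ` B)" by (simp add: f.span_image)
    moreover have "f ` B \<subseteq> vs2.span (f ` C)"
    proof
      fix y assume "y \<in> f ` B"
      then consider b where "b \<in> C" "y = f b" | b where "b \<in> BK" "y = f b" using BC(1) by blast
      then show "y \<in> vs2.span (f ` C)"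
      proof cases
        case 1 then show ?thesis by (auto intro: vs2.span_base)
      next
        case 2 then show ?thesis using BK(1) by (auto simp: K_def vs2.span_zero)
      qed
    qed
    ultimately show "w \<in> vs2.span (f ` C)" using vs2.span_minimal vs2.subspace_span by blast
  qed
  then have "card (f ` C) = vs2.dim (f ` V)"
    using ind \<open>C \<subseteq> V\<close> by (intro vs2.basis_card_eq_dim) auto
  moreover have "card (f ` C) = card C" by (rule card_image[OF \<open>inj_on f C\<close>])
  moreover have "card B = vs1.dim V" using B by (intro vs1.basis_card_eq_dim) auto
  moreover have "card B = card C + card BK"
    using BC \<open>finite B\<close> by (simp add: card_Un_disjoint)
  ultimately show ?thesis using BK(4) by (simp add: K_def)
qed

lemma dim_image_injective:
  assumes f: "Vector_Spaces.linear s1 s2 f" and V: "vs1.subspace V" and fin: "finitely_spanned vs1.span V"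
    and inj: "\<And>v. v \<in> V \<Longrightarrow> f v = 0 \<Longrightarrow> v = 0"
  shows "vs2.dim (f ` V) = vs1.dim V"
proof -
  have "{v \<in> V. f v = 0} = {0}"
    using inj f V by (auto simp: vs1.subspace_0 linear_0)
  moreover have "vs1.dim {0} = 0" using vs1.dim_le_card[of "{0}" "{}"] by (simp add: vs1.span_zero)
  ultimately show ?thesis using rank_nullity[OF f V fin] by simp
qed

end

section \<open>Homogeneous components\<close>

lemma kscale_coeff [simp]: "cf (kscale c p) i j l = c * cf p i j l"
  by (simp add: kscale_def)

lemma kscale_conv_mult: "kscale c p = [:[:[:c:]:]:] * p"
  by (simp add: kscale_def)

section \<open>Monomials and polynomials with prescribed support\<close>

definition mon :: "nat \<Rightarrow> nat \<Rightarrow> nat \<Rightarrow> ('k::field) poly3" where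
  "mon i j l = Polynomial.monom (Polynomial.monom (Polynomial.monom 1 i) j) l"

lemma cf_mon: "cf (mon i j l) i' j' l' = (if i = i' \<and> j = j' \<and> l = l' then 1 else 0)"
  by (simp add: mon_def)

lemma mon_conv_var: "mon i j l = var_x ^ i * var_y ^ j * var_z ^ l"
proof -
  have x: "var_x ^ i = [:[:Polynomial.monom 1 i:]:]" for i
    by (induction i) (simp_all add: var_x_def monom_Suc one_pCons[symmetric])
  have y: "var_y ^ j = [:Polynomial.monom 1 j:]" for j
    by (induction j) (simp_all add: var_y_def monom_Suc one_pCons[symmetric])
  have z: "var_z ^ l = Polynomial.monom 1 l" for l
    by (induction l) (simp_all add: var_z_def monom_Suc)
  show ?thesis by (simp add: x y z mon_def smult_monom)
qed

lemma mon_mult: "mon i j l * mon i' j' l' = mon (i + i') (j + j') (l + l')"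
  by (simp add: mon_def mult_monom)

definition supported :: "(nat \<times> nat \<times> nat) set \<Rightarrow> ('k::field) poly3 set" where
  "supported S = {p. \<forall>i j l. cf p i j l \<noteq> 0 \<longrightarrow> (i, j, l) \<in> S}"

definition poly3_of :: "(nat \<times> nat \<times> nat) set \<Rightarrow> (nat \<times> nat \<times> nat \<Rightarrow> 'k) \<Rightarrow> ('k::field) poly3" where
  "poly3_of S g = (\<Sum>t\<in>S. kscale (g t) (case t of (i, j, l) \<Rightarrow> mon i j l))"

lemma cf_poly3_of:
  assumes "finite S"
  shows "cf (poly3_of S g) i j l = (if (i, j, l) \<in> S then g (i, j, l) else 0)"
proof -
  have "cf (poly3_of S g) i j l = (\<Sum>t\<in>S. if t = (i, j, l) then g t else 0)"
    unfolding poly3_of_def coeff_sum by (intro sum.cong) (auto simp: cf_mon split: prod.splits)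
  then show ?thesis using assms by simp
qed

lemma finite_support: "finite {(i, j, l). cf p i j l \<noteq> 0}"
proof (rule finite_subset)
  show "{(i, j, l). cf p i j l \<noteq> 0} \<subseteq>
    (\<lambda>(l, j, i). (i, j, l)) ` (SIGMA l:{..Polynomial.degree p}.
       SIGMA j:{..Polynomial.degree (Polynomial.coeff p l)}.
         {..Polynomial.degree (Polynomial.coeff (Polynomial.coeff p l) j)})"
  proof (clarify)
    fix i j l assume nz: "cf p i j l \<noteq> 0"
    then have "i \<le> Polynomial.degree (Polynomial.coeff (Polynomial.coeff p l) j)" by (rule le_degree)
    moreover have "Polynomial.coeff (Polynomial.coeff p l) j \<noteq> 0" using nz by auto
    then have "j \<le> Polynomial.degree (Polynomial.coeff p l)" by (rule le_degree)
    moreover have "Polynomial.coeff p l \<noteq> 0" using nz by auto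
    then have "l \<le> Polynomial.degree p" by (rule le_degree)
    ultimately show "(i, j, l) \<in> (\<lambda>(l, j, i). (i, j, l)) ` (SIGMA l:{..Polynomial.degree p}.
       SIGMA j:{..Polynomial.degree (Polynomial.coeff p l)}.
         {..Polynomial.degree (Polynomial.coeff (Polynomial.coeff p l) j)})"
      by (intro image_eqI[of _ _ "(l, j, i)"]) auto
  qed
qed auto

lemma supported_subspace: "kvs.subspace (supported S)"
  unfolding kvs.subspace_def supported_def by (simp, metis add_0)

lemma supported_dim:
  fixes S :: "(nat \<times> nat \<times> nat) set"
  assumes S: "finite S"
  shows "kvs.dim (supported S :: ('k::field) poly3 set) = card S"
    and "finitely_spanned kvs.span (supported S :: 'k poly3 set)"
proof -
  define m :: "nat \<times> nat \<times> nat \<Rightarrow> 'k poly3" where "m = (\<lambda>(i, j, l). mon i j l)"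
  have cfm: "cf (m t) i j l = (if t = (i, j, l) then 1 else 0)" for t i j l
    by (auto simp: m_def cf_mon split: prod.splits)
  have inj: "inj m"
  proof (rule injI)
    fix s t assume st: "m s = m t"
    obtain i j l where ijl: "s = (i, j, l)" by (cases s)
    have "cf (m s) i j l = 1" by (simp add: cfm ijl)
    then have "t = (i, j, l)" unfolding st cfm by (metis zero_neq_one)
    then show "s = t" using ijl by simp
  qed
  then have inj_S: "inj_on m S" by (rule inj_on_subset) simp
  have ind: "kvs.independent (m ` S)"
  proof (rule kvs.independent_if_scalars_zero)
    show "finite (m ` S)" using S by simp
    fix g x assume sum0: "(\<Sum>x\<in>m ` S. kscale (g x) x) = 0" and "x \<in> m ` S"
    then obtain t where t: "t \<in> S" "x = m t" by blast
    obtain i j l where ijl: "t = (i, j, l)" by (cases t)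
    have "0 = cf (\<Sum>s\<in>S. kscale (g (m s)) (m s)) i j l"
      using sum0 by (simp add: sum.reindex[OF inj_S])
    also have "\<dots> = (\<Sum>s\<in>S. if s = t then g (m s) else 0)"
      unfolding coeff_sum by (intro sum.cong) (auto simp: cfm ijl)
    finally show "g x = 0" using S t by simp
  qed
  moreover have sp: "(supported S :: 'k poly3 set) \<subseteq> kvs.span (m ` S)"
  proof
    fix p :: "'k poly3" assume "p \<in> supported S"
    then have "p = poly3_of S (\<lambda>(i, j, l). cf p i j l)"
      using S by (intro poly3_eqI) (auto simp: cf_poly3_of supported_def)
    also have "\<dots> = (\<Sum>t\<in>S. kscale ((\<lambda>(i, j, l). cf p i j l) t) (m t))"
      unfolding poly3_of_def by (intro sum.cong) (auto simp: m_def)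
    also have "\<dots> \<in> kvs.span (m ` S)"
      by (intro kvs.span_sum kvs.span_scale kvs.span_base) auto
    finally show "p \<in> kvs.span (m ` S)" .
  qed
  moreover have "m ` S \<subseteq> supported S" by (auto simp: supported_def cfm split: if_splits)
  ultimately have "card (m ` S) = kvs.dim (supported S :: 'k poly3 set)" by (intro kvs.basis_card_eq_dim[OF _ sp ind])
  then show "kvs.dim (supported S :: 'k poly3 set) = card S"
    by (simp add: card_image[OF inj_S])
  show "finitely_spanned kvs.span (supported S :: 'k poly3 set)"
    unfolding finitely_spanned_def using sp S by blast
qed

lemma forms_conv_supported: "forms n = supported {(i, j, l). int (i + j + l) = n}"
  by (auto simp: forms_def supported_def)

lemma finite_degree_set: "finite {(i, j, l). int (i + j + l) = n}"
  by (rule finite_subset[of _ "{..nat n} \<times> {..nat n} \<times> {..nat n}"]) auto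

lemma forms_subspace: "kvs.subspace (forms n)"
  by (simp add: forms_conv_supported supported_subspace)

lemma forms_finite_span: "finitely_spanned kvs.span (forms n)"
  unfolding forms_conv_supported by (rule supported_dim[OF finite_degree_set])

lemma forms_closed:
  "0 \<in> forms n" "p \<in> forms n \<Longrightarrow> q \<in> forms n \<Longrightarrow> p + q \<in> forms n"
  "p \<in> forms n \<Longrightarrow> q \<in> forms n \<Longrightarrow> p - q \<in> forms n" "p \<in> forms n \<Longrightarrow> - p \<in> forms n"
  "p \<in> forms n \<Longrightarrow> kscale c p \<in> forms n"
  using forms_subspace[of n] kvs.subspace_diff kvs.subspace_neg unfolding kvs.subspace_def by blast+

text \<open>The monomials of degree n correspond to the pairs (i, j) with i + j \<le> n. The count
  is doubled to remain a polynomial identity in \<open>nat\<close>.\<close>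

lemma two_dim_forms: "2 * kvs.dim (forms (int n) :: ('k::field) poly3 set) = (n + 1) * (n + 2)"
proof -
  have "{(i, j, l). int (i + j + l) = int n} = (\<lambda>(i, j). (i, j, n - i - j)) ` (SIGMA i:{..n}. {..n - i})"
  proof (intro equalityI subsetI)
    fix t assume "t \<in> {(i, j, l). int (i + j + l) = int n}"
    then obtain i j l where "t = (i, j, l)" "i + j + l = n" by (auto simp flip: of_nat_add)
    then show "t \<in> (\<lambda>(i, j). (i, j, n - i - j)) ` (SIGMA i:{..n}. {..n - i})"
      by (intro image_eqI[of _ _ "(i, j)"]) auto
  qed auto
  moreover have "inj_on (\<lambda>(i, j). (i, j, n - i - j)) (SIGMA i:{..n}. {..n - i})"
    by (auto simp: inj_on_def)
  ultimately have "card {(i, j, l). int (i + j + l) = int n} = card (SIGMA i:{..n}. {..n - i})"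
    by (simp add: card_image)
  also have "\<dots> = (\<Sum>i\<le>n. Suc (n - i))" by simp
  finally have "kvs.dim (forms (int n) :: 'k poly3 set) = (\<Sum>i\<le>n. Suc (n - i))"
    by (simp only: forms_conv_supported supported_dim finite_degree_set)
  moreover have "2 * (\<Sum>i\<le>n. Suc (n - i)) = (n + 1) * (n + 2)"
    by (induction n) (simp_all add: sum.atMost_Suc_shift del: sum.atMost_Suc)
  ultimately show ?thesis by simp
qed

lemma forms_neg: "n < 0 \<Longrightarrow> forms n = {0}"
  by (auto simp: forms_def intro!: poly3_eqI)

lemma mon_forms: "mon i j l \<in> forms (int (i + j + l))"
  by (auto simp: forms_def cf_mon split: if_splits)

lemma cf_mult:
  "cf (p * q) i j l = (\<Sum>c\<le>l. \<Sum>b\<le>j. \<Sum>a\<le>i. cf p a b c * cf q (i - a) (j - b) (l - c))"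
  by (simp add: coeff_mult coeff_sum)

lemma forms_mult:
  assumes "p \<in> forms m" "q \<in> forms n"
  shows "p * q \<in> forms (m + n)"
  unfolding forms_def
proof (clarify)
  fix i j l assume "cf (p * q) i j l \<noteq> 0"
  then obtain c where c: "c \<le> l" "(\<Sum>b\<le>j. \<Sum>a\<le>i. cf p a b c * cf q (i - a) (j - b) (l - c)) \<noteq> 0"
    unfolding cf_mult using sum.not_neutral_contains_not_neutral by (metis (no_types, lifting) atMost_iff)
  then obtain b where b: "b \<le> j" "(\<Sum>a\<le>i. cf p a b c * cf q (i - a) (j - b) (l - c)) \<noteq> 0"
    using sum.not_neutral_contains_not_neutral by (metis (no_types, lifting) atMost_iff)
  then obtain a where a: "a \<le> i" "cf p a b c * cf q (i - a) (j - b) (l - c) \<noteq> 0"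
    using sum.not_neutral_contains_not_neutral by (metis (no_types, lifting) atMost_iff)
  then have "cf p a b c \<noteq> 0" "cf q (i - a) (j - b) (l - c) \<noteq> 0" by auto
  then have "int (a + b + c) = m" "int ((i - a) + (j - b) + (l - c)) = n"
    using assms unfolding forms_def by blast+
  then show "int (i + j + l) = m + n" using a b c by (simp add: of_nat_diff)
qed

text \<open>Homogeneous component. The degree is an integer, so that a shift below degree 0 gives 0
  instead of being truncated.\<close>

definition hc :: "int \<Rightarrow> ('k::field) poly3 \<Rightarrow> 'k poly3" where
  "hc n p = poly3_of ({(i, j, l). cf p i j l \<noteq> 0} \<inter> {(i, j, l). int (i + j + l) = n})
     (\<lambda>(i, j, l). cf p i j l)"

lemma cf_hc: "cf (hc n p) i j l = (if int (i + j + l) = n then cf p i j l else 0)"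
  unfolding hc_def by (subst cf_poly3_of) (auto simp: finite_support)

lemma hc_forms [simp]: "hc n p \<in> forms n"
  by (auto simp: forms_def cf_hc split: if_splits)

lemma hc_add: "hc n (p + q) = hc n p + hc n q"
  by (intro poly3_eqI) (simp add: cf_hc)

lemma hc_0 [simp]: "hc n 0 = 0"
  by (intro poly3_eqI) (simp add: cf_hc)

lemma hc_sum: "hc n (sum f A) = (\<Sum>i\<in>A. hc n (f i))"
  by (induction A rule: infinite_finite_induct) (simp_all add: hc_add)

lemma hc_of_form: "p \<in> forms m \<Longrightarrow> hc n p = (if n = m then p else 0)"
  by (intro poly3_eqI) (auto simp: cf_hc forms_def)

text \<open>The bound may be raised freely, so that several polynomials, or the coordinates of a
  vector, can share one.\<close>

lemma sum_hc: "\<exists>N. \<forall>M\<ge>N. p = (\<Sum>n\<le>M. hc (int n) p)"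
proof -
  have "finite ((\<lambda>(i, j, l). i + j + l) ` {(i, j, l). cf p i j l \<noteq> 0})"
    using finite_support by (rule finite_imageI)
  then obtain N where "\<forall>n\<in>(\<lambda>(i, j, l). i + j + l) ` {(i, j, l). cf p i j l \<noteq> 0}. n \<le> N"
    unfolding finite_nat_set_iff_bounded_le by blast
  then have N: "i + j + l \<le> N" if "cf p i j l \<noteq> 0" for i j l using that by auto
  have "p = (\<Sum>n\<le>M. hc (int n) p)" if "N \<le> M" for M
  proof (intro poly3_eqI)
    fix i j l
    have "cf (\<Sum>n\<le>M. hc (int n) p) i j l = (\<Sum>n\<le>M. if n = i + j + l then cf p i j l else 0)"
      unfolding coeff_sum by (intro sum.cong) (auto simp: cf_hc)
    also have "\<dots> = (if i + j + l \<le> M then cf p i j l else 0)" by simp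
    also have "\<dots> = cf p i j l" using N[where i = i and j = j and l = l] that
      by (cases "cf p i j l = 0") auto
    finally show "cf p i j l = cf (\<Sum>n\<le>M. hc (int n) p) i j l" by simp
  qed
  then show ?thesis by blast
qed

lemma hc_mult_form:
  assumes "q \<in> forms m"
  shows "hc (n + m) (p * q) = hc n p * q"
proof -
  obtain N where N: "p = (\<Sum>k\<le>N. hc (int k) p)" using sum_hc by blast
  have "hc (n + m) (p * q) = hc (n + m) (\<Sum>k\<le>N. hc (int k) p * q)"
    by (subst N) (simp add: sum_distrib_right)
  also have "\<dots> = (\<Sum>k\<le>N. hc n (hc (int k) p) * q)"
    unfolding hc_sum by (intro sum.cong) (auto simp: hc_of_form[OF forms_mult[OF hc_forms assms]] hc_of_form[OF hc_forms])
  also have "\<dots> = hc n (\<Sum>k\<le>N. hc (int k) p) * q"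
    by (simp add: hc_sum sum_distrib_right)
  also have "\<dots> = hc n p * q" using N by simp
  finally show ?thesis .
qed

lemma hc_form_mult:
  assumes "q \<in> forms m"
  shows "hc (n + m) (q * p) = q * hc n p"
  using hc_mult_form[OF assms, of n p] by (simp add: mult.commute)

lemma hc_neg: "n < 0 \<Longrightarrow> hc n p = 0"
  using hc_forms[of n p] by (simp add: forms_neg del: hc_forms)

lemma var_forms: "var_x \<in> forms 1" "var_y \<in> forms 1" "var_z \<in> forms 1"
  using mon_forms[of 1 0 0] mon_forms[of 0 1 0] mon_forms[of 0 0 1] by (simp_all add: mon_conv_var)

lemma const_forms: "[:[:[:c:]:]:] \<in> forms 0"
  by (auto simp: forms_def coeff_pCons split: nat.splits)

lemma one_forms: "1 \<in> forms 0"
  using const_forms[of 1] by (simp add: one_pCons)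

section \<open>The graded module $R^3$ over $k$\<close>

definition kscale3 :: "'k::field \<Rightarrow> 'k vec3 \<Rightarrow> 'k vec3" where
  "kscale3 c = (\<lambda>(p, q, r). (kscale c p, kscale c q, kscale c r))"

interpretation k3: vector_space "kscale3 :: 'k::field \<Rightarrow> 'k vec3 \<Rightarrow> 'k vec3"
  by unfold_locales (auto simp: kscale3_def kvs.scale_right_distrib kvs.scale_left_distrib)

lemma kscale3_conv_scale3: "kscale3 c v = scale3 [:[:[:c:]:]:] v"
  by (auto simp: kscale3_def scale3_def kscale_conv_mult split: prod.splits)

interpretation k_k: vector_space_pair "kscale :: 'k::field \<Rightarrow> 'k poly3 \<Rightarrow> 'k poly3" kscale ..
interpretation k3_k: vector_space_pair "kscale3 :: 'k::field \<Rightarrow> 'k vec3 \<Rightarrow> 'k vec3" kscale ..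
interpretation k_k3: vector_space_pair kscale "kscale3 :: 'k::field \<Rightarrow> 'k vec3 \<Rightarrow> 'k vec3" ..

lemma kscale_linearI:
  assumes "\<And>a b. f (a + b) = f a + f b" "\<And>c a. f (kscale c a) = kscale c (f a)"
  shows "Vector_Spaces.linear kscale kscale f"
  by (rule Vector_Spaces.linear_iff[THEN iffD2]) (use assms in \<open>auto simp: kvs.vector_space_axioms\<close>)

lemma kscale3_linearI:
  assumes "\<And>a b. f (a + b) = f a + f b" "\<And>c a. f (kscale3 c a) = kscale c (f a)"
  shows "Vector_Spaces.linear kscale3 kscale f"
  by (rule Vector_Spaces.linear_iff[THEN iffD2])
    (use assms in \<open>auto simp: kvs.vector_space_axioms k3.vector_space_axioms\<close>)

lemma kscale_3_linearI:
  assumes "\<And>a b. f (a + b) = f a + f b" "\<And>c a. f (kscale c a) = kscale3 c (f a)"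
  shows "Vector_Spaces.linear kscale kscale3 f"
  by (rule Vector_Spaces.linear_iff[THEN iffD2])
    (use assms in \<open>auto simp: kvs.vector_space_axioms k3.vector_space_axioms\<close>)

lemma forms3_subspace: "k3.subspace (forms3 n)"
  unfolding k3.subspace_def
  by (auto simp: forms3_def kscale3_def zero_prod_def forms_closed split: prod.splits)

text \<open>Rank-nullity for the first projection, and then for the second projection on its
  kernel.\<close>

lemma dim_triple:
  fixes A B C :: "('k::field) poly3 set"
  assumes "kvs.subspace A" "kvs.subspace B" "kvs.subspace C"
    "finitely_spanned kvs.span A" "finitely_spanned kvs.span B" "finitely_spanned kvs.span C"
  shows "finitely_spanned k3.span (A \<times> B \<times> C)"
    and "k3.dim (A \<times> B \<times> C) = kvs.dim A + kvs.dim B + kvs.dim C"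
proof -
  have lin: "Vector_Spaces.linear kscale kscale3 (\<lambda>p :: 'k poly3. (p, 0, 0))"
    "Vector_Spaces.linear kscale kscale3 (\<lambda>p :: 'k poly3. (0, p, 0))"
    "Vector_Spaces.linear kscale kscale3 (\<lambda>p :: 'k poly3. (0, 0, p))"
    by (rule kscale_3_linearI; simp add: kscale3_def)+
  have lin': "Vector_Spaces.linear kscale3 kscale (\<lambda>v :: 'k vec3. fst v)"
    "Vector_Spaces.linear kscale3 kscale (\<lambda>v :: 'k vec3. fst (snd v))"
    by (rule kscale3_linearI; simp add: kscale3_def split: prod.splits)+
  have sub: "k3.subspace (A \<times> B \<times> C)" "k3.subspace ({0} \<times> B \<times> C)"
    using assms(1-3) unfolding k3.subspace_def kvs.subspace_def
    by (auto simp: kscale3_def zero_prod_def split: prod.splits)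
  obtain SA SB SC where S:
    "finite ((\<lambda>p. (p, 0 :: 'k poly3, 0 :: 'k poly3)) ` SA)" "(\<lambda>p. (p, 0, 0)) ` A \<subseteq> (\<lambda>p. (p, 0, 0)) ` kvs.span SA"
    "finite ((\<lambda>p. (0 :: 'k poly3, p, 0 :: 'k poly3)) ` SB)" "(\<lambda>p. (0, p, 0)) ` B \<subseteq> (\<lambda>p. (0, p, 0)) ` kvs.span SB"
    "finite ((\<lambda>p. (0 :: 'k poly3, 0 :: 'k poly3, p)) ` SC)" "(\<lambda>p. (0, 0, p)) ` C \<subseteq> (\<lambda>p. (0, 0, p)) ` kvs.span SC"
    using assms(4-6) unfolding finitely_spanned_def by (meson finite_imageI image_mono)
  let ?S = "(\<lambda>p. (p, 0, 0)) ` SA \<union> (\<lambda>p. (0, p, 0)) ` SB \<union> (\<lambda>p. (0, 0, p)) ` SC"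
  have "A \<times> B \<times> C \<subseteq> k3.span ?S"
  proof (clarify)
    fix a b c assume "a \<in> A" "b \<in> B" "c \<in> C"
    then have "(a, 0, 0) \<in> (\<lambda>p. (p, 0, 0)) ` kvs.span SA" "(0, b, 0) \<in> (\<lambda>p. (0, p, 0)) ` kvs.span SB"
      "(0, 0, c) \<in> (\<lambda>p. (0, 0, p)) ` kvs.span SC"
      using S by blast+
    then have "(a, 0, 0) \<in> k3.span ((\<lambda>p. (p, 0, 0)) ` SA)" "(0, b, 0) \<in> k3.span ((\<lambda>p. (0, p, 0)) ` SB)"
      "(0, 0, c) \<in> k3.span ((\<lambda>p. (0, 0, p)) ` SC)"
      by (simp_all only: k_k3.linear_span_image[OF lin(1)] k_k3.linear_span_image[OF lin(2)]
          k_k3.linear_span_image[OF lin(3)])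
    then have "(a, 0, 0) \<in> k3.span ?S" "(0, b, 0) \<in> k3.span ?S" "(0, 0, c) \<in> k3.span ?S"
      by (meson k3.span_mono le_supI1 le_supI2 subsetD sup_ge1 sup_ge2)+
    then have "(a, 0, 0) + (0, b, 0) + (0, 0, c) \<in> k3.span ?S" by (intro k3.span_add)
    then show "(a, b, c) \<in> k3.span ?S" by simp
  qed
  then show fin: "finitely_spanned k3.span (A \<times> B \<times> C)" unfolding finitely_spanned_def using S(1,3,5) by (intro exI[of _ ?S]) simp
  have 0: "0 \<in> A" "0 \<in> B" "0 \<in> C" using assms(1-3) by (auto simp: kvs.subspace_def)
  have "k3.dim (A \<times> B \<times> C) = k3.dim {v \<in> A \<times> B \<times> C. fst v = 0} + kvs.dim (fst ` (A \<times> B \<times> C))"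
    by (rule k3_k.rank_nullity[OF lin'(1) sub(1) fin])
  moreover have "{v \<in> A \<times> B \<times> C. fst v = 0} = {0} \<times> B \<times> C" "fst ` (A \<times> B \<times> C) = A"
    using 0 by (auto simp: image_iff)
  moreover have fin': "finitely_spanned k3.span ({0} \<times> B \<times> C)"
    using fin by (rule k3.finite_span_mono) (use 0 in auto)
  moreover have "k3.dim ({0} \<times> B \<times> C) =
      k3.dim {v \<in> {0} \<times> B \<times> C. fst (snd v) = 0} + kvs.dim ((\<lambda>v :: 'k vec3. fst (snd v)) ` ({0} \<times> B \<times> C))"
    by (rule k3_k.rank_nullity[OF lin'(2) sub(2) fin'])
  moreover have "{v \<in> {0 :: 'k poly3} \<times> B \<times> C. fst (snd v) = 0} = (\<lambda>p. (0, 0, p)) ` C"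
    "(\<lambda>v :: 'k vec3. fst (snd v)) ` ({0} \<times> B \<times> C) = B"
    using 0 by (auto simp: image_iff zero_prod_def)
  moreover have "k3.dim ((\<lambda>p. (0 :: 'k poly3, 0 :: 'k poly3, p)) ` C) = kvs.dim C"
    by (rule k_k3.dim_image_injective[OF lin(3) assms(3,6)]) (simp add: zero_prod_def)
  ultimately show "k3.dim (A \<times> B \<times> C) = kvs.dim A + kvs.dim B + kvs.dim C" by simp
qed

lemma forms3_finite_span: "finitely_spanned k3.span (forms3 n)"
  unfolding forms3_def by (intro dim_triple forms_subspace forms_finite_span)

lemma dim_forms3: "k3.dim (forms3 n :: ('k::field) vec3 set) = 3 * kvs.dim (forms n :: 'k poly3 set)"
  unfolding forms3_def by (subst dim_triple) (simp_all add: forms_subspace forms_finite_span)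

section \<open>Multiplicities from Hilbert functions\<close>

text \<open>Polynomials that agree at all large integers are equal, so the Hilbert polynomial is the
  constant \<open>c\<close>. Positivity of \<open>c\<close> selects the branch of
  \<open>quot_multiplicity\<close> for positive dimension, where the factorial is that of degree
  0.\<close>

lemma quot_multiplicity_eventually_const:
  fixes I :: "('k::field) poly3 set"
  assumes ev: "\<forall>\<^sub>F n in sequentially. hilbert_fun I n = c" and "c > 0"
  shows "quot_multiplicity I = of_nat c"
proof -
  have "hilbert_poly I = [:of_nat c:]"
    unfolding hilbert_poly_def
  proof (rule the_equality)
    show "\<forall>\<^sub>F n in sequentially. poly [:of_nat c:] (of_nat n) = of_nat (hilbert_fun I n)"
      using ev by eventually_elim simp
    fix P :: "rat poly"
    assume "\<forall>\<^sub>F n in sequentially. poly P (of_nat n) = of_nat (hilbert_fun I n)"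
    with ev have "\<forall>\<^sub>F n in sequentially. poly (P - [:of_nat c:]) (of_nat n) = 0"
      by eventually_elim simp
    then obtain N where N: "\<And>n. n \<ge> N \<Longrightarrow> poly (P - [:of_nat c:]) (of_nat n) = 0"
      unfolding eventually_sequentially by blast
    have "infinite (of_nat ` {N..} :: rat set)"
      by (simp add: finite_image_iff inj_on_def infinite_Ici)
    moreover have "(of_nat ` {N..} :: rat set) \<subseteq> {r. poly (P - [:of_nat c:]) r = 0}"
      using N by auto
    ultimately have "infinite {r. poly (P - [:of_nat c:]) r = 0}"
      by (metis finite_subset)
    then have "P - [:of_nat c:] = 0" using poly_roots_finite by blast
    then show "P = [:of_nat c:]" by simp
  qed
  then show ?thesis using \<open>c > 0\<close> by (simp add: quot_multiplicity_def)
qed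

section \<open>The ideal \<open>J\<^sub>d\<close>\<close>

definition gen1 :: "nat \<Rightarrow> ('k::field) poly3" where "gen1 d = mon d 0 0"
definition gen2 :: "nat \<Rightarrow> ('k::field) poly3" where
  "gen2 d = mon 0 (d - 1) 1 - kscale (of_nat (d - 2)) (mon 1 1 (d - 2))"
definition gen3 :: "nat \<Rightarrow> ('k::field) poly3" where
  "gen3 d = mon 0 d 0 - kscale (of_nat (d - 1)) (mon 1 (d - 2) 1) + mon (d - 2) 0 2"

lemma kscale_of_nat: "kscale (of_nat c) p = of_nat c * p"
  by (simp add: kscale_conv_mult of_nat_poly)

lemma J_gens_eq: "J_gens d = (gen1 d, gen2 d, gen3 d)"
  by (simp add: J_gens_def gen1_def gen2_def gen3_def kscale_of_nat mon_conv_var mult.assoc)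

definition ideal_J :: "nat \<Rightarrow> ('k::field) poly3 set" where "ideal_J d = gen_ideal3 (J_gens d)"

lemma mem_ideal_J_iff: "p \<in> ideal_J d \<longleftrightarrow> (\<exists>u v w. p = u * gen1 d + v * gen2 d + w * gen3 d)"
  by (auto simp: ideal_J_def gen_ideal3_def J_gens_eq type_genideal_insert3)

lemma ideal_ideal_J: "ideal (ideal_J d) R3"
  by (simp add: ideal_J_def gen_ideal3_def J_gens_eq type_genideal)

lemmas ideal_J_closed = type_idealD[OF ideal_ideal_J]

lemma ideal_J_kscale: "p \<in> ideal_J d \<Longrightarrow> kscale c p \<in> ideal_J d"
  unfolding kscale_conv_mult by (rule ideal_J_closed)

lemma gen_mem_ideal_J: "gen1 d \<in> ideal_J d" "gen2 d \<in> ideal_J d" "gen3 d \<in> ideal_J d"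
proof -
  have "gen1 d = 1 * gen1 d + 0 * gen2 d + 0 * gen3 d" "gen2 d = 0 * gen1 d + 1 * gen2 d + 0 * gen3 d"
    "gen3 d = 0 * gen1 d + 0 * gen2 d + 1 * gen3 d" by simp_all
  then show "gen1 d \<in> ideal_J d" "gen2 d \<in> ideal_J d" "gen3 d \<in> ideal_J d"
    unfolding mem_ideal_J_iff by blast+
qed

lemma cf_mon_mult:
  "cf (mon a b c * p) i j l = (if a \<le> i \<and> b \<le> j \<and> c \<le> l then cf p (i - a) (j - b) (l - c) else 0)"
  by (simp add: mon_def coeff_monom_mult)

lemma gen_forms:
  assumes "d \<ge> 4"
  shows "gen1 d \<in> forms (int d)" "gen2 d \<in> forms (int d)" "gen3 d \<in> forms (int d)"
  using mon_forms[of d 0 0] mon_forms[of 0 "d - 1" 1] mon_forms[of 1 1 "d - 2"]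
    mon_forms[of 0 d 0] mon_forms[of 1 "d - 2" 1] mon_forms[of "d - 2" 0 2] assms
  unfolding gen1_def gen2_def gen3_def
  by (auto intro!: forms_closed simp: of_nat_diff)

text \<open>The generators are forms of degree \<open>d\<close>, so the coefficients of any
  representation may be replaced by their components of degree \<open>n - int d\<close>.\<close>

lemma ideal_J_form_cases:
  assumes "d \<ge> 4" "p \<in> ideal_J d" "p \<in> forms n"
  obtains u v w where "u \<in> forms (n - int d)" "v \<in> forms (n - int d)" "w \<in> forms (n - int d)"
    "p = u * gen1 d + v * gen2 d + w * gen3 d"
proof -
  obtain u v w where p: "p = u * gen1 d + v * gen2 d + w * gen3 d"
    using assms(2) unfolding mem_ideal_J_iff by blast
  have "p = hc n p" using hc_of_form[OF assms(3), of n] by simp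
  also have "\<dots> = hc (n - int d) u * gen1 d + hc (n - int d) v * gen2 d + hc (n - int d) w * gen3 d"
    unfolding p using hc_mult_form[OF gen_forms(1)[OF assms(1)], of "n - int d" u]
      hc_mult_form[OF gen_forms(2)[OF assms(1)], of "n - int d" v]
      hc_mult_form[OF gen_forms(3)[OF assms(1)], of "n - int d" w]
    by (simp add: hc_add)
  finally show thesis using that hc_forms by blast
qed

lemma mem_ideal_of_monomials:
  fixes I :: "('k::field) poly3 set"
  assumes "ideal I R3" "\<And>i j l. cf p i j l \<noteq> 0 \<Longrightarrow> mon i j l \<in> I"
  shows "p \<in> I"
proof -
  let ?S = "{(i, j, l). cf p i j l \<noteq> 0}"
  have "p = poly3_of ?S (\<lambda>(i, j, l). cf p i j l)"
    by (intro poly3_eqI) (simp add: cf_poly3_of finite_support)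
  also have "\<dots> \<in> I"
    unfolding poly3_of_def kscale_conv_mult
    by (intro type_ideal_sum[OF assms(1)] type_idealD(3)[OF assms(1)]) (auto intro: assms(2))
  finally show ?thesis .
qed

text \<open>The ideal of the local ring at \<open>(0 : 0 : 1)\<close>: the saturation of \<open>J\<^sub>d\<close> with respect to \<open>z\<close>.\<close>

definition sat_z :: "('k::field) poly3 set \<Rightarrow> 'k poly3 set" where
  "sat_z I = {p. \<exists>a. var_z ^ a * p \<in> I}"

lemma ideal_sat_z:
  assumes "ideal I R3"
  shows "ideal (sat_z I) R3"
proof -
  note I = type_idealD[OF assms]
  have "0 \<in> sat_z I" using I(1) by (simp add: sat_z_def)
  moreover have "p + q \<in> sat_z I" if pq: "p \<in> sat_z I" "q \<in> sat_z I" for p q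
  proof -
    obtain a b where ab: "var_z ^ a * p \<in> I" "var_z ^ b * q \<in> I" using pq by (auto simp: sat_z_def)
    then have "var_z ^ b * (var_z ^ a * p) + var_z ^ a * (var_z ^ b * q) \<in> I"
      by (rule I(2)[OF I(3) I(3)])
    then have "var_z ^ (a + b) * (p + q) \<in> I" by (simp add: power_add algebra_simps)
    then show ?thesis by (auto simp: sat_z_def)
  qed
  moreover have "r * p \<in> sat_z I" if p: "p \<in> sat_z I" for p r
  proof -
    obtain a where "var_z ^ a * p \<in> I" using p by (auto simp: sat_z_def)
    then have "r * (var_z ^ a * p) \<in> I" by (rule I)
    then show ?thesis by (auto simp: sat_z_def mult.left_commute)
  qed
  ultimately show ?thesis unfolding type_ideal_iff by blast
qed

lemma sat_z_power: "var_z ^ a * p \<in> sat_z I \<Longrightarrow> p \<in> sat_z I"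
  by (auto simp: sat_z_def power_add[symmetric] mult.assoc[symmetric])

text \<open>Characteristic zero enters here: the integers d - 2 and their powers, which come with
  the second generator, can be cancelled.\<close>

lemma sat_z_of_nat:
  fixes I :: "('k::field_char_0) poly3 set"
  assumes "ideal I R3" "of_nat n * p \<in> sat_z I" "n \<noteq> 0"
  shows "p \<in> sat_z I"
proof -
  have "kscale (inverse (of_nat n)) (kscale (of_nat n) p) \<in> sat_z I"
    unfolding kscale_conv_mult[of "inverse _"] kscale_of_nat
    by (rule type_idealD(3)[OF ideal_sat_z[OF assms(1)] assms(2)])
  then show ?thesis using assms(3) by simp
qed

lemma sat_z_superset: "p \<in> I \<Longrightarrow> p \<in> sat_z I"
  by (auto simp: sat_z_def intro: exI[of _ 0])

lemma sat_z_large: "ideal I R3 \<Longrightarrow> p \<in> sat_z I \<Longrightarrow> \<exists>A. \<forall>a\<ge>A. var_z ^ a * p \<in> I"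
proof -
  assume I: "ideal I R3" and "p \<in> sat_z I"
  then obtain A where A: "var_z ^ A * p \<in> I" by (auto simp: sat_z_def)
  have "var_z ^ a * p \<in> I" if "A \<le> a" for a
  proof -
    have "var_z ^ a * p = var_z ^ (a - A) * (var_z ^ A * p)"
      unfolding mult.assoc[symmetric] power_add[symmetric] using that by simp
    then show ?thesis by (simp only: type_idealD(3)[OF I A])
  qed
  then show ?thesis by blast
qed

lemma power_diff_mem_ideal:
  fixes a b :: "'a::comm_ring_1"
  assumes "ideal I ring_of_type_algebra" "a - b \<in> I"
  shows "a ^ n - b ^ n \<in> I"
  using type_idealD(4)[OF assms] by (simp add: power_diff_sumr2)

text \<open>The constant in the local relation x^(d-2) = c y^d. At z = 1 the third generator reads
  x^(d-2) = (d-1) x y^(d-2) - y^d. For d > 4 the term x y^(d-2) vanishes locally, which leaves -1;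
  for d = 4 it is x y^2 = y^4 / 2, which gives 3/2 - 1 = 1/2.\<close>

definition ccoeff :: "nat \<Rightarrow> 'k::field_char_0" where
  "ccoeff d = (if d = 4 then 1 / 2 else - 1)"

section \<open>Relations in the local ring at (0 : 0 : 1), with d = e + 4 to avoid truncated
  subtraction\<close>

context
  fixes d e :: nat
  assumes d: "d = e + 4"
begin

lemma gens_expanded:
  "(gen1 d :: ('k::field_char_0) poly3) = var_x ^ (e + 4)"
  "(gen2 d :: 'k poly3) = var_z * (var_y ^ (e + 3) - of_nat (e + 2) * (var_x * var_y * var_z ^ (e + 1)))"
  "(gen3 d :: 'k poly3) =
    var_y ^ (e + 4) - of_nat (e + 3) * (var_x * var_y ^ (e + 2) * var_z) + var_x ^ (e + 2) * var_z ^ 2"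
proof -
  have dd: "d - 1 = e + 3" "d - 2 = e + 2" using d by simp_all
  show "(gen1 d :: 'k poly3) = var_x ^ (e + 4)" by (simp add: gen1_def d mon_conv_var)
  obtain c where c: "of_nat (e + 2) = (c :: 'k poly3)" by simp
  have "var_z ^ (e + 2) = var_z * (var_z ^ (e + 1) :: 'k poly3)" by simp
  then show "(gen2 d :: 'k poly3) = var_z * (var_y ^ (e + 3) - of_nat (e + 2) * (var_x * var_y * var_z ^ (e + 1)))"
    unfolding gen2_def dd kscale_of_nat mon_conv_var c by (simp only: algebra_simps power_0 power_one_right mult_1_right mult_1_left)
  show "(gen3 d :: 'k poly3) =
    var_y ^ (e + 4) - of_nat (e + 3) * (var_x * var_y ^ (e + 2) * var_z) + var_x ^ (e + 2) * var_z ^ 2"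
    unfolding gen3_def dd unfolding kscale_of_nat mon_conv_var d
    by (simp only: power_0 power_one_right mult_1_right mult_1_left)
qed

text \<open>Modulo the third generator y^d is a multiple of x, and x^d is the first
  generator.\<close>

lemma nilpotent_y: "var_y ^ (d * d) \<in> (ideal_J d :: ('k::field_char_0) poly3 set)"
proof -
  define w :: "'k poly3" where "w = of_nat (e + 3) * (var_y ^ (e + 2) * var_z) - var_x ^ (e + 1) * var_z ^ 2"
  obtain c where c: "of_nat (e + 3) = (c :: 'k poly3)" by simp
  have "var_x ^ (e + 2) = var_x * (var_x ^ (e + 1) :: 'k poly3)" by simp
  then have "var_y ^ d - var_x * w = gen3 d"
    unfolding gens_expanded w_def c unfolding d by (simp only: algebra_simps)
  then have "var_y ^ d - var_x * w \<in> ideal_J d" using gen_mem_ideal_J(3) by metis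
  then have "(var_y ^ d) ^ d - (var_x * w) ^ d \<in> ideal_J d" by (rule power_diff_mem_ideal[OF ideal_ideal_J])
  moreover have "w ^ d * var_x ^ d \<in> ideal_J d"
    using ideal_J_closed(3)[OF gen_mem_ideal_J(1), of "w ^ d" d] unfolding gens_expanded(1) unfolding d .
  ultimately have "((var_y ^ d) ^ d - (var_x * w) ^ d) + w ^ d * var_x ^ d \<in> ideal_J d" by (rule ideal_J_closed)
  then show ?thesis by (simp add: power_mult power_mult_distrib mult.commute)
qed

lemma xyz_relation:
  "of_nat (e + 2) * (var_x * var_y * var_z ^ (e + 1)) - var_y ^ (e + 3) \<in> sat_z (ideal_J d :: ('k::field_char_0) poly3 set)"
proof -
  have "var_z ^ 1 * (var_y ^ (e + 3) - of_nat (e + 2) * (var_x * var_y * var_z ^ (e + 1))) \<in> sat_z (ideal_J d :: 'k poly3 set)"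
  proof -
    have "gen2 d \<in> sat_z (ideal_J d :: 'k poly3 set)" by (rule sat_z_superset, rule gen_mem_ideal_J)
    then show ?thesis unfolding gens_expanded(2) by (simp only: power_one_right)
  qed
  then have "var_y ^ (e + 3) - of_nat (e + 2) * (var_x * var_y * var_z ^ (e + 1)) \<in> sat_z (ideal_J d :: 'k poly3 set)"
    by (rule sat_z_power)
  then have "- (var_y ^ (e + 3) - of_nat (e + 2) * (var_x * var_y * var_z ^ (e + 1))) \<in> sat_z (ideal_J d :: 'k poly3 set)"
    by (rule type_idealD(5)[OF ideal_sat_z[OF ideal_ideal_J]])
  then show ?thesis by simp
qed

text \<open>Next to a factor y, each x z^(e+1) may be traded for y^(e+2) at the price of a factor e
  + 2. One y has to stay for the next trade, hence the exponent \<open>Suc k\<close>.\<close>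

lemma xz_power_relation:
  "of_nat (e + 2) ^ m * ((var_x * var_z ^ (e + 1)) ^ m * var_y ^ Suc k) - var_y ^ (Suc k + m * (e + 2))
    \<in> sat_z (ideal_J d :: ('k::field_char_0) poly3 set)"
proof (induction m arbitrary: k)
  case 0
  then show ?case using type_idealD(1)[OF ideal_sat_z[OF ideal_ideal_J]] by simp
next
  case (Suc m)
  let ?N = "of_nat (e + 2) :: 'k poly3"
  have "(?N ^ m * (var_x * var_z ^ (e + 1)) ^ m * var_y ^ k) * (?N * (var_x * var_y * var_z ^ (e + 1)) - var_y ^ (e + 3))
      + (?N ^ m * ((var_x * var_z ^ (e + 1)) ^ m * var_y ^ Suc (k + e + 2)) - var_y ^ (Suc (k + e + 2) + m * (e + 2)))
      \<in> sat_z (ideal_J d)"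
    using type_idealD(2,3)[OF ideal_sat_z[OF ideal_ideal_J]] xyz_relation Suc.IH by blast
  moreover have "?N ^ Suc m * ((var_x * var_z ^ (e + 1)) ^ Suc m * var_y ^ Suc k) =
      (?N ^ m * (var_x * var_z ^ (e + 1)) ^ m * var_y ^ k) * (?N * (var_x * var_y * var_z ^ (e + 1)))"
    by (simp only: power_Suc mult_ac)
  moreover have "?N ^ m * ((var_x * var_z ^ (e + 1)) ^ m * var_y ^ Suc (k + e + 2)) =
      (?N ^ m * (var_x * var_z ^ (e + 1)) ^ m * var_y ^ k) * var_y ^ (e + 3)"
  proof -
    have "(var_y :: 'k poly3) ^ Suc (k + e + 2) = var_y ^ k * var_y ^ (e + 3)"
      unfolding power_add[symmetric] by (rule arg_cong[where f = "power _"]) simp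
    then show ?thesis by (simp only: mult.assoc)
  qed
  moreover have "Suc (k + e + 2) + m * (e + 2) = Suc k + Suc m * (e + 2)" by simp
  ultimately show ?case by (simp only: right_diff_distrib) (simp only: diff_add_cancel add_diff_eq)
qed

text \<open>Trading the powers of x in y times the third generator for powers of y gives y^(e+5)
  \<open>B\<close>, where \<open>B\<close> is the bracket 1 - (e+3)/(e+2) y^e + ... cleared of
  denominators and made homogeneous with powers of z. It is a unit at (0 : 0 : 1), so y^(e+5) itself
  vanishes there.\<close>

lemma sat_y: "var_y ^ (e + 5) \<in> sat_z (ideal_J d :: ('k::field_char_0) poly3 set)"
proof -
  let ?S = "sat_z (ideal_J d) :: 'k poly3 set"
  have "ideal ?S R3" by (rule ideal_sat_z[OF ideal_ideal_J])
  note S = type_idealD[OF this]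
  define N where "N = (of_nat (e + 2) :: 'k poly3)"
  define E where "E = (of_nat (e + 3) :: 'k poly3)"
  \<comment> \<open>With this power of z the term x^(e+2) of the third generator is accompanied by
    exactly (z^(e+1))^(e+2), as \<open>xz_power_relation\<close> demands.\<close>
  define M where "M = e * (e + 2)"
  define B where "B = N ^ (e + 2) * var_z ^ (e + M) - E * N ^ (e + 1) * var_z ^ M * var_y ^ e
    + var_y ^ (e * e + 3 * e)"
  have pw: "var_y ^ k = var_y ^ i * (var_y ^ j :: 'k poly3)" if "i + j = k" for i j k
    using that by (simp add: power_add[symmetric])
  have 1: "N ^ (e + 2) * var_z ^ (e + M) * var_y * gen3 d \<in> ?S"
    by (rule S(3), rule sat_z_superset, rule gen_mem_ideal_J)
  have "of_nat (e + 2) ^ 1 * ((var_x * var_z ^ (e + 1)) ^ 1 * var_y ^ Suc (e + 2))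
      - var_y ^ (Suc (e + 2) + 1 * (e + 2)) \<in> ?S"
    by (rule xz_power_relation)
  moreover have "Suc (e + 2) = e + 3" "e + 3 + 1 * (e + 2) = 2 * e + 5" by simp_all
  ultimately have "N * (var_x * var_z ^ (e + 1) * var_y ^ (e + 3)) - var_y ^ (2 * e + 5) \<in> ?S"
    unfolding N_def by (simp only: power_one_right)
  then have 2: "E * N ^ (e + 1) * var_z ^ M *
      (N * (var_x * var_z ^ (e + 1) * var_y ^ (e + 3)) - var_y ^ (2 * e + 5)) \<in> ?S"
    by (rule S(3))
  have "of_nat (e + 2) ^ (e + 2) * ((var_x * var_z ^ (e + 1)) ^ (e + 2) * var_y ^ Suc 0)
      - var_y ^ (Suc 0 + (e + 2) * (e + 2)) \<in> ?S"
    by (rule xz_power_relation)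
  then have 3: "N ^ (e + 2) * ((var_x * var_z ^ (e + 1)) ^ (e + 2) * var_y)
      - var_y ^ (1 + (e + 2) * (e + 2)) \<in> ?S"
    unfolding N_def by (simp only: power_Suc0_right One_nat_def)
  have expand: "N1 * N' * P * y * (y4 - E' * (x * q * z) + xx * z ^ 2) =
      N1 * N' * P * (y * y4) - E' * N1 * zM * (N' * (x * ze * y3)) + N1 * N' * (xx * ze2 * y)"
    if "P * z = zM * ze" "P * z ^ 2 = ze2" "y * q = y3"
    for N1 N' P y y4 E' x q z xx zM ze ze2 y3 :: "'k poly3"
  proof -
    have "E' * N1 * zM * (N' * (x * ze * y3)) = E' * N1 * N' * x * (zM * ze) * y3"
      by (simp only: mult_ac)
    then show ?thesis unfolding that(1)[symmetric] that(2,3)[symmetric] by (simp add: algebra_simps)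
  qed
  have "(N ^ (e + 1) * N) * var_z ^ (e + M) * var_y * gen3 d
      = (N ^ (e + 1) * N) * var_z ^ (e + M) * (var_y * var_y ^ (e + 4))
      - E * N ^ (e + 1) * var_z ^ M * (N * (var_x * var_z ^ (e + 1) * var_y ^ (e + 3)))
      + (N ^ (e + 1) * N) * (var_x ^ (e + 2) * (var_z ^ (e + 1)) ^ (e + 2) * var_y)"
    unfolding gens_expanded(3) E_def
  proof (rule expand)
    show "(var_z :: 'k poly3) ^ (e + M) * var_z = var_z ^ M * var_z ^ (e + 1)"
      by (simp add: power_add)
    have "e + M + 2 = (e + 1) * (e + 2)" by (simp add: M_def algebra_simps)
    then show "(var_z :: 'k poly3) ^ (e + M) * var_z ^ 2 = (var_z ^ (e + 1)) ^ (e + 2)"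
      by (simp only: power_mult[symmetric] power_add[symmetric])
    show "(var_y :: 'k poly3) * var_y ^ (e + 2) = var_y ^ (e + 3)" by (simp add: numeral_eq_Suc)
  qed
  moreover have "N ^ (e + 1) * N = N ^ (e + 2)" by simp
  ultimately have eq: "N ^ (e + 2) * var_z ^ (e + M) * var_y * gen3 d
      = N ^ (e + 2) * var_z ^ (e + M) * (var_y * var_y ^ (e + 4))
      - E * N ^ (e + 1) * var_z ^ M * (N * (var_x * var_z ^ (e + 1) * var_y ^ (e + 3)))
      + N ^ (e + 2) * ((var_x * var_z ^ (e + 1)) ^ (e + 2) * var_y)"
    by (simp only: power_mult_distrib)
  have y: "var_y * var_y ^ (e + 4) = (var_y ^ (e + 5) :: 'k poly3)"
    "(var_y :: 'k poly3) ^ (2 * e + 5) = var_y ^ (e + 5) * var_y ^ e"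
    "(var_y :: 'k poly3) ^ (1 + (e + 2) * (e + 2)) = var_y ^ (e + 5) * var_y ^ (e * e + 3 * e)"
    by (simp add: numeral_eq_Suc, (rule pw, simp add: algebra_simps)+)
  have regroup: "Y5 * (NZ - c * Ye + Yf) = NZ * Y5 - T + U + c * (T' - Y5 * Ye) - (U - Y5 * Yf)"
    if "T = c * T'" for Y5 NZ c Ye Yf T T' U :: "'k poly3"
    unfolding that by (simp add: algebra_simps)
  have "var_y ^ (e + 5) * B = N ^ (e + 2) * var_z ^ (e + M) * var_y * gen3 d
      + E * N ^ (e + 1) * var_z ^ M * (N * (var_x * var_z ^ (e + 1) * var_y ^ (e + 3)) - var_y ^ (2 * e + 5))
      - (N ^ (e + 2) * ((var_x * var_z ^ (e + 1)) ^ (e + 2) * var_y) - var_y ^ (1 + (e + 2) * (e + 2)))"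
    unfolding eq y B_def by (rule regroup) (rule refl)
  then have YB: "var_y ^ (e + 5) * B \<in> ?S" using S(6)[OF S(2)[OF 1 2] 3] by (simp only:)
  show ?thesis
  proof (cases "e = 0")
    case True
    \<comment> \<open>All three terms are constants here: 4 - 6 + 1 = -1.\<close>
    then have "B = - 1" by (simp add: B_def M_def N_def E_def)
    then show ?thesis using S(5)[OF YB] by simp
  next
    case False
    define c where "c = E * N ^ (e + 1) * var_z ^ M"
    define W where "W = c * var_y ^ (e - 1) - var_y ^ (e * e + 3 * e - 1)"
    have "var_y ^ e = var_y * (var_y ^ (e - 1) :: 'k poly3)"
      "var_y ^ (e * e + 3 * e) = var_y * (var_y ^ (e * e + 3 * e - 1) :: 'k poly3)"
      using pw[of 1 "e - 1" e] pw[of 1 "e * e + 3 * e - 1" "e * e + 3 * e"] False by simp_all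
    then have B: "B = N ^ (e + 2) * var_z ^ (e + M) - var_y * W"
      unfolding B_def W_def c_def[symmetric] by (simp only: algebra_simps)
    \<comment> \<open>Modulo y the bracket is (e+2)^(e+2) times a power of z, so vanishing of
      y^(k+1) implies vanishing of y^k. The descent starts at the nilpotency exponent d * d.\<close>
    have step: "var_y ^ k \<in> ?S" if k: "e + 5 \<le> k" "var_y ^ Suc k \<in> ?S" for k
    proof -
      have mem: "var_y ^ (k - (e + 5)) * (var_y ^ (e + 5) * B) + W * var_y ^ Suc k \<in> ?S"
        by (intro S(2) S(3) YB k(2))
      have yk: "var_y ^ k = var_y ^ (k - (e + 5)) * (var_y ^ (e + 5) :: 'k poly3)"
        by (rule pw) (use k(1) in simp)
      have "var_y ^ (k - (e + 5)) * (var_y ^ (e + 5) * B) + W * var_y ^ Suc k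
          = var_z ^ (e + M) * (N ^ (e + 2) * var_y ^ k)"
        unfolding B power_Suc mult.assoc[symmetric] yk[symmetric] by (simp only: algebra_simps)
      then have "var_z ^ (e + M) * (N ^ (e + 2) * var_y ^ k) \<in> ?S" using mem by (simp only:)
      then have "N ^ (e + 2) * var_y ^ k \<in> ?S" by (rule sat_z_power)
      then have "of_nat ((e + 2) ^ (e + 2)) * var_y ^ k \<in> ?S" unfolding N_def of_nat_power .
      then show ?thesis by (rule sat_z_of_nat[OF ideal_ideal_J]) simp
    qed
    have top: "var_y ^ (d * d) \<in> ?S" by (rule sat_z_superset[OF nilpotent_y])
    have "e + 5 \<le> d * d" by (simp add: d algebra_simps)
    then show ?thesis
      by (rule inc_induct[where P = "\<lambda>k. var_y ^ k \<in> ?S"]) (rule top, rule step)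
  qed
qed

text \<open>A single trade turns (e+2) x y^3 z^(e+1) into y^(e+5), which vanishes by
  \<open>sat_y\<close>.\<close>

lemma sat_xy3: "var_x * var_y ^ 3 \<in> sat_z (ideal_J d :: ('k::field_char_0) poly3 set)"
proof -
  let ?S = "sat_z (ideal_J d) :: 'k poly3 set"
  have "ideal ?S R3" by (rule ideal_sat_z[OF ideal_ideal_J])
  note S = type_idealD[OF this]
  have "of_nat (e + 2) ^ 1 * ((var_x * var_z ^ (e + 1)) ^ 1 * var_y ^ Suc 2)
      - var_y ^ (Suc 2 + 1 * (e + 2)) \<in> ?S"
    by (rule xz_power_relation)
  moreover have "Suc 2 = 3" "3 + 1 * (e + 2) = e + 5" by simp_all
  ultimately have "of_nat (e + 2) * (var_x * var_z ^ (e + 1) * var_y ^ 3) - var_y ^ (e + 5) \<in> ?S"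
    by (simp only: power_one_right)
  then have "of_nat (e + 2) * (var_x * var_z ^ (e + 1) * var_y ^ 3) - var_y ^ (e + 5) + var_y ^ (e + 5) \<in> ?S"
    using sat_y by (rule S(2))
  then have "of_nat (e + 2) * (var_x * var_z ^ (e + 1) * var_y ^ 3) \<in> ?S" by (simp only: diff_add_cancel)
  then have "var_x * var_z ^ (e + 1) * var_y ^ 3 \<in> ?S" by (rule sat_z_of_nat[OF ideal_ideal_J]) simp
  then have "var_z ^ (e + 1) * (var_x * var_y ^ 3) \<in> ?S" by (simp only: mult_ac)
  then show ?thesis by (rule sat_z_power)
qed

lemma sat_xy_power: "k \<ge> 3 \<Longrightarrow> var_x * var_y ^ k \<in> sat_z (ideal_J d :: ('k::field_char_0) poly3 set)"
proof -
  assume "k \<ge> 3"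
  then have "var_x * var_y ^ k = var_x * var_y ^ 3 * (var_y ^ (k - 3) :: 'k poly3)"
    by (simp add: mult.assoc flip: power_add)
  then show ?thesis by (simp only: type_idealD(4)[OF ideal_sat_z[OF ideal_ideal_J] sat_xy3])
qed

text \<open>Multiplying the basic relation by x turns x^2 y into a multiple of x y^(e+3), which
  vanishes because e + 3 is at least 3.\<close>

lemma sat_x2y: "var_x ^ 2 * var_y \<in> sat_z (ideal_J d :: ('k::field_char_0) poly3 set)"
proof -
  let ?S = "sat_z (ideal_J d) :: 'k poly3 set"
  have "ideal ?S R3" by (rule ideal_sat_z[OF ideal_ideal_J])
  note S = type_idealD[OF this]
  have "var_x * (of_nat (e + 2) * (var_x * var_y * var_z ^ (e + 1)) - var_y ^ (e + 3)) + var_x * var_y ^ (e + 3) \<in> ?S"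
    by (intro S(2) S(3) xyz_relation sat_xy_power) simp
  moreover have "x * (c * (x * y * z) - y') + x * y' = c * (z * (x ^ 2 * y))" for x c y z y' :: "'k poly3"
    by (simp add: algebra_simps power2_eq_square)
  ultimately have "of_nat (e + 2) * (var_z ^ (e + 1) * (var_x ^ 2 * var_y)) \<in> ?S" by (simp only:)
  then have "var_z ^ (e + 1) * (var_x ^ 2 * var_y) \<in> ?S" by (rule sat_z_of_nat[OF ideal_ideal_J]) simp
  then show ?thesis by (rule sat_z_power)
qed

lemma sat_x_power:
  "var_x ^ (e + 2) * var_z ^ 2 - kscale (ccoeff d) (var_y ^ (e + 4)) \<in> sat_z (ideal_J d :: ('k::field_char_0) poly3 set)"
proof -
  let ?S = "sat_z (ideal_J d) :: 'k poly3 set"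
  have "ideal ?S R3" by (rule ideal_sat_z[OF ideal_ideal_J])
  note S = type_idealD[OF this]
  have g: "gen3 d \<in> ?S" by (intro sat_z_superset gen_mem_ideal_J)
  show ?thesis
  proof (cases "e = 0")
    case True
    \<comment> \<open>For d = 4 the middle term -3 x y^2 z of the third generator is removed by y
      times the relation 2 x y z = y^3; the factors 2 and 3 clear denominators.\<close>
    have "2 * gen3 d + 3 * (var_y * (of_nat (e + 2) * (var_x * var_y * var_z ^ (e + 1)) - var_y ^ (e + 3))) \<in> ?S"
      by (intro S(2) S(3) xyz_relation g)
    moreover have "2 * gen3 d + 3 * (var_y * (of_nat (e + 2) * (var_x * var_y * var_z ^ (e + 1)) - var_y ^ (e + 3)))
       = of_nat 2 * (var_x ^ (e + 2) * var_z ^ 2 - kscale (1 / 2) (var_y ^ (e + 4) :: 'k poly3))"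
    proof -
      have "of_nat 2 * kscale (1 / 2) (var_y ^ 4 :: 'k poly3) = var_y ^ 4"
        unfolding kscale_of_nat[symmetric] by simp
      then show ?thesis using True
        by (simp add: gens_expanded algebra_simps power2_eq_square numeral_eq_Suc)
    qed
    ultimately have "of_nat 2 * (var_x ^ (e + 2) * var_z ^ 2 - kscale (1 / 2) (var_y ^ (e + 4))) \<in> ?S" by simp
    then have "var_x ^ (e + 2) * var_z ^ 2 - kscale (1 / 2) (var_y ^ (e + 4)) \<in> ?S"
      by (rule sat_z_of_nat[OF ideal_ideal_J]) simp
    moreover have "ccoeff d = (1 / 2 :: 'k)" using True by (simp add: ccoeff_def d)
    ultimately show ?thesis by (simp only:)
  next
    case False
    \<comment> \<open>For d > 4 the exponent e + 2 is at least 3, so the middle term of the third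
      generator vanishes by itself.\<close>
    have "gen3 d + of_nat (e + 3) * (var_z * (var_x * var_y ^ (e + 2))) \<in> ?S"
      using False by (intro S(2) S(3) g sat_xy_power) simp
    moreover have "kscale (- 1) p = - p" for p :: "'k poly3" by simp
    moreover have "ccoeff d = (- 1 :: 'k)" using False by (simp add: ccoeff_def d)
    moreover have "y - c * (x * y' * z) + x' + c * (z * (x * y')) = x' - - y" for x y z y' x' c :: "'k poly3"
      by (simp add: algebra_simps)
    ultimately show ?thesis unfolding gens_expanded(3) by (simp only:)
  qed
qed

lemma sat_x_power': "var_x ^ (e + 3) \<in> sat_z (ideal_J d :: ('k::field_char_0) poly3 set)"
proof -
  let ?S = "sat_z (ideal_J d) :: 'k poly3 set"
  have "ideal ?S R3" by (rule ideal_sat_z[OF ideal_ideal_J])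
  note S = type_idealD[OF this]
  have "var_x * (var_x ^ (e + 2) * var_z ^ 2 - kscale (ccoeff d) (var_y ^ (e + 4))) + [:[:[:(ccoeff d):]:]:] * (var_x * var_y ^ (e + 4)) \<in> ?S"
    by (intro S(2) S(3) sat_x_power sat_xy_power) simp
  moreover have "var_x ^ (e + 3) = var_x * (var_x ^ (e + 2) :: 'k poly3)" by (simp add: numeral_eq_Suc)
  moreover have "x * (x' * z - c * y) + c * (x * y) = z * (x * x')" for x x' z c y :: "'k poly3"
    by (simp add: algebra_simps)
  ultimately have "var_z ^ 2 * var_x ^ (e + 3) \<in> ?S" unfolding kscale_conv_mult by (simp only:)
  then show ?thesis by (rule sat_z_power)
qed

end

text \<open>Each relation in the saturation holds in J_d after multiplication by all large powers of
  z; the sum of the six thresholds serves all of them. Together they rewrite any monomial with a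
  large power of z.\<close>

lemma large_z_relations:
  assumes d: "d \<ge> 4"
  obtains A where
    "\<And>l. l \<ge> A \<Longrightarrow> mon 0 (d + 1) l \<in> (ideal_J d :: ('k::field_char_0) poly3 set)"
    "\<And>l. l \<ge> A \<Longrightarrow> mon 1 3 l \<in> (ideal_J d :: 'k poly3 set)"
    "\<And>l. l \<ge> A \<Longrightarrow> mon 2 1 l \<in> (ideal_J d :: 'k poly3 set)"
    "\<And>l. l \<ge> A \<Longrightarrow> mon (d - 1) 0 l \<in> (ideal_J d :: 'k poly3 set)"
    "\<And>l. l \<ge> A \<Longrightarrow>
      kscale (of_nat (d - 2)) (mon 1 1 (l + (d - 3))) - mon 0 (d - 1) l \<in> (ideal_J d :: 'k poly3 set)"
    "\<And>l. l \<ge> A \<Longrightarrow>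
      mon (d - 2) 0 (l + 2) - kscale (ccoeff d) (mon 0 d l) \<in> (ideal_J d :: 'k poly3 set)"
proof -
  let ?J = "ideal_J d :: 'k poly3 set"
  obtain e where e: "d = e + 4" using d by (metis add.commute le_iff_add)
  have large: "\<exists>A. \<forall>a\<ge>A. var_z ^ a * p \<in> ?J" if "p \<in> sat_z ?J" for p
    using sat_z_large[OF ideal_ideal_J that] .
  obtain A1 where A1: "\<forall>a\<ge>A1. var_z ^ a * var_y ^ (e + 5) \<in> ?J"
    using large[OF sat_y[OF e]] by blast
  obtain A2 where A2: "\<forall>a\<ge>A2. var_z ^ a * (var_x * var_y ^ 3) \<in> ?J"
    using large[OF sat_xy3[OF e]] by blast
  obtain A3 where A3: "\<forall>a\<ge>A3. var_z ^ a * (var_x ^ 2 * var_y) \<in> ?J"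
    using large[OF sat_x2y[OF e]] by blast
  obtain A4 where A4: "\<forall>a\<ge>A4. var_z ^ a * var_x ^ (e + 3) \<in> ?J"
    using large[OF sat_x_power'[OF e]] by blast
  obtain A5 where A5: "\<forall>a\<ge>A5. var_z ^ a *
      (of_nat (e + 2) * (var_x * var_y * var_z ^ (e + 1)) - var_y ^ (e + 3)) \<in> ?J"
    using large[OF xyz_relation[OF e]] by blast
  obtain A6 where A6: "\<forall>a\<ge>A6. var_z ^ a *
      (var_x ^ (e + 2) * var_z ^ 2 - kscale (ccoeff d) (var_y ^ (e + 4))) \<in> ?J"
    using large[OF sat_x_power[OF e]] by blast
  define A where "A = A1 + A2 + A3 + A4 + A5 + A6"
  have dd: "d + 1 = e + 5" "d - 1 = e + 3" "d - 2 = e + 2" "d - 3 = e + 1" using e by simp_all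
  have "mon 0 (d + 1) l \<in> ?J" "mon 1 3 l \<in> ?J" "mon 2 1 l \<in> ?J" "mon (d - 1) 0 l \<in> ?J" if "A \<le> l" for l
    using that A1 A2 A3 A4 unfolding dd mon_conv_var by (simp_all add: A_def mult.commute[of _ "var_z ^ l"])
  moreover have "kscale (of_nat (d - 2)) (mon 1 1 (l + (d - 3))) - mon 0 (d - 1) l \<in> ?J" if "A \<le> l" for l
  proof -
    have "kscale (of_nat (d - 2)) (mon 1 1 (l + (d - 3))) - mon 0 (d - 1) l = var_z ^ l *
      (of_nat (e + 2) * (var_x * var_y * var_z ^ (e + 1)) - (var_y ^ (e + 3) :: 'k poly3))"
      unfolding dd mon_conv_var kscale_of_nat power_add[of _ l] power_0 power_one_right right_diff_distrib
      by (simp only: mult_ac mult_1_left mult_1_right)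
    moreover have "A5 \<le> l" using that by (simp add: A_def)
    ultimately show ?thesis using A5 by (simp only:)
  qed
  moreover have "mon (d - 2) 0 (l + 2) - kscale (ccoeff d) (mon 0 d l) \<in> ?J" if "A \<le> l" for l
  proof -
    have "mon (d - 2) 0 (l + 2) - kscale (ccoeff d) (mon 0 d l) = var_z ^ l *
      (var_x ^ (e + 2) * var_z ^ 2 - kscale (ccoeff d) (var_y ^ (e + 4) :: 'k poly3))"
      unfolding dd mon_conv_var kscale_conv_mult power_add[of _ l 2] power_0 power_one_right right_diff_distrib
      unfolding e by (simp only: mult_ac mult_1_left mult_1_right)
    moreover have "A6 \<le> l" using that by (simp add: A_def)
    ultimately show ?thesis using A6 by (simp only:)
  qed
  ultimately show thesis by (rule that[of A])
qed

text \<open>The exponents of the monomials x^i y^j that do not vanish locally: those of the basis,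
  and x y, x y^2, x^(d-2), which are multiples of y^(d-1) and y^d.\<close>

definition exceptional :: "nat \<Rightarrow> nat \<Rightarrow> nat \<Rightarrow> bool" where
  "exceptional d i j \<longleftrightarrow> j = 0 \<and> i \<le> d - 2 \<or> i = 0 \<and> j \<le> d \<or> i = 1 \<and> (j = 1 \<or> j = 2)"

lemma mon_mem_mono:
  assumes "mon a b c \<in> (ideal_J d :: ('k::field) poly3 set)" "a \<le> i" "b \<le> j" "c \<le> l"
  shows "mon i j l \<in> (ideal_J d :: 'k poly3 set)"
proof -
  have "mon i j l = mon (i - a) (j - b) (l - c) * (mon a b c :: 'k poly3)"
    using assms by (simp add: mon_mult)
  then show ?thesis using ideal_J_closed(3)[OF assms(1)] by simp
qed

text \<open>Degree at least A + d + d * d leaves three possibilities: the power of z is large and a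
  local relation applies, or x^d divides the monomial, or the nilpotent power y^(d * d)
  does.\<close>

lemma large_monomials:
  assumes d: "d \<ge> 4"
  shows "\<exists>N. \<forall>n\<ge>N. \<forall>i j l. i + j + l = n \<longrightarrow> \<not> exceptional d i j
    \<longrightarrow> mon i j l \<in> (ideal_J d :: ('k::field_char_0) poly3 set)"
proof -
  let ?J = "ideal_J d :: 'k poly3 set"
  obtain e where e: "d = e + 4" using d by (metis add.commute le_iff_add)
  obtain A where A: "\<And>l. l \<ge> A \<Longrightarrow> mon 0 (d + 1) l \<in> ?J" "\<And>l. l \<ge> A \<Longrightarrow> mon 1 3 l \<in> ?J"
    "\<And>l. l \<ge> A \<Longrightarrow> mon 2 1 l \<in> ?J" "\<And>l. l \<ge> A \<Longrightarrow> mon (d - 1) 0 l \<in> ?J"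
    by (rule large_z_relations[OF d]) (rule that)
  have nil: "mon 0 (d * d) 0 \<in> ?J" using nilpotent_y[OF e] by (simp add: mon_conv_var)
  have x: "mon d 0 0 \<in> ?J" using gen_mem_ideal_J(1)[of d] by (simp add: gen1_def)
  have "mon i j l \<in> ?J" if n: "i + j + l \<ge> A + d + d * d" and ne: "\<not> exceptional d i j" for i j l
  proof (cases "A \<le> l")
    case False
    then have "d \<le> i \<or> d * d \<le> j" using n by linarith
    then show ?thesis using mon_mem_mono[OF nil, of i j l] mon_mem_mono[OF x, of i j l] by auto
  next
    case True
    consider "i = 0" "d + 1 \<le> j" | "i = 1" "3 \<le> j" | "2 \<le> i" "1 \<le> j" | "j = 0" "d - 1 \<le> i"
    proof -
      have "i = 0 \<or> i = 1 \<or> 2 \<le> i" by linarith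
      moreover have "d + 1 \<le> j" if "i = 0" using ne that d unfolding exceptional_def by simp
      moreover have "3 \<le> j" if "i = 1"
      proof -
        have "j \<noteq> 0" "j \<noteq> 1" "j \<noteq> 2" using ne that d unfolding exceptional_def by auto
        then show ?thesis by linarith
      qed
      moreover have "1 \<le> j \<or> j = 0 \<and> d - 1 \<le> i" using ne d unfolding exceptional_def by auto
      ultimately show thesis using that by blast
    qed
    then show ?thesis
    proof cases
      case 1 then show ?thesis by (intro mon_mem_mono[OF A(1)[OF True]]) auto
    next
      case 2 then show ?thesis by (intro mon_mem_mono[OF A(2)[OF True]]) auto
    next
      case 3 then show ?thesis by (intro mon_mem_mono[OF A(3)[OF True]]) auto
    next
      case 4 then show ?thesis by (intro mon_mem_mono[OF A(4)[OF True]]) auto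
    qed
  qed
  then show ?thesis by blast
qed

text \<open>After dehomogenising with \<open>z = 1\<close>, the quotient of the local ring by \<open>J\<^sub>d\<close> has the basis
  \<open>1, x, \<dots>, x\<^bsup>d-3\<^esup>, y, \<dots>, y\<^bsup>d\<^esup>\<close>, with $xy = y^{d-1}/(d-2)$, $xy^2 = y^d/(d-2)$,
  $x^{d-2} = c\,y^d$, where \<open>c\<close> is \<open>ccoeff d\<close>, and all other monomials zero. The
  functionals below are the coordinates with respect to it, on forms of degree \<open>n\<close>.\<close>

definition loc_coord :: "nat \<Rightarrow> nat \<Rightarrow> nat \<Rightarrow> ('k::field_char_0) poly3 \<Rightarrow> 'k" where
  "loc_coord d n s p =
     (if s < d - 2 then cf p s 0 (n - s)
      else let j = s - (d - 3) in cf p 0 j (n - j)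
        + (if j = d - 1 then cf p 1 1 (n - 2) / of_nat (d - 2) else 0)
        + (if j = d then cf p 1 2 (n - 3) / of_nat (d - 2) + ccoeff d * cf p (d - 2) 0 (n - (d - 2)) else 0))"

lemma loc_coord_linear: "loc_coord d n s (p + q) = loc_coord d n s p + loc_coord d n s q" "loc_coord d n s (kscale c p) = c * loc_coord d n s p"
  by (simp_all add: loc_coord_def Let_def algebra_simps add_divide_distrib)

lemma loc_coord_gens:
  fixes u :: "('k::field_char_0) poly3"
  assumes d: "d \<ge> 4" and n: "d + 2 \<le> n" and s: "s < 2 * d - 2"
  shows "loc_coord d n s (u * gen1 d) = 0" "loc_coord d n s (u * gen2 d) = 0" "loc_coord d n s (u * gen3 d) = 0"
proof -
  have g1: "u * gen1 d = mon d 0 0 * u" by (simp add: gen1_def mult.commute)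
  have g2: "u * gen2 d = mon 0 (d - 1) 1 * u - kscale (of_nat (d - 2)) (mon 1 1 (d - 2) * u)"
    by (simp add: gen2_def kscale_conv_mult mult.commute right_diff_distrib)
  have g3: "u * gen3 d = mon 0 d 0 * u - kscale (of_nat (d - 1)) (mon 1 (d - 2) 1 * u) + mon (d - 2) 0 2 * u"
    by (simp add: gen3_def kscale_conv_mult mult.commute algebra_simps)
  show "loc_coord d n s (u * gen1 d) = 0"
    unfolding g1 loc_coord_def Let_def cf_mon_mult using d by auto
  define D where "D = (of_nat (d - 2) :: 'k)"
  define E where "E = (of_nat (d - 1) :: 'k)"
  have nz: "D \<noteq> 0" using d unfolding D_def of_nat_eq_0_iff by simp
  obtain e where e: "d = e + 4" using d by (metis add.commute le_iff_add)
  define m where "m = n - e - 6"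
  have m: "n = m + e + 6" using n e by (simp add: m_def)
  \<comment> \<open>For d = 4 the term x y^(d-2) z of the third generator meets the coordinate of
    y^d, and the contributions 1, -3/2 and 1/2 cancel only for these exact values.\<close>
  have DE: "D = 2" "E = 3" if "e = 0" using that by (simp_all add: D_def E_def e)
  \<comment> \<open>The first d - 2 coordinates belong to 1, x, ..., x^(d-3); the remaining d belong
    to y^j with j from 1 to d.\<close>
  define j where "j = s - (d - 3)"
  have cases: "s < d - 2 \<or> \<not> s < d - 2 \<and> 1 \<le> j \<and> j < d - 1 \<or> \<not> s < d - 2 \<and> j = d - 1 \<or> \<not> s < d - 2 \<and> j = d"
    unfolding j_def using s d by linarith
  then consider (small) "s < d - 2" | (mid) "\<not> s < d - 2" "1 \<le> j" "j < d - 1"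
    | (dm) "\<not> s < d - 2" "j = d - 1" | (dd) "\<not> s < d - 2" "j = d"
    by blast
  note cases = this
  show "loc_coord d n s (u * gen2 d) = 0"
    using cases
  proof cases
    case small then show ?thesis unfolding g2 loc_coord_def by (simp add: cf_mon_mult e)
  next
    case mid
    then show ?thesis
      unfolding g2 loc_coord_def Let_def j_def[symmetric] by (simp add: cf_mon_mult e)
  next
    case dm
    then show ?thesis
      using nz unfolding g2 loc_coord_def Let_def j_def[symmetric] D_def[symmetric]
      by (simp add: cf_mon_mult e m)
  next
    case dd
    then show ?thesis
      using nz unfolding g2 loc_coord_def Let_def j_def[symmetric] D_def[symmetric]
      by (simp add: cf_mon_mult e m)
  qed
  show "loc_coord d n s (u * gen3 d) = 0"
    using cases
  proof cases
    case small then show ?thesis unfolding g3 loc_coord_def by (simp add: cf_mon_mult e)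
  next
    case mid
    then show ?thesis
      unfolding g3 loc_coord_def Let_def j_def[symmetric] by (simp add: cf_mon_mult e)
  next
    case dm
    then show ?thesis
      using nz unfolding g3 loc_coord_def Let_def j_def[symmetric] D_def[symmetric] E_def[symmetric]
      by (simp add: cf_mon_mult e m)
  next
    case dd
    then show ?thesis
      using nz DE unfolding g3 loc_coord_def Let_def j_def[symmetric] D_def[symmetric] E_def[symmetric]
      by (cases "e = 0") (simp_all add: cf_mon_mult e m ccoeff_def)
  qed
qed

lemma loc_coord_ideal_J:
  fixes p :: "('k::field_char_0) poly3"
  assumes d: "d \<ge> 4" and n: "d + 2 \<le> n" and s: "s < 2 * d - 2" and p: "p \<in> ideal_J d"
  shows "loc_coord d n s p = 0"
proof -
  obtain u v w where "p = u * gen1 d + v * gen2 d + w * gen3 d" using p unfolding mem_ideal_J_iff by blast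
  then show ?thesis by (simp add: loc_coord_linear loc_coord_gens[OF d n s])
qed

text \<open>Elements of J_d are subtracted to remove the exceptional monomials outside the basis.
  The coordinates are then plain coefficients; their vanishing leaves only monomials that lie in J_d
  by \<open>large_monomials\<close>.\<close>

lemma loc_coord_zero_imp_mem:
  assumes d: "d \<ge> 4"
  shows "\<exists>N. \<forall>n\<ge>N. \<forall>p\<in>forms (int n). (\<forall>s<2 * d - 2. loc_coord d n s p = 0)
    \<longrightarrow> p \<in> (ideal_J d :: ('k::field_char_0) poly3 set)"
proof -
  let ?J = "ideal_J d :: 'k poly3 set"
  obtain N where N: "\<And>n i j l. n \<ge> N \<Longrightarrow> i + j + l = n \<Longrightarrow> \<not> exceptional d i j \<Longrightarrow> mon i j l \<in> ?J"
  proof -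
    obtain N where "\<forall>n\<ge>N. \<forall>i j l. i + j + l = n \<longrightarrow> \<not> exceptional d i j \<longrightarrow> mon i j l \<in> ?J"
      by (rule exE[OF large_monomials[OF d]]) (rule that)
    then show thesis by (intro that[of N]) simp
  qed
  obtain A where A5: "\<And>l. l \<ge> A \<Longrightarrow>
      kscale (of_nat (d - 2)) (mon 1 1 (l + (d - 3))) - mon 0 (d - 1) l \<in> ?J"
    and A6: "\<And>l. l \<ge> A \<Longrightarrow> mon (d - 2) 0 (l + 2) - kscale (ccoeff d) (mon 0 d l) \<in> ?J"
    by (rule large_z_relations[OF d]) (rule that)
  define N' where "N' = N + A + d + 2"
  have "p \<in> ?J" if n: "n \<ge> N'" and p: "p \<in> forms (int n)" and
    lam0: "\<And>s. s < 2 * d - 2 \<Longrightarrow> loc_coord d n s p = 0" for n p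
  proof -
    define a where "a = cf p 1 1 (n - 2)"
    define b where "b = cf p 1 2 (n - 3)"
    define c where "c = cf p (d - 2) 0 (n - (d - 2))"
    define D where "D = (of_nat (d - 2) :: 'k)"
    have D: "D \<noteq> 0" using d unfolding D_def of_nat_eq_0_iff by simp
    \<comment> \<open>These elements of J_d express x y, x y^2 and x^(d-2) through the basis
      monomials y^(d-1) and y^d.\<close>
    define G1 :: "'k poly3" where "G1 = mon 1 1 (n - 2) - kscale (1 / D) (mon 0 (d - 1) (n - (d - 1)))"
    define G2 :: "'k poly3" where "G2 = mon 1 2 (n - 3) - kscale (1 / D) (mon 0 d (n - d))"
    define G3 :: "'k poly3" where "G3 = mon (d - 2) 0 (n - (d - 2)) - kscale (ccoeff d) (mon 0 d (n - d))"
    define q where "q = p - kscale a G1 - kscale b G2 - kscale c G3"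
    have G: "G1 \<in> ?J" "G2 \<in> ?J" "G3 \<in> ?J"
    proof -
      have l: "n - (d - 1) + (d - 3) = n - 2" "n - d + (d - 3) = n - 3" "n - d + 2 = n - (d - 2)"
        using n d by (auto simp: N'_def)
      have "kscale (1 / D) (kscale D (mon 1 1 (n - 2)) - mon 0 (d - 1) (n - (d - 1))) \<in> ?J"
        using A5[of "n - (d - 1)"] n d unfolding l D_def by (intro ideal_J_kscale) (simp add: N'_def)
      then show "G1 \<in> ?J" using D by (simp add: G1_def kvs.scale_right_diff_distrib)
      have "kscale D (mon 1 1 (n - 3)) - mon 0 (d - 1) (n - d) \<in> ?J"
        using A5[of "n - d"] n d unfolding l D_def by (simp add: N'_def)
      then have "kscale (1 / D) (mon 0 1 0 * (kscale D (mon 1 1 (n - 3)) - mon 0 (d - 1) (n - d))) \<in> ?J"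
        by (rule ideal_J_kscale[OF ideal_J_closed(3)])
      moreover have "mon 0 1 0 * (kscale D (mon 1 1 (n - 3)) - mon 0 (d - 1) (n - d))
          = kscale D (mon 1 2 (n - 3)) - (mon 0 d (n - d) :: 'k poly3)"
      proof -
        have "mon 0 1 0 * mon 1 1 (n - 3) = (mon 1 2 (n - 3) :: 'k poly3)"
          "mon 0 1 0 * mon 0 (d - 1) (n - d) = (mon 0 d (n - d) :: 'k poly3)"
          using d by (simp_all add: mon_mult numeral_2_eq_2)
        moreover have "m * (kscale D u - v) = kscale D (m * u) - m * v" for m u v :: "'k poly3"
          unfolding kscale_conv_mult by (simp only: algebra_simps)
        ultimately show ?thesis by (simp only:)
      qed
      ultimately show "G2 \<in> ?J" using D by (simp add: G2_def kvs.scale_right_diff_distrib)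
      show "G3 \<in> ?J" using A6[of "n - d"] n d unfolding l G3_def by (simp add: N'_def)
    qed
    have e0: "cf p s 0 (n - s) = 0" if "s < d - 2" for s
      using lam0[of s] that d by (simp add: loc_coord_def)
    have ej: "cf p 0 j (n - j) + (if j = d - 1 then a / D else 0)
        + (if j = d then b / D + ccoeff d * c else 0) = 0" if "1 \<le> j" "j \<le> d" for j
    proof -
      have "\<not> j + (d - 3) < d - 2" "j + (d - 3) - (d - 3) = j" "j + (d - 3) < 2 * d - 2" using that d by auto
      then have "loc_coord d n (j + (d - 3)) p = 0" using lam0 by blast
      then show ?thesis
        unfolding loc_coord_def Let_def if_not_P[OF \<open>\<not> j + (d - 3) < d - 2\<close>] \<open>j + (d - 3) - (d - 3) = j\<close>
          a_def[symmetric] b_def[symmetric] c_def[symmetric] D_def[symmetric] .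
    qed
    have dne: "d - Suc 0 \<noteq> d" "d \<noteq> d - Suc 0" using d by auto
    have cfq: "mon i j l \<in> ?J" if nz: "cf q i j l \<noteq> 0" for i j l
    proof -
      have "q \<in> forms (int n)"
      proof -
        have mf: "mon i j l \<in> (forms (int n) :: 'k poly3 set)" if "i + j + l = n" for i j l
          using mon_forms[of i j l] that by simp
        have "mon 1 1 (n - 2) \<in> (forms (int n) :: 'k poly3 set)"
          "mon 0 (d - 1) (n - (d - 1)) \<in> (forms (int n) :: 'k poly3 set)"
          "mon 1 2 (n - 3) \<in> (forms (int n) :: 'k poly3 set)" "mon 0 d (n - d) \<in> (forms (int n) :: 'k poly3 set)"
          "mon (d - 2) 0 (n - (d - 2)) \<in> (forms (int n) :: 'k poly3 set)"
          by (rule mf, use n d in \<open>simp add: N'_def\<close>)+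
        then show ?thesis unfolding q_def G1_def G2_def G3_def by (intro forms_closed p)
      qed
      then have "int (i + j + l) = int n" using nz unfolding forms_def by blast
      then have ijl: "i + j + l = n" by (simp only: of_nat_eq_iff)
      then have l: "l = n - i - j" by simp
      have "\<not> exceptional d i j"
      proof
        assume "exceptional d i j"
        then consider "j = 0" "i < d - 2" | "j = 0" "i = d - 2" | "i = 0" "1 \<le> j" "j < d - 1"
          | "i = 0" "j = d - 1" | "i = 0" "j = d" | "i = 1" "j = 1" | "i = 1" "j = 2"
        proof -
          have "i < d - 2 \<or> i = d - 2" if "i \<le> d - 2" using that by linarith
          moreover have "j = 0 \<or> 1 \<le> j \<and> j < d - 1 \<or> j = d - 1 \<or> j = d" if "j \<le> d" using that by linarith
          moreover have "0 < d - 2" using d by simp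
          ultimately show thesis using \<open>exceptional d i j\<close> that unfolding exceptional_def by blast
        qed
        then have "cf q i j l = 0"
        proof cases
          case 1
          then show ?thesis using e0[of i] d n unfolding q_def G1_def G2_def G3_def l
            by (simp add: cf_mon)
        next
          case 2
          then show ?thesis using d n unfolding q_def G1_def G2_def G3_def l
            by (simp add: cf_mon c_def)
        next
          case 3
          then show ?thesis using ej[of j] d n dne unfolding q_def G1_def G2_def G3_def l
            by (auto simp: cf_mon)
        next
          case 4
          then show ?thesis using ej[of j] d n dne unfolding q_def G1_def G2_def G3_def l
            by (simp add: cf_mon algebra_simps)
        next
          case 5
          then show ?thesis using ej[of j] d n dne unfolding q_def G1_def G2_def G3_def l
            by (simp add: cf_mon algebra_simps)
        next
          case 6
          then show ?thesis using d n unfolding q_def G1_def G2_def G3_def l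
            by (simp add: cf_mon a_def numeral_eq_Suc)
        next
          case 7
          then show ?thesis using d n unfolding q_def G1_def G2_def G3_def l
            by (simp add: cf_mon b_def numeral_eq_Suc)
        qed
        then show False using nz by simp
      qed
      then show ?thesis using N[of n i j l] ijl n by (simp add: N'_def)
    qed
    have "q \<in> ?J" by (rule mem_ideal_of_monomials[OF ideal_ideal_J cfq])
    then have "q + kscale a G1 + kscale b G2 + kscale c G3 \<in> ?J"
      using G by (intro ideal_J_closed(2) ideal_J_kscale)
    then show ?thesis by (simp add: q_def)
  qed
  then show ?thesis by blast
qed

text \<open>For large n the local coordinates form a surjective linear map on the forms of degree n
  whose kernel is the degree n part of J_d; rank-nullity gives the codimension 2d - 2.\<close>

lemma dim_ideal_J_forms:
  assumes d: "d \<ge> 4"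
  shows "\<exists>N. \<forall>n\<ge>N. kvs.dim (forms (int n) :: ('k::field_char_0) poly3 set)
    = kvs.dim ((ideal_J d :: 'k poly3 set) \<inter> forms (int n)) + (2 * d - 2)"
proof -
  let ?J = "ideal_J d :: 'k poly3 set"
  obtain N where N: "\<And>n p. n \<ge> N \<Longrightarrow> p \<in> forms (int n) \<Longrightarrow> (\<forall>s<2 * d - 2. loc_coord d n s p = 0) \<Longrightarrow> p \<in> ?J"
    using loc_coord_zero_imp_mem[OF d, where ?'k = 'k] by blast
  have "kvs.dim (forms (int n) :: 'k poly3 set) = kvs.dim (?J \<inter> forms (int n)) + (2 * d - 2)"
    if n: "n \<ge> N + d + 2" for n
  proof -
    \<comment> \<open>Polynomials in x of degree below 2d - 2 serve as a model of k^(2d-2).\<close>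
    define S :: "(nat \<times> nat \<times> nat) set" where "S = (\<lambda>s. (s, 0, 0)) ` {..<2 * d - 2}"
    have S: "finite S" "card S = 2 * d - 2" by (auto simp: S_def card_image inj_on_def)
    define L where "L = (\<lambda>p :: 'k poly3. poly3_of S (\<lambda>(s, _, _). loc_coord d n s p))"
    have cfL: "cf (L p) i j l = (if j = 0 \<and> l = 0 \<and> i < 2 * d - 2 then loc_coord d n i p else 0)" for p i j l
      using S(1) by (auto simp: L_def cf_poly3_of S_def)
    have lin: "Vector_Spaces.linear kscale kscale L"
      by (rule kscale_linearI; intro poly3_eqI; simp add: cfL loc_coord_linear)
    have ker: "{p \<in> forms (int n). L p = 0} = ?J \<inter> forms (int n)"
    proof (intro equalityI subsetI)
      fix p assume p: "p \<in> {p \<in> forms (int n). L p = 0}"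
      have "loc_coord d n s p = 0" if "s < 2 * d - 2" for s
        using cfL[where p = p and i = s and j = 0 and l = 0] p that by simp
      then show "p \<in> ?J \<inter> forms (int n)" using N[of n p] p n by simp
    next
      fix p assume p: "p \<in> ?J \<inter> forms (int n)"
      then have "L p = 0" using loc_coord_ideal_J[OF d, of n _ p] n by (intro poly3_eqI) (simp add: cfL)
      then show "p \<in> {p \<in> forms (int n). L p = 0}" using p by simp
    qed
    have img: "L ` forms (int n) = supported S"
    proof (intro equalityI subsetI)
      fix q assume "q \<in> L ` forms (int n)"
      then show "q \<in> supported S" by (auto simp: supported_def cfL S_def split: if_splits)
    next
      fix q :: "'k poly3" assume q: "q \<in> supported S"
      \<comment> \<open>The preimage uses only basis monomials, made homogeneous with z; on their
        span the correction terms of the coordinates are zero.\<close>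
      define T where "T = (\<lambda>s. (s, 0::nat, n - s)) ` {..<d - 2} \<union> (\<lambda>j. (0::nat, j, n - j)) ` {1..d}"
      define p where "p = poly3_of T (\<lambda>(i, j, _). if j = 0 then cf q i 0 0 else cf q (j + (d - 3)) 0 0)"
      have T: "finite T" by (simp add: T_def)
      have cfp: "cf p i j l = (if (i, j, l) \<in> T then if j = 0 then cf q i 0 0 else cf q (j + (d - 3)) 0 0 else 0)"
        for i j l using T by (simp add: p_def cf_poly3_of)
      have pn: "p \<in> forms (int n)"
        unfolding forms_def using n d by (auto simp: cfp T_def split: if_splits)
      have "L p = q"
      proof (intro poly3_eqI)
        fix i j l
        have outside: "cf q i j l = 0" if "\<not> (j = 0 \<and> l = 0 \<and> i < 2 * d - 2)"
          using q that by (auto simp: supported_def S_def)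
        have inside: "loc_coord d n i p = cf q i 0 0" if i: "i < 2 * d - 2"
        proof (cases "i < d - 2")
          case True
          then show ?thesis by (simp add: loc_coord_def cfp T_def)
        next
          case False
          define j where "j = i - (d - 3)"
          have j: "1 \<le> j" "j \<le> d" "j + (d - 3) = i" using False i d by (auto simp: j_def)
          have "(1, 1, n - 2) \<notin> T" "(1, 2, n - 3) \<notin> T" "(d - 2, 0, n - (d - 2)) \<notin> T" "(0, j, n - j) \<in> T"
            using d j by (auto simp: T_def)
          then show ?thesis using False j unfolding loc_coord_def Let_def j_def[symmetric] by (simp add: cfp)
        qed
        show "cf (L p) i j l = cf q i j l" using outside inside by (auto simp: cfL)
      qed
      then show "q \<in> L ` forms (int n)" using pn by blast
    qed
    show ?thesis
      using k_k.rank_nullity[OF lin forms_subspace forms_finite_span, of "int n"]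
      unfolding ker img using supported_dim(1)[OF S(1), where ?'k = 'k] S(2) by simp
  qed
  then show ?thesis by blast
qed

lemma quot_multiplicity_ideal_J:
  assumes d: "d \<ge> 4"
  shows "quot_multiplicity (ideal_J d :: ('k::field_char_0) poly3 set) = of_nat (2 * d - 2)"
proof (rule quot_multiplicity_eventually_const)
  obtain N where "\<forall>n\<ge>N. kvs.dim (forms (int n) :: 'k poly3 set)
    = kvs.dim ((ideal_J d :: 'k poly3 set) \<inter> forms (int n)) + (2 * d - 2)"
    using dim_ideal_J_forms[OF d] by blast
  then show "\<forall>\<^sub>F n in sequentially. hilbert_fun (ideal_J d :: 'k poly3 set) n = 2 * d - 2"
    unfolding eventually_sequentially hilbert_fun_def by (intro exI[of _ N]) simp
qed (use d in simp)

section \<open>The height of \<open>J\<^sub>d\<close>\<close>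

lemma prime_xy_subset:
  fixes P :: "('k::field) poly3 set"
  assumes "primeideal P R3" "var_x \<in> P" "var_y \<in> P"
  shows "prime_xy \<subseteq> P"
  using type_idealD(2,4)[OF type_primeidealD(1)[OF assms(1)]] assms(2,3) by (auto simp: mem_prime_xy_iff)

lemma prime_xz_subset:
  fixes P :: "('k::field) poly3 set"
  assumes "primeideal P R3" "var_x \<in> P" "var_z \<in> P"
  shows "prime_xz \<subseteq> P"
  using type_idealD(2,4)[OF type_primeidealD(1)[OF assms(1)]] assms(2,3) by (auto simp: mem_prime_xz_iff)

text \<open>The first hypothesis puts a prime of height two inside every prime over \<open>I\<close>
  and so bounds the height from below; the second exhibits a prime of height two over
  \<open>I\<close>.\<close>

lemma ideal_height_eq_2:
  fixes I :: "('k::field) poly3 set"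
  assumes "\<And>P. primeideal P R3 \<Longrightarrow> I \<subseteq> P \<Longrightarrow> prime_xy \<subseteq> P \<or> prime_xz \<subseteq> P"
    and "I \<subseteq> prime_xy \<or> I \<subseteq> prime_xz"
  shows "ideal_height R3 I = 2"
  unfolding ideal_height_def
proof (rule antisym)
  have "2 \<in> prime_height R3 ` {P. primeideal P R3 \<and> I \<subseteq> P}"
    using assms(2)
  proof
    assume "I \<subseteq> prime_xy"
    then show ?thesis
      by (intro image_eqI[of _ _ prime_xy]) (simp_all add: prime_height_prime_xy primeideal_prime_xy)
  next
    assume "I \<subseteq> prime_xz"
    then show ?thesis
      by (intro image_eqI[of _ _ prime_xz]) (simp_all add: prime_height_prime_xz primeideal_prime_xz)
  qed
  then show "Inf (prime_height R3 ` {P. primeideal P R3 \<and> I \<subseteq> P}) \<le> 2" by (rule Inf_lower)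
  show "2 \<le> Inf (prime_height R3 ` {P. primeideal P R3 \<and> I \<subseteq> P})"
    by (rule Inf_greatest) (use assms(1) in \<open>auto intro: prime_height_supset_ge_2\<close>)
qed

lemma gens_mem_prime_xy:
  assumes "d \<ge> 4"
  shows "gen1 d \<in> prime_xy" "gen2 d \<in> prime_xy" "gen3 d \<in> prime_xy"
  using assms by (auto simp: prime_xy_def gen1_def gen2_def gen3_def cf_mon)

lemma ideal_J_subset_prime_xy:
  assumes "d \<ge> 4"
  shows "ideal_J d \<subseteq> (prime_xy :: ('k::field) poly3 set)"
proof -
  have "ideal (prime_xy :: 'k poly3 set) R3" by (rule type_primeidealD(1)[OF primeideal_prime_xy])
  note P = type_idealD(2,3)[OF this]
  show ?thesis by (auto simp: mem_ideal_J_iff intro!: P gens_mem_prime_xy[OF assms])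
qed

lemma ideal_height_ideal_J:
  assumes d: "d \<ge> 4"
  shows "ideal_height R3 (ideal_J d :: ('k::field_char_0) poly3 set) = 2"
proof (rule ideal_height_eq_2)
  fix P :: "'k poly3 set" assume P: "primeideal P R3" "ideal_J d \<subseteq> P"
  note PI = type_idealD[OF type_primeidealD(1)[OF P(1)]]
  obtain e where e: "d = e + 4" using d by (metis add.commute le_iff_add)
  have "gen1 d \<in> P" "gen3 d \<in> P" using gen_mem_ideal_J P(2) by blast+
  then have x: "var_x \<in> P" unfolding gens_expanded(1)[OF e] using type_primeideal_powerD[OF P(1)] by blast
  define w where "w = of_nat (e + 3) * (var_y ^ (e + 2) * var_z) - var_x ^ (e + 1) * (var_z :: 'k poly3) ^ 2"
  have "gen3 d + var_x * w = var_y ^ (e + 4)"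
  proof -
    have "var_x ^ (e + 2) = var_x * (var_x ^ (e + 1) :: 'k poly3)" by simp
    moreover have "y - c * (x * y' * z) + x * x' * z2 + x * (c * (y' * z) - x' * z2) = y"
      for y c x y' z x' z2 :: "'k poly3" by (simp add: algebra_simps)
    ultimately show ?thesis unfolding gens_expanded(3)[OF e] w_def by (simp only:)
  qed
  moreover have "gen3 d + var_x * w \<in> P" using \<open>gen3 d \<in> P\<close> PI(4)[OF x] by (rule PI(2))
  ultimately have "var_y ^ (e + 4) \<in> P" by simp
  then have "var_y \<in> P" by (rule type_primeideal_powerD[OF P(1)])
  then show "prime_xy \<subseteq> P \<or> prime_xz \<subseteq> P" using prime_xy_subset[OF P(1) x] by blast
qed (use ideal_J_subset_prime_xy[OF d] in blast)

section \<open>The initial degree of the syzygy module\<close>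

text \<open>Here \<open>A\<close> and \<open>B\<close> are the coefficients of \<open>x\<^bsup>i\<^esup>z\<^bsup>l\<^esup>\<close>, with \<open>y = 1\<close>, of the last two entries of a
  syzygy, and the equation is the vanishing of the coefficients of \<open>x\<^bsup>i\<^esup>\<close> for \<open>i < d\<close>. It is solved
  by descending induction on the weight \<open>l - i\<close>.\<close>

lemma syzygy_coefficients_zero:
  fixes A B :: "int \<Rightarrow> int \<Rightarrow> 'k::field" and D E :: 'k and d :: int
  assumes d: "d \<ge> 5" and D: "D \<noteq> 0"
    and A: "\<And>i l. A i l \<noteq> 0 \<Longrightarrow> 0 \<le> i \<and> 0 \<le> l \<and> i + l \<le> d \<and> i \<le> d - 1"
    and B: "\<And>i l. B i l \<noteq> 0 \<Longrightarrow> 0 \<le> i \<and> 0 \<le> l \<and> i + l \<le> d - 1"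
    and eq: "\<And>i l. i \<le> d - 1 \<Longrightarrow>
      A i (l - 1) - D * A (i - 1) (l - d + 2) + B i l - E * B (i - 1) (l - 1) + B (i - d + 2) (l - 2) = 0"
    and A00: "A 0 0 = 0"
  shows "A i l = 0" "B i l = 0"
proof -
  have A0: "A i l = 0" if "\<not> (0 \<le> i \<and> 0 \<le> l \<and> i + l \<le> d \<and> i \<le> d - 1)" for i l using A that by blast
  have B0: "B i l = 0" if "\<not> (0 \<le> i \<and> 0 \<le> l \<and> i + l \<le> d - 1)" for i l using B that by blast
  \<comment> \<open>Above weight \<open>w + d - 3\<close> no \<open>A\<close> enters the equation.
    The last \<open>B\<close>-term has weight l - i + d - 4, which is larger as d \<ge> 5, and
    vanishes by induction. What remains is B i l = E B (i-1) (l-1), which starts from 0 at i =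
    0.\<close>
  have B_high: "B i l = 0" if Aw: "\<And>i l. l - i > w \<Longrightarrow> A i l = 0" and v: "l - i > w + d - 3" for w i l
    using v
  proof (induction "nat (d - (l - i))" arbitrary: i l rule: less_induct)
    case (less i l)
    show ?case
    proof (cases "0 \<le> i \<and> 0 \<le> l \<and> i + l \<le> d - 1")
      case True
      define v where "v = l - i"
      have "B i' (i' + v) = 0" if "i' \<le> d - 1" for i'
      proof (cases "0 \<le> i'")
        case True
        then show ?thesis using that
        proof (induction i' rule: int_ge_induct)
          case base
          have "A 0 (v - 1) = 0" by (rule Aw) (use less.prems d v_def in linarith)
          moreover have "A (0 - 1) (v - d + 2) = 0" "B (0 - 1) (v - 1) = 0" "B (0 - d + 2) (v - 2) = 0"
            using d by (auto intro: A0 B0)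
          ultimately show ?case using eq[of 0 v] d by simp
        next
          case (step i')
          have "A (i' + 1) (i' + 1 + v - 1) = 0" by (rule Aw) (use less.prems d v_def in linarith)
          moreover have "A (i' + 1 - 1) (i' + 1 + v - d + 2) = 0"
            by (rule Aw) (use less.prems d v_def in linarith)
          moreover have "B (i' + 1 - 1) (i' + 1 + v - 1) = 0" using step by simp
          moreover have "B (i' + 1 - d + 2) (i' + 1 + v - 2) = 0"
          proof (cases "v < d")
            case True
            show ?thesis
              by (rule less.hyps) (use True less.prems d v_def in linarith)+
          next
            case False then show ?thesis using step d by (intro B0) linarith
          qed
          ultimately show ?case using eq[of "i' + 1" "i' + 1 + v"] step.prems
            by (simp only: diff_0 mult_zero_right add_0 minus_zero add_0_right diff_zero)
        qed
      qed (use B0 in auto)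
      then have "B i (i + v) = 0" using True by auto
      then show ?thesis by (simp add: v_def)
    qed (rule B0)
  qed
  \<comment> \<open>The induction starts above weight \<open>d\<close>, where the support of
    \<open>A\<close> ends.\<close>
  have weight: "A i l = 0" if "l - i > d - int k" for k i l
    using that
  proof (induction k arbitrary: i l)
    case 0
    then show ?case by (intro A0) linarith
  next
    case (Suc k)
    define w where "w = d - int k"
    have Aw: "A i l = 0" if "l - i > w" for i l using Suc.IH that by (simp add: w_def)
    \<comment> \<open>\<open>a\<close> is the line of weight \<open>w\<close> of \<open>A\<close>,
      and \<open>b\<close> the line of weight \<open>w + d - 3\<close> of \<open>B\<close>. In the
      equations of weight \<open>w + d - 3\<close> every other term lies in a higher weight, already
      known to be zero; hence the coupling \<open>rec\<close>.\<close>
    define a where "a = (\<lambda>i. A i (i + w))"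
    define b where "b = (\<lambda>i. B i (i + w + d - 3))"
    have a0: "a i = 0" if "\<not> (0 \<le> i \<and> 0 \<le> i + w \<and> 2 * i + w \<le> d \<and> i \<le> d - 1)" for i
      unfolding a_def by (rule A0) (use that in linarith)
    have b0: "b i = 0" if "\<not> (0 \<le> i \<and> 2 * i + w \<le> 2)" for i
      unfolding b_def by (rule B0) (use that in linarith)
    have rec: "D * a (i - 1) = b i - E * b (i - 1)" if "i \<le> d - 1" for i
    proof -
      have "A i (i + w + d - 3 - 1) = 0" by (rule Aw) (use d in linarith)
      moreover have "B (i - d + 2) (i + w + d - 3 - 2) = 0"
        by (rule B_high[of w]) (use Aw d in \<open>simp_all\<close>)
      moreover have "i + w + d - 3 - d + 2 = i - 1 + w" "i + w + d - 3 - 1 = i - 1 + w + d - 3" by simp_all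
      ultimately show ?thesis using eq[OF that, of "i + w + d - 3"] unfolding a_def b_def
        by (simp add: algebra_simps)
    qed
    have main: "a i = 0" if i: "i \<le> d - 2" for i
    proof -
      have Da: "D * a i = b (i + 1) - E * b i" using rec[of "i + 1"] i by simp
      show ?thesis
      proof (cases "0 \<le> i \<and> 0 \<le> i + w")
        case True
        show ?thesis
        proof (cases "w \<ge> 0")
          case w: True
          \<comment> \<open>For w \<ge> 0 the support leaves only \<open>b 0\<close> and
            \<open>b 1\<close>. In weight 0 the value \<open>a 0\<close>, which is
            \<open>A 0 0\<close>, is a free parameter of the recursion and has to be zero by
            assumption.\<close>
          have b00: "b 0 = 0" using rec[of 0] a0[of "-1"] b0[of "-1"] d by simp
          have b1: "b 1 = 0"
          proof (cases "w = 0")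
            case True
            then have "a 0 = 0" using A00 by (simp add: a_def)
            then show ?thesis using rec[of 1] b00 d by simp
          qed (use w in \<open>intro b0; linarith\<close>)
          have "b (i + 1) = 0" using b1 True w by (cases "i = 0") (auto intro: b0)
          moreover have "b i = 0"
            using b1 b00 True w by (cases "i = 0"; cases "i = 1") (auto intro: b0)
          ultimately show ?thesis using Da D by simp
        next
          case w: False
          \<comment> \<open>For i < -w the exponent i + w of z is negative, so \<open>a\<close>
            vanishes and the recursion carries \<open>b 0 = 0\<close> up to i = -w. Beyond that
            index \<open>b\<close> has no support.\<close>
          have low: "b j = 0" if "0 \<le> j" "j \<le> - w" "j \<le> d - 1" for j
            using that
          proof (induction j rule: int_ge_induct)
            case base
            then show ?case using rec[of 0] a0[of "-1"] b0[of "-1"] d by simp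
          next
            case (step j)
            then have "b j = 0" "a j = 0" using a0[of j] by auto
            then show ?case using rec[of "j + 1"] step.prems by simp
          qed
          have "b (i + 1) = 0" using True w by (intro b0) auto
          moreover have "b i = 0"
          proof (cases "i = - w")
            case True then show ?thesis using low[of i] i w by simp
          next
            case False then show ?thesis using True w by (intro b0) auto
          qed
          ultimately show ?thesis using Da D by simp
        qed
      qed (use a0 in blast)
    qed
    \<comment> \<open>\<open>rec\<close> would need the coefficient of x^d here, on which there is
      no condition. The support leaves only the exponents l = 0 and l = 1 of z, and the equation
      whose first term is A (d-1) l settles both.\<close>
    have top: "a (d - 1) = 0"
    proof (cases "2 * (d - 1) + w \<le> d \<and> 0 \<le> d - 1 + w")
      case True
      define l where "l = d - 1 + w"
      have l: "l = 0 \<or> l = 1" using True unfolding l_def by auto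
      have Bi0: "B i 0 = 0" if "i \<le> d - 1" for i
      proof -
        have "A i (0 - 1) = 0" "A (i - 1) (0 - d + 2) = 0" "B (i - 1) (0 - 1) = 0" "B (i - d + 2) (0 - 2) = 0"
          using d by (auto intro: A0 B0)
        then show ?thesis using eq[OF that, of 0] by simp
      qed
      have "B (d - 1) (l + 1) = 0" "A (d - 1 - 1) (l + 1 - d + 2) = 0"
        using l d by (auto intro!: A0 B0)
      moreover have "B (d - 1 - 1) (l + 1 - 1) = 0"
        using l
      proof
        assume "l = 0" then show ?thesis using Bi0[of "d - 2"] by simp
      next
        assume "l = 1"
        then have "d - 2 + w = 1 - 1" by (simp add: l_def)
        then have "A (d - 2) (1 - 1) = 0" using main[of "d - 2"] unfolding a_def by simp
        moreover have "A (d - 2 - 1) (1 - d + 2) = 0" "B (d - 2 - d + 2) (1 - 2) = 0"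
          using d by (auto intro!: A0 B0)
        moreover have "B (d - 2 - 1) (1 - 1) = 0" using Bi0[of "d - 3"] by simp
        ultimately have "B (d - 2) 1 = 0" using eq[of "d - 2" 1] by simp
        then show ?thesis using \<open>l = 1\<close> by simp
      qed
      moreover have "B (d - 1 - d + 2) (l + 1 - 2) = 0"
        using l Bi0[of 1] B0[of 1 "-1"] d by auto
      ultimately have "A (d - 1) l = 0" using eq[of "d - 1" "l + 1"] by simp
      then show ?thesis by (simp only: a_def l_def)
    qed (rule a0, linarith)
    have "a i = 0" for i
    proof -
      consider "i \<le> d - 2" | "i = d - 1" | "i \<ge> d" by linarith
      then show ?thesis using main top a0[of i] by cases auto
    qed
    then have "A i (i + w) = 0" for i by (simp add: a_def)
    then have "l - i = w \<Longrightarrow> A i l = 0" by (metis add.commute diff_add_cancel)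
    moreover have "l - i > w \<or> l - i = w" using Suc.prems w_def by linarith
    ultimately show ?case using Aw by blast
  qed
  have Aall: "A i l = 0" for i l
    using weight[where i = i and l = l and k = "nat (d + 1 - (l - i))"] by (cases "d + 1 \<le> l - i") (auto intro: A0)
  show "A i l = 0" by (rule Aall)
  show "B i l = 0" using B_high[where w = "l - i - d + 2" and i = i and l = l] Aall by simp
qed

text \<open>For d = 4 the three \<open>B\<close>-terms of an equation share one weight, so
  \<open>B\<close> cannot be determined before \<open>A\<close>. The equations still split by
  weight, and for each weight from 3 down to -3 of \<open>A\<close> they form an invertible system
  in at most three unknowns, once values found in the same weight are inserted.\<close>

lemma syzygy_coefficients_zero_4:
  fixes A B :: "int \<Rightarrow> int \<Rightarrow> 'k::field_char_0"
  assumes A: "\<And>i l. A i l \<noteq> 0 \<Longrightarrow> 0 \<le> i \<and> 0 \<le> l \<and> i + l \<le> 3"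
    and B: "\<And>i l. B i l \<noteq> 0 \<Longrightarrow> 0 \<le> i \<and> 0 \<le> l \<and> i + l \<le> 3"
    and eq: "\<And>i l. i \<le> 3 \<Longrightarrow>
      A i (l - 1) - 2 * A (i - 1) (l - 2) + B i l - 3 * B (i - 1) (l - 1) + B (i - 2) (l - 2) = 0"
  shows "A i l = 0" "B i l = 0"
proof -
  have A0: "A i l = 0" if "i < 0 \<or> l < 0 \<or> i + l > 3" for i l using A[of i l] that by fastforce
  have B0: "B i l = 0" if "i < 0 \<or> l < 0 \<or> i + l > 3" for i l using B[of i l] that by fastforce
  have lin2: "a = 0 \<and> b = 0" if "a + b = 0" "- 2 * a - 3 * b = 0" for a b :: 'k
  proof -
    have "b = - a" using that(1) by (simp add: eq_neg_iff_add_eq_0 add.commute)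
    then show ?thesis using that(2) by simp
  qed
  have lin3: "a = 0 \<and> a' = 0 \<and> b = 0" if "a + b = 0" "a' - 2 * a - 3 * b = 0" "- 2 * a' + b = 0" for a a' b :: 'k
  proof -
    have b: "b = - a" using that(1) by (simp add: eq_neg_iff_add_eq_0 add.commute)
    have "a' + a = 0" using that(2) unfolding b by (simp add: algebra_simps)
    then have a': "a' = - a" by (simp add: eq_neg_iff_add_eq_0)
    show ?thesis using that(3) unfolding a' b by simp
  qed
  have w3: "A 0 3 = 0" using eq[of 0 4] by (simp add: A0 B0)
  have w2: "A 0 2 = 0" "B 0 3 = 0"
  proof -
    have "A 0 2 + B 0 3 = 0" using eq[of 0 3] by (simp add: A0 B0)
    moreover have "- 2 * A 0 2 - 3 * B 0 3 = 0" using eq[of 1 4] by (simp add: A0 B0)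
    ultimately show "A 0 2 = 0" "B 0 3 = 0" using lin2 by blast+
  qed
  have w1: "A 0 1 = 0" "A 1 2 = 0" "B 0 2 = 0"
  proof -
    have "A 0 1 + B 0 2 = 0" using eq[of 0 2] by (simp add: A0 B0)
    moreover have "A 1 2 - 2 * A 0 1 - 3 * B 0 2 = 0" using eq[of 1 3] by (simp add: A0 B0)
    moreover have "- 2 * A 1 2 + B 0 2 = 0" using eq[of 2 4] by (simp add: A0 B0)
    ultimately show "A 0 1 = 0" "A 1 2 = 0" "B 0 2 = 0" using lin3 by blast+
  qed
  have w0: "A 0 0 = 0" "A 1 1 = 0" "B 0 1 = 0" "B 1 2 = 0"
  proof -
    show B12: "B 1 2 = 0" using eq[of 3 4] by (simp add: A0 B0)
    have "A 0 0 + B 0 1 = 0" using eq[of 0 1] by (simp add: A0 B0)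
    moreover have "A 1 1 - 2 * A 0 0 - 3 * B 0 1 = 0" using eq[of 1 2] by (simp add: A0 B0 B12)
    moreover have "- 2 * A 1 1 + B 0 1 = 0" using eq[of 2 3] by (simp add: A0 B0 B12)
    ultimately show "A 0 0 = 0" "A 1 1 = 0" "B 0 1 = 0" using lin3 by blast+
  qed
  have w_1: "A 1 0 = 0" "A 2 1 = 0" "B 0 0 = 0" "B 1 1 = 0"
  proof -
    show B00: "B 0 0 = 0" using eq[of 0 0] by (simp add: A0 B0)
    have "A 1 0 + B 1 1 = 0" using eq[of 1 1] by (simp add: A0 B0 B00)
    moreover have "A 2 1 - 2 * A 1 0 - 3 * B 1 1 = 0" using eq[of 2 2] by (simp add: A0 B0 B00)
    moreover have "- 2 * A 2 1 + B 1 1 = 0" using eq[of 3 3] by (simp add: A0 B0)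
    ultimately show "A 1 0 = 0" "A 2 1 = 0" "B 1 1 = 0" using lin3 by blast+
  qed
  have w_2: "A 2 0 = 0" "B 1 0 = 0" "B 2 1 = 0"
  proof -
    show B10: "B 1 0 = 0" using eq[of 1 0] by (simp add: A0 B0)
    have "A 2 0 + B 2 1 = 0" using eq[of 2 1] by (simp add: A0 B0 B10)
    moreover have "- 2 * A 2 0 - 3 * B 2 1 = 0" using eq[of 3 2] by (simp add: A0 B0 B10)
    ultimately show "A 2 0 = 0" "B 2 1 = 0" using lin2 by blast+
  qed
  have w_3: "A 3 0 = 0" "B 2 0 = 0" "B 3 0 = 0"
  proof -
    show "B 2 0 = 0" using eq[of 2 0] by (simp add: A0 B0)
    then show "A 3 0 = 0" using eq[of 3 1] by (simp add: A0 B0)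
    show "B 3 0 = 0" using eq[of 3 0] by (simp add: A0 B0)
  qed
  have range: "i = 0 \<and> (l = 0 \<or> l = 1 \<or> l = 2 \<or> l = 3) \<or> i = 1 \<and> (l = 0 \<or> l = 1 \<or> l = 2)
      \<or> i = 2 \<and> (l = 0 \<or> l = 1) \<or> i = 3 \<and> l = 0" if "0 \<le> i" "0 \<le> l" "i + l \<le> 3"
    using that by arith
  show "A i l = 0"
    using range A[of i l] w3 w2 w1 w0 w_1 w_2 w_3 by (cases "A i l = 0") auto
  show "B i l = 0"
    using range B[of i l] w3 w2 w1 w0 w_1 w_2 w_3 by (cases "B i l = 0") auto
qed

text \<open>Coefficients of a form of degree \<open>n\<close>, with the exponent of y left implicit
  and extended by zero to integer indices, so that shifted indices need no case distinction.\<close>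

definition cfi :: "nat \<Rightarrow> ('k::field) poly3 \<Rightarrow> int \<Rightarrow> int \<Rightarrow> 'k" where
  "cfi n p i l = (if 0 \<le> i \<and> 0 \<le> l \<and> i + l \<le> int n
     then cf p (nat i) (nat (int n - i - l)) (nat l) else 0)"

lemma cf_mon_mult_cfi:
  assumes "a + b + c = d" "i + j + l = n + d"
  shows "cf (mon a b c * p) i j l = cfi n p (int i - int a) (int l - int c)"
proof (cases "a \<le> i \<and> b \<le> j \<and> c \<le> l")
  case True
  then have "nat (int i - int a) = i - a" "nat (int l - int c) = l - c"
    "nat (int n - (int i - int a) - (int l - int c)) = j - b"
    "int i - int a + (int l - int c) \<le> int n"
    using assms by linarith+
  then show ?thesis using True by (simp add: cf_mon_mult cfi_def)
next
  case False
  then have "\<not> (0 \<le> int i - int a \<and> 0 \<le> int l - int c \<and> int i - int a + (int l - int c) \<le> int n)"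
    using assms by linarith
  then show ?thesis using False by (auto simp: cf_mon_mult cfi_def)
qed

lemma cfi_eq_0_imp:
  assumes "p \<in> forms (int n)" "\<And>i l. cfi n p i l = 0"
  shows "p = 0"
proof (rule poly3_eqI)
  fix i j l
  have "cf p i j l = 0"
  proof (rule ccontr)
    assume nz: "cf p i j l \<noteq> 0"
    then have "int (i + j + l) = int n" using assms(1) unfolding forms_def by blast
    then have "nat (int n - int i - int l) = j" "int i + int l \<le> int n" by linarith+
    then have "cfi n p (int i) (int l) = cf p i j l" by (simp add: cfi_def)
    then show False using nz assms(2) by simp
  qed
  then show "cf p i j l = cf 0 i j l" by simp
qed

text \<open>Only exponents i < d of x are compared, to which x^d \<open>a1\<close> contributes
  nothing; this eliminates \<open>a1\<close>.\<close>

lemma cfi_equation: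
  fixes a1 a2 a3 :: "('k::field) poly3"
  assumes d: "d \<ge> 4" and eq: "a1 * gen1 d + a2 * gen2 d + a3 * gen3 d = 0" and i: "i \<le> int d - 1"
  shows "cfi n a2 i (l - 1) - of_nat (d - 2) * cfi n a2 (i - 1) (l - int d + 2) + cfi n a3 i l
    - of_nat (d - 1) * cfi n a3 (i - 1) (l - 1) + cfi n a3 (i - int d + 2) (l - 2) = 0"
proof (cases "0 \<le> i \<and> 0 \<le> l \<and> i + l \<le> int (n + d)")
  case False
  have "cfi n a2 i (l - 1) = 0" "cfi n a2 (i - 1) (l - int d + 2) = 0" "cfi n a3 i l = 0"
    "cfi n a3 (i - 1) (l - 1) = 0" "cfi n a3 (i - int d + 2) (l - 2) = 0"
    using False d i unfolding cfi_def by (auto split: if_splits)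
  then show ?thesis by simp
next
  case True
  define i' l' where "i' = nat i" and "l' = nat l"
  define j where "j = n + d - i' - l'"
  have il: "int i' = i" "int l' = l" using True by (simp_all add: i'_def l'_def)
  have sum: "i' + j + l' = n + d" using True il by (simp add: j_def)
  have dd: "int (d - 2) = int d - 2" "0 + (d - 1) + 1 = d" "1 + 1 + (d - 2) = d" "0 + d + 0 = d"
    "1 + (d - 2) + 1 = d" "d - 2 + 0 + 2 = d" using d by auto
  note m = cf_mon_mult_cfi[OF _ sum]
  have e: "a1 * gen1 d + a2 * gen2 d + a3 * gen3 d = mon d 0 0 * a1
     + (mon 0 (d - 1) 1 * a2 - kscale (of_nat (d - 2)) (mon 1 1 (d - 2) * a2))
     + (mon 0 d 0 * a3 - kscale (of_nat (d - 1)) (mon 1 (d - 2) 1 * a3) + mon (d - 2) 0 2 * a3)"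
    unfolding gen1_def gen2_def gen3_def kscale_conv_mult by (simp only: algebra_simps)
  have "cf (mon d 0 0 * a1) i' j l' = 0" using i il by (simp add: cf_mon_mult)
  then have "0 = cf (a1 * gen1 d + a2 * gen2 d + a3 * gen3 d) i' j l'
      - cf (mon d 0 0 * a1) i' j l'" unfolding eq by simp
  also have "\<dots> = cfi n a2 i (l - 1) - of_nat (d - 2) * cfi n a2 (i - 1) (l - int (d - 2))
    + (cfi n a3 i l - of_nat (d - 1) * cfi n a3 (i - 1) (l - 1) + cfi n a3 (i - int (d - 2)) (l - 2))"
    unfolding e coeff_add coeff_diff kscale_coeff m[OF dd(2)] m[OF dd(3)] m[OF dd(4)] m[OF dd(5)] m[OF dd(6)] il
    by simp
  finally show ?thesis unfolding dd(1) by (simp add: algebra_simps)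
qed

text \<open>For d \<ge> 5 the recursion lemma asks for \<open>A 0 0 = 0\<close>. A multiple of the
  Koszul solution is subtracted to achieve this, and its degree d then shows the multiple to be
  zero.\<close>

lemma no_small_syzygies:
  fixes a1 a2 a3 :: "('k::field_char_0) poly3"
  assumes d: "d \<ge> 4" and n: "n < d" and a: "a2 \<in> forms (int n)" "a3 \<in> forms (int n)"
    and eq: "a1 * gen1 d + a2 * gen2 d + a3 * gen3 d = 0"
  shows "a1 = 0 \<and> a2 = 0 \<and> a3 = 0"
proof -
  define A where "A = cfi n a2"
  define B where "B = cfi n a3"
  define D where "D = (of_nat (d - 2) :: 'k)"
  define E where "E = (of_nat (d - 1) :: 'k)"
  have sys: "A i (l - 1) - D * A (i - 1) (l - int d + 2) + B i l
      - E * B (i - 1) (l - 1) + B (i - int d + 2) (l - 2) = 0" if "i \<le> int d - 1" for i l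
    using cfi_equation[OF d eq that] by (simp add: A_def B_def D_def E_def)
  have supp: "0 \<le> i \<and> 0 \<le> l \<and> i + l \<le> int d - 1" if "A i l \<noteq> 0 \<or> B i l \<noteq> 0" for i l
    using that n by (auto simp: A_def B_def cfi_def split: if_splits)
  have "A i l = 0 \<and> B i l = 0" for i l
  proof (cases "d = 4")
    case True
    have "of_nat (4 - 2) = (2 :: 'k)" "of_nat (4 - 1) = (3 :: 'k)" by simp_all
    then have "A i (l - 1) - 2 * A (i - 1) (l - 2) + B i l - 3 * B (i - 1) (l - 1) + B (i - 2) (l - 2) = 0"
      if "i \<le> 3" for i l
      using sys[where i = i and l = l] that unfolding True D_def E_def by simp
    moreover have "0 \<le> i \<and> 0 \<le> l \<and> i + l \<le> 3" if "A i l \<noteq> 0" for i l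
      using supp[where i = i and l = l] that True by simp
    moreover have "0 \<le> i \<and> 0 \<le> l \<and> i + l \<le> 3" if "B i l \<noteq> 0" for i l
      using supp[where i = i and l = l] that True by simp
    ultimately show ?thesis
      using syzygy_coefficients_zero_4[of A B i l] by blast
  next
    case False
    then have d5: "int d \<ge> 5" using d by simp
    define dl :: "int \<Rightarrow> int \<Rightarrow> int \<Rightarrow> int \<Rightarrow> 'k"
      where "dl = (\<lambda>p q i l. if i = p \<and> l = q then 1 else (0 :: 'k))"
    have shift: "dl p q (i - u) (l - v) = dl (p + u) (q + v) i l" for p q i l u v by (auto simp: dl_def)
    define t where "t = A 0 0"
    \<comment> \<open>\<phi> and \<psi> are the coefficients of the third generator and of minus the
      second, both at y = 1: the Koszul solution of the recursion, with value 1 at (0, 0).\<close>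
    define \<phi> where "\<phi> = (\<lambda>i l. dl 0 0 i l - E * dl 1 1 i l + dl (int d - 2) 2 i l)"
    define \<psi> where "\<psi> = (\<lambda>i l. D * dl 1 (int d - 2) i l - dl 0 1 i l)"
    define A' where "A' = (\<lambda>i l. A i l - t * \<phi> i l)"
    define B' where "B' = (\<lambda>i l. B i l - t * \<psi> i l)"
    have koszul: "\<phi> i (l - 1) - D * \<phi> (i - 1) (l - (int d - 2)) + \<psi> i l - E * \<psi> (i - 1) (l - 1)
        + \<psi> (i - (int d - 2)) (l - 2) = 0" for i l
      using shift[of _ _ i 0 l 1] shift[of _ _ i 1 l "int d - 2"] shift[of _ _ i 1 l 1]
        shift[of _ _ i "int d - 2" l 2]
      unfolding \<phi>_def \<psi>_def by (simp add: algebra_simps)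
    have lin: "A' i (l - 1) - D * A' (i - 1) (l - int d + 2) + B' i l
      - E * B' (i - 1) (l - 1) + B' (i - int d + 2) (l - 2) = 0" if "i \<le> int d - 1" for i l
    proof -
      have "A' i (l - 1) - D * A' (i - 1) (l - int d + 2) + B' i l
        - E * B' (i - 1) (l - 1) + B' (i - int d + 2) (l - 2)
        = (A i (l - 1) - D * A (i - 1) (l - int d + 2) + B i l
          - E * B (i - 1) (l - 1) + B (i - int d + 2) (l - 2))
        - t * (\<phi> i (l - 1) - D * \<phi> (i - 1) (l - int d + 2) + \<psi> i l - E * \<psi> (i - 1) (l - 1)
        + \<psi> (i - int d + 2) (l - 2))"
        unfolding A'_def B'_def by (simp only: algebra_simps)
      moreover have "l - int d + 2 = l - (int d - 2)" "i - int d + 2 = i - (int d - 2)" by simp_all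
      ultimately show ?thesis using sys[OF that, of l] koszul[of i l] by (simp only: mult_zero_right diff_zero)
    qed
    have "A' i l = 0 \<and> B' i l = 0" for i l
    proof -
      have D0: "D \<noteq> 0" using d unfolding D_def of_nat_eq_0_iff by simp
      have A'supp: "0 \<le> i \<and> 0 \<le> l \<and> i + l \<le> int d \<and> i \<le> int d - 1" if nz: "A' i l \<noteq> 0" for i l
      proof (cases "A i l = 0")
        case True
        then have "\<phi> i l \<noteq> 0" using nz by (auto simp: A'_def)
        then show ?thesis using d5 by (auto simp: \<phi>_def dl_def split: if_splits)
      qed (use supp[where i = i and l = l] in auto)
      have B'supp: "0 \<le> i \<and> 0 \<le> l \<and> i + l \<le> int d - 1" if nz: "B' i l \<noteq> 0" for i l
      proof (cases "B i l = 0")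
        case True
        then have "\<psi> i l \<noteq> 0" using nz by (auto simp: B'_def)
        then show ?thesis using d5 by (auto simp: \<psi>_def dl_def split: if_splits)
      qed (use supp[where i = i and l = l] in auto)
      have "A' 0 0 = 0" using d5 by (simp add: A'_def t_def \<phi>_def dl_def)
      then show ?thesis
        using syzygy_coefficients_zero[OF d5 D0 A'supp B'supp lin] by blast
    qed
    then have z: "A' i l = 0" "B' i l = 0" for i l by blast+
    \<comment> \<open>Now (A, B) = t (\<phi>, \<psi>). But \<open>A\<close> is supported in degrees
      below d, while \<phi> has the coefficient 1 at x^(d-2) z^2, of degree d.\<close>
    have "A (int d - 2) 2 = 0" using supp[of "int d - 2" 2] by auto
    moreover have "\<phi> (int d - 2) 2 = 1" using d5 by (simp add: \<phi>_def dl_def)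
    ultimately have "t = 0" using z(1)[of "int d - 2" 2] by (simp add: A'_def)
    then show ?thesis using z[where i = i and l = l] by (simp add: A'_def B'_def)
  qed
  then have "a2 = 0" "a3 = 0" using a by (auto intro: cfi_eq_0_imp simp: A_def B_def)
  moreover from this have "a1 * gen1 d = 0" using eq by simp
  moreover have "gen1 d \<noteq> (0 :: 'k poly3)"
  proof
    assume "gen1 d = (0 :: 'k poly3)"
    then have "cf (gen1 d :: 'k poly3) d 0 0 = 0" by simp
    then show False by (simp add: gen1_def cf_mon)
  qed
  ultimately show ?thesis by simp
qed

lemma mem_syz_iff: "(a1, a2, a3) \<in> syz (J_gens d) \<longleftrightarrow> a1 * gen1 d + a2 * gen2 d + a3 * gen3 d = 0"
  by (simp add: syz_def J_gens_eq)

lemma gens_nonzero: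
  assumes "d \<ge> 4"
  shows "gen1 d \<noteq> (0 :: ('k::field) poly3)" "gen2 d \<noteq> (0 :: 'k poly3)"
proof -
  have "cf (gen1 d :: 'k poly3) d 0 0 = 1" by (simp add: gen1_def cf_mon)
  then show "gen1 d \<noteq> (0 :: 'k poly3)" by (metis coeff_0 zero_neq_one)
  have "cf (gen2 d :: 'k poly3) 0 (d - 1) 1 = 1" using assms by (simp add: gen2_def cf_mon)
  then show "gen2 d \<noteq> (0 :: 'k poly3)" by (metis coeff_0 zero_neq_one)
qed

lemma small_syzygy_zero:
  assumes "d \<ge> 4" "s \<in> syz (J_gens d)" "s \<in> forms3 n" "n < int d"
  shows "s = (0 :: ('k::field_char_0) vec3)"
proof -
  obtain a1 a2 a3 where s: "s = (a1, a2, a3)" by (cases s)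
  show ?thesis
  proof (cases "n < 0")
    case True
    then show ?thesis using assms(3) s by (auto simp: forms3_def forms_neg zero_prod_def)
  next
    case False
    then have "forms n = (forms (int (nat n)) :: 'k poly3 set)" "nat n < d" using assms(4) by auto
    then show ?thesis using no_small_syzygies[OF assms(1), of "nat n" a2 a3 a1] assms(2,3) s
      by (auto simp: forms3_def mem_syz_iff zero_prod_def)
  qed
qed

definition koszul :: "nat \<Rightarrow> ('k::field) vec3" where "koszul d = (- gen2 d, gen1 d, 0)"

lemma koszul_syz:
  assumes "d \<ge> 4"
  shows "koszul d \<in> syz (J_gens d)" "koszul d \<in> forms3 (int d)" "koszul d \<noteq> (0 :: ('k::field) vec3)"
  using gen_forms[OF assms] gens_nonzero[OF assms]
  by (auto simp: koszul_def mem_syz_iff forms3_def zero_prod_def mult.commute intro: forms_closed)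

lemma indeg_syz:
  assumes "d \<ge> 4"
  shows "indeg (syz (J_gens d :: ('k::field_char_0) vec3)) = d"
  unfolding indeg_def
proof (rule Least_equality)
  show "\<exists>s\<in>syz (J_gens d) \<inter> forms3 (int d). s \<noteq> (0 :: 'k vec3)"
    using koszul_syz[OF assms] by blast
  fix n assume "\<exists>s\<in>syz (J_gens d) \<inter> forms3 (int n). s \<noteq> (0 :: 'k vec3)"
  then show "d \<le> n" using small_syzygy_zero[OF assms] by (metis IntD1 IntD2 not_le of_nat_less_iff)
qed

section \<open>\<open>R/J\<^sub>d\<close> is not Cohen--Macaulay\<close>

lemma ideal_J_form_small:
  assumes "d \<ge> 4" "p \<in> ideal_J d" "p \<in> forms n" "n < int d"
  shows "p = (0 :: ('k::field) poly3)"
  by (rule ideal_J_form_cases[OF assms(1-3)]) (use assms(4) in \<open>simp add: forms_neg\<close>)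

text \<open>\<open>J\<^sub>d\<close> is not saturated: some monomial multiple of \<open>x\<^bsup>d-1\<^esup>\<close> is a socle element of \<open>R/J\<^sub>d\<close>.\<close>

lemma socle_element:
  assumes d: "d \<ge> 4"
  shows "\<exists>s. s \<notin> (ideal_J d :: ('k::field_char_0) poly3 set) \<and>
    (\<forall>p. cf p 0 0 0 = 0 \<longrightarrow> p * s \<in> (ideal_J d :: 'k poly3 set))"
proof -
  let ?J = "ideal_J d :: 'k poly3 set"
  obtain e where e: "d = e + 4" using d by (metis add.commute le_iff_add)
  obtain A where A: "\<And>l. l \<ge> A \<Longrightarrow> mon (d - 1) 0 l \<in> ?J"
    by (rule large_z_relations[OF d]) (rule that)
  have nil: "mon 0 (d * d) 0 \<in> ?J" using nilpotent_y[OF e] by (simp add: mon_conv_var)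
  have x: "mon d 0 0 \<in> ?J" using gen_mem_ideal_J(1)[of d] by (simp add: gen1_def)
  define S where "S = {(i, j, l). mon i j l * mon (d - 1) 0 0 \<notin> ?J}"
  \<comment> \<open>One more x gives x^d; the powers y^(d * d) and, next to x^(d-1), z^A are in J_d
    as well.\<close>
  have bound: "i = 0 \<and> j \<le> d * d \<and> l \<le> A" if S: "(i, j, l) \<in> S" for i j l
  proof (intro conjI)
    have nm: "mon (i + (d - 1)) j l \<notin> ?J" using S by (simp add: S_def mon_mult)
    show "i = 0"
      using nm mon_mem_mono[OF x, of "i + (d - 1)" j l] d by (cases i) auto
    show "j \<le> d * d"
      using nm mon_mem_mono[OF nil, of "i + (d - 1)" j l] by (cases "d * d \<le> j") auto
    show "l \<le> A"
      using nm mon_mem_mono[OF A[of A], of "i + (d - 1)" j l] by (cases "A \<le> l") auto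
  qed
  have "S \<subseteq> {..0} \<times> {..d * d} \<times> {..A}"
    using bound by auto
  then have fin: "finite S" by (rule finite_subset) simp
  have "(0, 0, 0) \<in> S"
  proof -
    have "cf (mon (d - 1) 0 0 :: 'k poly3) (d - 1) 0 0 = 1" by (simp add: cf_mon)
    then have "mon (d - 1) 0 0 \<noteq> (0 :: 'k poly3)" by auto
    then have "mon (d - 1) 0 0 \<notin> ?J"
      using ideal_J_form_small[OF d _ mon_forms[of "d - 1" 0 0]] d by fastforce
    then show ?thesis by (simp add: S_def mon_mult)
  qed
  \<comment> \<open>A monomial of maximal degree in \<open>S\<close>: any proper multiple leaves
    \<open>S\<close>, that is, enters J_d after multiplication by x^(d-1).\<close>
  define m where "m = Max ((\<lambda>(i, j, l). i + j + l) ` S)"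
  have "m \<in> (\<lambda>(i, j, l). i + j + l) ` S"
    unfolding m_def using fin \<open>(0, 0, 0) \<in> S\<close> by (intro Max_in) auto
  then obtain i j l where ijl: "(i, j, l) \<in> S" "m = i + j + l" by auto
  have max: "i' + j' + l' \<le> m" if "(i', j', l') \<in> S" for i' j' l'
  proof -
    have "(\<lambda>(i, j, l). i + j + l) (i', j', l') \<le> Max ((\<lambda>(i, j, l). i + j + l) ` S)"
      using fin that by (intro Max_ge finite_imageI imageI)
    then show ?thesis by (simp add: m_def)
  qed
  define s where "s = mon i j l * (mon (d - 1) 0 0 :: 'k poly3)"
  have "s \<notin> ?J" using ijl by (simp add: s_def S_def)
  moreover have "p * s \<in> ?J" if p: "cf p 0 0 0 = 0" for p
  proof -
    have id: "ideal {q. q * s \<in> ?J} R3"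
      unfolding type_ideal_iff by (simp add: distrib_right mult.assoc ideal_J_closed)
    have "mon a b c \<in> {q. q * s \<in> ?J}" if nz: "cf p a b c \<noteq> 0" for a b c
    proof (rule ccontr)
      assume "mon a b c \<notin> {q. q * s \<in> ?J}"
      then have "(a + i, b + j, c + l) \<in> S"
        by (simp add: S_def s_def mult.assoc[symmetric] mon_mult add.assoc)
      then have "a + i + (b + j) + (c + l) \<le> m" by (rule max)
      then have "a = 0 \<and> b = 0 \<and> c = 0" using ijl by simp
      then show False using nz p by simp
    qed
    then show ?thesis using mem_ideal_of_monomials[OF id] by blast
  qed
  ultimately show ?thesis by blast
qed

definition irrelevant :: "('k::field) poly3 set" where "irrelevant = {p. cf p 0 0 0 = 0}"

lemma cf_mult_000: "cf (p * q) 0 0 0 = cf p 0 0 0 * cf q 0 0 0"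
  by (simp add: coeff_mult_0)

lemma ideal_irrelevant: "ideal irrelevant R3"
  unfolding type_ideal_iff by (simp add: irrelevant_def cf_mult_000)

text \<open>The maximal ideal (x,y,z) of R/J_d has height at least one, because (x,y) is a smaller
  prime over J_d, but depth zero, because it annihilates the socle element.\<close>

lemma not_cohen_macaulay_R3_Quot_ideal_J:
  assumes d: "d \<ge> 4"
  shows "\<not> cohen_macaulay (R3 Quot (ideal_J d :: ('k::field_char_0) poly3 set))"
proof -
  let ?J = "ideal_J d :: 'k poly3 set"
  let ?Q = "R3 Quot ?J"
  interpret R: cring "R3 :: 'k poly3 ring" by (rule cring_from_type_algebra)
  interpret J: ideal ?J R3 by (rule ideal_ideal_J)
  interpret Q: cring ?Q by (rule J.quotient_is_cring) (rule R.cring_axioms)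
  define \<pi> where "\<pi> = (\<lambda>a. ?J +>\<^bsub>R3\<^esub> a)"
  have hom: "\<pi> \<in> ring_hom R3 ?Q" unfolding \<pi>_def by (rule J.rcos_ring_hom)
  have \<pi>_eq: "\<pi> a = {h + a | h. h \<in> ?J}" for a by (auto simp: \<pi>_def a_r_coset_def r_coset_def)
  have \<pi>_mult: "\<pi> a \<otimes>\<^bsub>?Q\<^esub> \<pi> b = \<pi> (a * b)" and \<pi>_add: "\<pi> a \<oplus>\<^bsub>?Q\<^esub> \<pi> b = \<pi> (a + b)" for a b
    using ring_hom_mult[OF hom, of a b] ring_hom_add[OF hom, of a b] by simp_all
  have \<pi>_one: "\<one>\<^bsub>?Q\<^esub> = \<pi> 1" using ring_hom_one[OF hom] by simp
  have zero_Q: "\<zero>\<^bsub>?Q\<^esub> = ?J" by (simp add: FactRing_def)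
  have carrier_Q: "carrier ?Q = range \<pi>" by (auto simp: FactRing_def A_RCOSETS_defs \<pi>_def a_r_coset_def)
  have \<pi>_eqD: "a - b \<in> ?J" if ab: "\<pi> a = \<pi> b" for a b
  proof -
    have "0 + a \<in> \<pi> a" unfolding \<pi>_eq using ideal_J_closed(1) by blast
    then obtain h where "0 + a = h + b" "h \<in> ?J" unfolding ab unfolding \<pi>_eq by blast
    then show ?thesis by simp
  qed
  have \<pi>_zero: "\<pi> a = ?J" if "a \<in> ?J" for a
  proof -
    have "h = (h - a) + a \<and> h - a \<in> ?J" if "h \<in> ?J" for h
      using that \<open>a \<in> ?J\<close> ideal_J_closed(6) by simp
    then show ?thesis unfolding \<pi>_eq using that ideal_J_closed(2) by blast
  qed
  have img_mem: "\<pi> a \<in> \<pi> ` P \<longleftrightarrow> a \<in> P" if P: "ideal P R3" "?J \<subseteq> P" for a P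
  proof
    assume "\<pi> a \<in> \<pi> ` P"
    then obtain p where p: "p \<in> P" "\<pi> a = \<pi> p" by blast
    then have "a - p \<in> P" using \<pi>_eqD P(2) by blast
    then have "a - p + p \<in> P" using p(1) by (rule type_idealD(2)[OF P(1)])
    then show "a \<in> P" by simp
  qed simp
  have img_ideal: "ideal (\<pi> ` P) ?Q" if "ideal P R3" for P
    unfolding \<pi>_def by (rule R.ring_ideal_imp_quot_ideal[OF ideal_ideal_J that])
  have prime_xy': "primeideal (\<pi> ` prime_xy) ?Q"
  proof (rule primeidealI)
    have xy: "primeideal (prime_xy :: 'k poly3 set) R3" by (rule primeideal_prime_xy)
    note mem = img_mem[OF type_primeidealD(1)[OF xy] ideal_J_subset_prime_xy[OF d]]
    show "ideal (\<pi> ` prime_xy) ?Q" by (rule img_ideal[OF type_primeidealD(1)[OF xy]])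
    have "\<pi> 1 \<notin> \<pi> ` prime_xy" using mem type_primeidealD(2)[OF xy] by simp
    then show "carrier ?Q \<noteq> \<pi> ` prime_xy" unfolding carrier_Q by blast
    fix U V assume "U \<in> carrier ?Q" "V \<in> carrier ?Q" "U \<otimes>\<^bsub>?Q\<^esub> V \<in> \<pi> ` prime_xy"
    then obtain a b where "U = \<pi> a" "V = \<pi> b" "\<pi> (a * b) \<in> \<pi> ` prime_xy"
      unfolding carrier_Q using \<pi>_mult by auto
    then show "U \<in> \<pi> ` prime_xy \<or> V \<in> \<pi> ` prime_xy"
      using mem type_primeidealD(3)[OF xy] by simp
  qed (rule Q.cring_axioms)
  define M where "M = \<pi> ` irrelevant"
  have J_irr: "?J \<subseteq> irrelevant"
  proof -
    have "?J \<subseteq> prime_xy" by (rule ideal_J_subset_prime_xy[OF d])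
    then show ?thesis by (auto simp: prime_xy_def irrelevant_def)
  qed
  note memM = img_mem[OF ideal_irrelevant J_irr, folded M_def]
  have M: "maximalideal M ?Q"
  proof (rule maximalidealI)
    show "ideal M ?Q" unfolding M_def by (rule img_ideal[OF ideal_irrelevant])
    have "\<pi> 1 \<notin> M" by (simp add: memM) (simp add: irrelevant_def)
    then show "carrier ?Q \<noteq> M" unfolding carrier_Q by blast
    fix K assume K: "ideal K ?Q" "M \<subseteq> K" "K \<subseteq> carrier ?Q"
    interpret K: ideal K ?Q by (rule K(1))
    show "K = M \<or> K = carrier ?Q"
    proof (rule disjCI)
      assume "K \<noteq> carrier ?Q"
      show "K = M"
      proof (rule ccontr)
        assume "K \<noteq> M"
        then obtain a where a: "\<pi> a \<in> K" "\<pi> a \<notin> M" using K(2,3) unfolding carrier_Q by blast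
        define c where "c = cf a 0 0 0"
        have "c \<noteq> 0" using a(2) by (simp add: memM irrelevant_def c_def)
        \<comment> \<open>The element 1 - a/c has no constant term, so it lies over
          \<open>M\<close>; together with \<open>a\<close> it puts 1 into \<open>K\<close>.\<close>
        define b where "b = 1 - [:[:[:inverse c:]:]:] * a"
        have "cf b 0 0 0 = 0" using \<open>c \<noteq> 0\<close> by (simp add: b_def c_def)
        then have "b \<in> irrelevant" by (simp add: irrelevant_def)
        then have "\<pi> b \<in> K" using K(2) unfolding M_def by blast
        moreover have "\<pi> [:[:[:inverse c:]:]:] \<otimes>\<^bsub>?Q\<^esub> \<pi> a \<in> K"
          using a(1) by (intro K.I_l_closed) (auto simp: carrier_Q)
        ultimately have "\<pi> b \<oplus>\<^bsub>?Q\<^esub> (\<pi> [:[:[:inverse c:]:]:] \<otimes>\<^bsub>?Q\<^esub> \<pi> a) \<in> K"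
          by (rule additive_subgroup.a_closed[OF K.is_additive_subgroup])
        then have "\<one>\<^bsub>?Q\<^esub> \<in> K" unfolding \<pi>_mult \<pi>_add \<pi>_one b_def by (simp only: diff_add_cancel)
        then show False using K.one_imp_carrier \<open>K \<noteq> carrier ?Q\<close> by blast
      qed
    qed
  qed
  have "prime_xy \<subset> (irrelevant :: 'k poly3 set)"
  proof -
    have "var_z \<in> (irrelevant :: 'k poly3 set)" "var_z \<notin> (prime_xy :: 'k poly3 set)"
      by (auto simp: irrelevant_def prime_xy_def var_z_def coeff_pCons intro!: exI[of _ 1])
    then show ?thesis by (auto simp: irrelevant_def prime_xy_def)
  qed
  then obtain a where a: "a \<in> irrelevant" "a \<notin> (prime_xy :: 'k poly3 set)" by blast
  have "\<pi> a \<notin> \<pi> ` prime_xy" "\<pi> a \<in> M" "\<pi> ` prime_xy \<subseteq> M"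
    using a img_mem[OF type_primeidealD(1)[OF primeideal_prime_xy] ideal_J_subset_prime_xy[OF d]]
      \<open>prime_xy \<subset> irrelevant\<close> by (auto simp: M_def)
  then have strict: "\<pi> ` prime_xy \<subset> M" by blast
  have "1 \<le> ideal_height ?Q M"
    unfolding ideal_height_def
  proof (rule Inf_greatest, clarify)
    fix P assume P: "primeideal P ?Q" "M \<subseteq> P"
    have "enat 1 \<le> prime_height ?Q P"
      by (rule prime_height_ge[of _ "\<lambda>i. if i = 0 then \<pi> ` prime_xy else P"])
        (use P prime_xy' strict in auto)
    then show "1 \<le> prime_height ?Q P" by (simp add: one_enat_def)
  qed
  moreover have "ideal_depth ?Q M = 0"
  proof -
    obtain s where s: "s \<notin> ?J" "\<And>p. cf p 0 0 0 = 0 \<Longrightarrow> p * s \<in> ?J"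
      using socle_element[OF d, where ?'k = 'k] by blast
    have gen_empty: "genideal ?Q {} = {?J}"
    proof
      show "genideal ?Q {} \<subseteq> {?J}"
        using Q.genideal_minimal[OF Q.zeroideal, of "{}"] by (simp add: zero_Q)
      show "{?J} \<subseteq> genideal ?Q {}"
        using additive_subgroup.zero_closed[OF ideal.axioms(1)[OF Q.genideal_ideal[of "{}"]]]
        by (simp add: zero_Q)
    qed
    \<comment> \<open>A first entry of a regular sequence in \<open>M\<close> would annihilate the
      class of the socle element, which is nonzero.\<close>
    have "xs = []" if reg: "regular_seq ?Q xs" "set xs \<subseteq> M" for xs
    proof (cases xs)
      case (Cons U ys)
      then obtain p where p: "U = \<pi> p" "p \<in> irrelevant" using reg(2) by (auto simp: M_def)
      then have "U \<otimes>\<^bsub>?Q\<^esub> \<pi> s = ?J" using s(2)[of p] by (simp add: \<pi>_mult \<pi>_zero irrelevant_def)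
      moreover have "\<forall>a\<in>carrier ?Q. xs ! 0 \<otimes>\<^bsub>?Q\<^esub> a \<in> genideal ?Q (set (take 0 xs))
          \<longrightarrow> a \<in> genideal ?Q (set (take 0 xs))"
        using reg(1) Cons unfolding regular_seq_def by (metis length_greater_0_conv list.distinct(1))
      ultimately have "\<pi> s = ?J" using Cons by (auto simp: gen_empty carrier_Q)
      then have "\<pi> s = \<pi> 0" using \<pi>_zero[OF ideal_J_closed(1)] by simp
      then have "s \<in> ?J" using \<pi>_eqD[of s 0] by simp
      then show ?thesis using s(1) by simp
    qed
    then have "{enat (length xs) | xs. regular_seq ?Q xs \<and> set xs \<subseteq> M} \<subseteq> {0}"
      by (auto simp: zero_enat_def)
    then have "ideal_depth ?Q M \<le> Sup {0}" unfolding ideal_depth_def by (rule Sup_subset_mono)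
    then show ?thesis by simp
  qed
  ultimately have "ideal_depth ?Q M \<noteq> ideal_height ?Q M" by auto
  then show ?thesis unfolding cohen_macaulay_def using M by blast
qed

section \<open>Homogeneous components of syzygies\<close>

definition hc3 :: "int \<Rightarrow> ('k::field) vec3 \<Rightarrow> 'k vec3" where
  "hc3 n = (\<lambda>(a, b, c). (hc n a, hc n b, hc n c))"

lemma hc3_forms3 [simp]: "hc3 n v \<in> forms3 n"
  by (simp add: hc3_def forms3_def split: prod.splits)

lemma hc3_add: "hc3 n (u + v) = hc3 n u + hc3 n v"
  by (simp add: hc3_def hc_add split: prod.splits)

lemma hc3_zero [simp]: "hc3 n 0 = 0"
  by (simp add: hc3_def zero_prod_def)

lemma hc3_of_form: "v \<in> forms3 m \<Longrightarrow> hc3 n v = (if n = m then v else 0)"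
  by (auto simp: hc3_def forms3_def hc_of_form zero_prod_def split: prod.splits)

lemma hc3_form_scale3: "q \<in> forms m \<Longrightarrow> hc3 (n + m) (scale3 q v) = scale3 q (hc3 n v)"
  by (auto simp: hc3_def scale3_def hc_form_mult split: prod.splits)

lemma sum_hc3: "\<exists>N. \<forall>M\<ge>N. v = (\<Sum>n\<le>M. hc3 (int n) v)"
proof -
  obtain a b c where v: "v = (a, b, c)" by (cases v)
  obtain N1 where N1: "\<forall>M\<ge>N1. a = (\<Sum>n\<le>M. hc (int n) a)" using sum_hc[of a] by blast
  obtain N2 where N2: "\<forall>M\<ge>N2. b = (\<Sum>n\<le>M. hc (int n) b)" using sum_hc[of b] by blast
  obtain N3 where N3: "\<forall>M\<ge>N3. c = (\<Sum>n\<le>M. hc (int n) c)" using sum_hc[of c] by blast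
  have sum: "(\<Sum>n\<le>M. hc3 (int n) v) = (\<Sum>n\<le>M. hc (int n) a, \<Sum>n\<le>M. hc (int n) b, \<Sum>n\<le>M. hc (int n) c)" for M
    by (induction M) (simp_all add: v hc3_def)
  have "v = (\<Sum>n\<le>M. hc3 (int n) v)" if "N1 + N2 + N3 \<le> M" for M
  proof -
    have "(\<Sum>n\<le>M. hc (int n) a) = a" "(\<Sum>n\<le>M. hc (int n) b) = b" "(\<Sum>n\<le>M. hc (int n) c) = c"
      using N1[rule_format, of M] N2[rule_format, of M] N3[rule_format, of M] that by simp_all
    then show ?thesis unfolding sum by (simp only: v)
  qed
  then show ?thesis by blast
qed

lemma forms3_closed:
  "0 \<in> forms3 n" "u \<in> forms3 n \<Longrightarrow> v \<in> forms3 n \<Longrightarrow> u + v \<in> forms3 n"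
  using forms3_subspace[of n] unfolding k3.subspace_def by blast+

lemma scale3_forms3: "r \<in> forms m \<Longrightarrow> v \<in> forms3 n \<Longrightarrow> scale3 r v \<in> forms3 (m + n)"
  by (auto simp: scale3_def forms3_def forms_mult)

lemma forms3_neg: "n < 0 \<Longrightarrow> forms3 n = {0}"
  by (auto simp: forms3_def forms_neg zero_prod_def)

definition graded_submodule :: "('k::field) vec3 set \<Rightarrow> bool" where
  "graded_submodule M \<longleftrightarrow> fm.subspace M \<and> (\<forall>v\<in>M. \<forall>n. hc3 n v \<in> M)"

lemma graded_submoduleD:
  assumes "graded_submodule M"
  shows "0 \<in> M" "u \<in> M \<Longrightarrow> v \<in> M \<Longrightarrow> u + v \<in> M" "u \<in> M \<Longrightarrow> scale3 r u \<in> M" "v \<in> M \<Longrightarrow> hc3 n v \<in> M"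
  using assms unfolding graded_submodule_def fm.subspace_def by blast+

lemma graded_submodule_k3_subspace:
  assumes "graded_submodule M"
  shows "k3.subspace (M \<inter> forms3 n)"
proof -
  have "k3.subspace M"
    unfolding k3.subspace_def kscale3_conv_scale3 using graded_submoduleD[OF assms] by blast
  then show ?thesis using forms3_subspace k3.subspace_inter by blast
qed

lemma graded_submodule_syz:
  assumes d: "d \<ge> 4"
  shows "graded_submodule (syz (J_gens d) :: ('k::field) vec3 set)"
  unfolding graded_submodule_def fm.subspace_def
proof (intro conjI ballI allI)
  show "(0 :: 'k vec3) \<in> syz (J_gens d)" by (simp add: zero_prod_def mem_syz_iff)
next
  fix u v :: "'k vec3" assume uv: "u \<in> syz (J_gens d)" "v \<in> syz (J_gens d)"
  obtain a b c a' b' c' where "u = (a, b, c)" "v = (a', b', c')" by (cases u, cases v)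
  moreover have "(a + a') * g + (b + b') * h + (c + c') * k = (a * g + b * h + c * k) + (a' * g + b' * h + c' * k)"
    for g h k by (simp add: algebra_simps)
  ultimately show "u + v \<in> syz (J_gens d)" using uv by (simp add: mem_syz_iff)
next
  fix u :: "'k vec3" and r assume u: "u \<in> syz (J_gens d)"
  obtain a b c where "u = (a, b, c)" by (cases u)
  moreover have "r * a * g + r * b * h + r * c * k = r * (a * g + b * h + c * k)"
    for g h k by (simp add: algebra_simps)
  ultimately show "scale3 r u \<in> syz (J_gens d)" using u by (simp add: mem_syz_iff scale3_def)
next
  fix u :: "'k vec3" and n assume u: "u \<in> syz (J_gens d)"
  obtain a b c where abc: "u = (a, b, c)" by (cases u)
  have "0 = hc (n + int d) (a * gen1 d + b * gen2 d + c * gen3 d)"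
    using u abc by (simp add: mem_syz_iff)
  also have "\<dots> = hc n a * gen1 d + hc n b * gen2 d + hc n c * gen3 d"
    by (simp add: hc_add hc_mult_form[OF gen_forms(1)[OF d]] hc_mult_form[OF gen_forms(2)[OF d]]
        hc_mult_form[OF gen_forms(3)[OF d]])
  finally show "hc3 n u \<in> syz (J_gens d)" by (simp add: abc hc3_def mem_syz_iff)
qed

section \<open>Minimal homogeneous generators\<close>

lemma cf_000_eq_0_decompose:
  assumes "cf r 0 0 0 = 0"
  shows "\<exists>u v w. r = var_x * u + var_y * v + var_z * w"
proof -
  define q where "q = r - var_x * shift_x r"
  define q' where "q' = q - var_y * shift_y q"
  have cfq: "cf q i j l = (if i = 0 then cf r 0 j l else 0)" for i j l
    by (simp add: q_def cf_var_x cf_shift split: nat.split)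
  have cfq': "cf q' i j l = (if i = 0 \<and> j = 0 then cf r 0 0 l else 0)" for i j l
    by (simp add: q'_def cf_var_y cf_shift cfq split: nat.split)
  have "q' = var_z * shift_z q'"
    by (intro poly3_eqI) (auto simp: cf_var_z cf_shift cfq' assms split: nat.split)
  then have "r = var_x * shift_x r + var_y * shift_y q + var_z * shift_z q'"
    by (simp add: q_def q'_def)
  then show ?thesis by blast
qed

lemma k3_span_subset_fm_span: "k3.span S \<subseteq> fm.span S"
proof (rule k3.span_minimal)
  show "S \<subseteq> fm.span S" by (rule fm.span_superset)
  show "k3.subspace (fm.span S)"
    unfolding k3.subspace_def kscale3_conv_scale3
    using fm.span_zero fm.span_add fm.span_scale by blast
qed

text \<open>The degree n part of (x,y,z) M; minimal generators of degree n form a basis of a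
  complement of it in the degree n part of M.\<close>

definition irr_part :: "('k::field) vec3 set \<Rightarrow> int \<Rightarrow> 'k vec3 set" where
  "irr_part M n = {scale3 var_x a + scale3 var_y b + scale3 var_z c | a b c.
     a \<in> M \<inter> forms3 (n - 1) \<and> b \<in> M \<inter> forms3 (n - 1) \<and> c \<in> M \<inter> forms3 (n - 1)}"

lemma irr_part_subset:
  assumes "graded_submodule M"
  shows "irr_part M n \<subseteq> M \<inter> forms3 n"
proof
  fix v assume "v \<in> irr_part M n"
  then obtain a b c where v: "v = scale3 var_x a + scale3 var_y b + scale3 var_z c"
    "a \<in> M \<inter> forms3 (n - 1)" "b \<in> M \<inter> forms3 (n - 1)" "c \<in> M \<inter> forms3 (n - 1)"
    unfolding irr_part_def by blast
  then have "v \<in> M" using graded_submoduleD[OF assms] by auto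
  moreover have "scale3 var_x a \<in> forms3 (1 + (n - 1))" "scale3 var_y b \<in> forms3 (1 + (n - 1))"
    "scale3 var_z c \<in> forms3 (1 + (n - 1))"
    by (rule scale3_forms3, rule var_forms, use v in blast)+
  then have "scale3 var_x a \<in> forms3 n" "scale3 var_y b \<in> forms3 n" "scale3 var_z c \<in> forms3 n"
    by simp_all
  then have "v \<in> forms3 n" unfolding v(1) by (intro forms3_closed(2))
  ultimately show "v \<in> M \<inter> forms3 n" by simp
qed

lemma irr_part_trivial:
  assumes "M \<inter> forms3 (n - 1) = {0}"
  shows "irr_part M n \<subseteq> {0}"
proof
  fix v assume "v \<in> irr_part M n"
  then obtain a b c where "v = scale3 var_x a + scale3 var_y b + scale3 var_z c" "a = 0" "b = 0" "c = 0"
    using assms unfolding irr_part_def by blast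
  then show "v \<in> {0}" by simp
qed

lemma irr_part_hc3:
  fixes M :: "('k::field) vec3 set"
  assumes M: "graded_submodule M" and v: "v \<in> M" and r: "cf r 0 0 0 = 0"
  shows "hc3 n (scale3 r v) \<in> irr_part M n"
proof -
  obtain p q w where "r = var_x * p + var_y * q + var_z * w" using cf_000_eq_0_decompose[OF r] by blast
  then have "scale3 r v = scale3 var_x (scale3 p v) + scale3 var_y (scale3 q v) + scale3 var_z (scale3 w v)"
    by (simp add: fm.scale_left_distrib)
  moreover have "hc3 n (scale3 var_x t) = scale3 var_x (hc3 (n - 1) t)"
    "hc3 n (scale3 var_y t) = scale3 var_y (hc3 (n - 1) t)"
    "hc3 n (scale3 var_z t) = scale3 var_z (hc3 (n - 1) t)" for t :: "'k vec3"
    using hc3_form_scale3[OF var_forms(1), of "n - 1" t] hc3_form_scale3[OF var_forms(2), of "n - 1" t]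
      hc3_form_scale3[OF var_forms(3), of "n - 1" t] by simp_all
  ultimately have "hc3 n (scale3 r v) = scale3 var_x (hc3 (n - 1) (scale3 p v))
      + scale3 var_y (hc3 (n - 1) (scale3 q v)) + scale3 var_z (hc3 (n - 1) (scale3 w v))"
    by (simp only: hc3_add)
  moreover have "hc3 (n - 1) (scale3 t v) \<in> M \<inter> forms3 (n - 1)" for t
    using graded_submoduleD(3,4)[OF M] v by simp
  ultimately show ?thesis unfolding irr_part_def by blast
qed

text \<open>Graded Nakayama: in each degree a basis \<open>B\<close> of \<open>irr_part\<close> is
  extended by \<open>C\<close> to a basis of the graded piece, and the union of all \<open>C\<close>
  is a minimal generating set. In the least degree \<open>irr_part\<close> is zero, so \<nu> may be
  put into \<open>C\<close>.\<close>

lemma minimal_generator_of_least_degree: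
  fixes M :: "('k::field) vec3 set"
  assumes M: "graded_submodule M" and low: "\<And>n. n < e \<Longrightarrow> M \<inter> forms3 n = {0}"
    and \<nu>: "\<nu> \<in> M" "\<nu> \<in> forms3 e" "\<nu> \<noteq> 0"
  shows "minimal_generator M \<nu>"
proof -
  define good where "good = (\<lambda>n B C. B \<subseteq> irr_part M n \<and> irr_part M n \<subseteq> k3.span B \<and> C \<subseteq> M \<inter> forms3 n
    \<and> k3.independent (B \<union> C) \<and> B \<inter> C = {} \<and> M \<inter> forms3 n \<subseteq> k3.span (B \<union> C) \<and> (n = e \<longrightarrow> \<nu> \<in> C))"
  have "\<exists>B C. good n B C" for n
  proof (cases "n = e")
    case False
    obtain B where B: "B \<subseteq> irr_part M n" "k3.independent B" "irr_part M n \<subseteq> k3.span B"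
      "card B = k3.dim (irr_part M n)"
      using k3.basis_exists .
    have "B \<subseteq> M \<inter> forms3 n" using B(1) irr_part_subset[OF M, of n] by (rule order_trans)
    then obtain B' where B': "B \<subseteq> B'" "B' \<subseteq> M \<inter> forms3 n" "k3.independent B'" "M \<inter> forms3 n \<subseteq> k3.span B'"
      using B(2) by (rule k3.maximal_independent_subset_extend)
    have "B \<union> (B' - B) = B'" using B'(1) by blast
    then have "good n B (B' - B)" unfolding good_def using False
      by (intro conjI impI B) (use B' in auto)
    then show ?thesis by blast
  next
    case True
    have "M \<inter> forms3 (e - 1) = {0}" by (rule low) simp
    then have W: "irr_part M n \<subseteq> {0}" unfolding True by (rule irr_part_trivial)
    have "{\<nu>} \<subseteq> M \<inter> forms3 n" "k3.independent {\<nu>}" using \<nu> True by auto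
    then obtain B' where B': "{\<nu>} \<subseteq> B'" "B' \<subseteq> M \<inter> forms3 n" "k3.independent B'" "M \<inter> forms3 n \<subseteq> k3.span B'"
      by (rule k3.maximal_independent_subset_extend)
    then have "good n {} B'" using W unfolding good_def by simp
    then show ?thesis by blast
  qed
  then obtain B C where BC: "\<And>n. good n (B n) (C n)" by metis
  have good: "B n \<subseteq> irr_part M n" "irr_part M n \<subseteq> k3.span (B n)" "C n \<subseteq> M \<inter> forms3 n"
    "k3.independent (B n \<union> C n)" "B n \<inter> C n = {}" "M \<inter> forms3 n \<subseteq> k3.span (B n \<union> C n)"
    "n = e \<Longrightarrow> \<nu> \<in> C n" for n
    using BC[of n] unfolding good_def by simp_all
  define S where "S = (\<Union>n. C n)"
  have "S \<subseteq> M" using good(3) by (auto simp: S_def)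
  have span_low: "M \<inter> forms3 (int n) \<subseteq> fm.span S" for n
  proof (induction n)
    case (0)
    have "M \<inter> forms3 (-1) = {0}" using graded_submoduleD(1)[OF M] by (simp add: forms3_neg)
    then have "irr_part M 0 \<subseteq> {0}" by (intro irr_part_trivial) simp
    then have "B 0 \<subseteq> {0}" using good(1)[of 0] by blast
    then have "k3.span (B 0 \<union> C 0) \<subseteq> k3.span (insert 0 S)" unfolding S_def by (intro k3.span_mono) auto
    then have "k3.span (B 0 \<union> C 0) \<subseteq> k3.span S" by simp
    then show ?case using good(6)[of 0] k3_span_subset_fm_span[of S] by auto
  next
    case (Suc n)
    have "B (int (Suc n)) \<subseteq> fm.span S"
    proof
      fix v assume "v \<in> B (int (Suc n))"
      then have "v \<in> irr_part M (int (Suc n))" using good(1) by blast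
      then obtain a b c where "v = scale3 var_x a + scale3 var_y b + scale3 var_z c"
        "a \<in> M \<inter> forms3 (int n)" "b \<in> M \<inter> forms3 (int n)" "c \<in> M \<inter> forms3 (int n)"
        unfolding irr_part_def by auto
      then show "v \<in> fm.span S" using Suc.IH by (auto intro!: fm.span_add fm.span_scale)
    qed
    moreover have "C (int (Suc n)) \<subseteq> fm.span S" using fm.span_superset[of S] by (auto simp: S_def)
    ultimately have "fm.span (B (int (Suc n)) \<union> C (int (Suc n))) \<subseteq> fm.span S"
      by (intro fm.span_minimal) auto
    then show ?case using good(6)[of "int (Suc n)"] k3_span_subset_fm_span by blast
  qed
  have span: "fm.span S = M"
  proof
    show "fm.span S \<subseteq> M" using \<open>S \<subseteq> M\<close> M by (intro fm.span_minimal) (auto simp: graded_submodule_def)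
    show "M \<subseteq> fm.span S"
    proof
      fix v assume v: "v \<in> M"
      obtain N where "v = (\<Sum>n\<le>N. hc3 (int n) v)" using sum_hc3[of v] by blast
      moreover have "hc3 (int n) v \<in> fm.span S" for n
        using span_low[of n] graded_submoduleD(4)[OF M v] by auto
      ultimately show "v \<in> fm.span S" using fm.span_sum by metis
    qed
  qed
  have "fm.span T \<noteq> M" if T: "T \<subset> S" for T
  proof
    assume eq: "fm.span T = M"
    obtain s where s: "s \<in> S" "s \<notin> T" using T by blast
    then obtain n where n: "s \<in> C n" unfolding S_def by blast
    \<comment> \<open>\<open>V\<close> is a hyperplane of the degree n part that contains
      \<open>irr_part\<close> but not \<open>s\<close>. A constant scalar preserves it and all other
      multiples fall into \<open>irr_part\<close>, so \<open>U\<close> is a submodule; it contains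
      \<open>T\<close> and misses \<open>s\<close>.\<close>
    define V where "V = k3.span (B n \<union> (C n - {s}))"
    define U where "U = {v \<in> M. hc3 n v \<in> V}"
    have V: "k3.subspace V" by (simp add: V_def)
    have irr_V: "irr_part M n \<subseteq> V"
      using good(2)[of n] k3.span_mono[of "B n" "B n \<union> (C n - {s})"] by (auto simp: V_def)
    have "fm.subspace U"
      unfolding fm.subspace_def
    proof (intro conjI ballI allI)
      show "0 \<in> U" using graded_submoduleD(1)[OF M] k3.subspace_0[OF V] by (simp add: U_def)
      show "u + v \<in> U" if "u \<in> U" "v \<in> U" for u v
        using that graded_submoduleD(2)[OF M] k3.subspace_add[OF V] by (simp add: U_def hc3_add)
      fix r :: "'k poly3" and v assume v: "v \<in> U"
      define c where "c = cf r 0 0 0"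
      define r' where "r' = r - [:[:[:c:]:]:]"
      have "scale3 r v = kscale3 c v + scale3 r' v"
        by (simp add: kscale3_conv_scale3 r'_def fm.scale_left_distrib[symmetric])
      moreover have "hc3 n (kscale3 c v) = kscale3 c (hc3 n v)"
        using hc3_form_scale3[OF const_forms, of n c v] by (simp add: kscale3_conv_scale3)
      moreover have "hc3 n (scale3 r' v) \<in> V"
        using irr_part_hc3[OF M, of v r' n] irr_V v by (auto simp: r'_def c_def U_def)
      ultimately have "hc3 n (scale3 r v) \<in> V"
        using v k3.subspace_add[OF V] k3.subspace_scale[OF V] by (simp add: hc3_add U_def)
      then show "scale3 r v \<in> U" using v graded_submoduleD(3)[OF M] by (simp add: U_def)
    qed
    moreover have "T \<subseteq> U"
    proof
      fix t assume t: "t \<in> T"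
      then obtain m where m: "t \<in> C m" using T unfolding S_def by blast
      have "hc3 n t = (if n = m then t else 0)" using m good(3)[of m] by (intro hc3_of_form) blast
      moreover have "t \<noteq> s" using t s by blast
      then have "n = m \<Longrightarrow> t \<in> V" using m by (auto simp: V_def intro: k3.span_base)
      ultimately have "hc3 n t \<in> V" using k3.subspace_0[OF V] by auto
      then show "t \<in> U" using m good(3)[of m] by (auto simp: U_def)
    qed
    ultimately have "M \<subseteq> U" using eq fm.span_minimal by blast
    then have "hc3 n s \<in> V" using n good(3)[of n] by (auto simp: U_def)
    then have "s \<in> V" using n good(3)[of n] hc3_of_form[of s n n] by auto
    moreover have "B n \<union> (C n - {s}) = B n \<union> C n - {s}" using n good(5)[of n] by blast
    ultimately have "k3.dependent (B n \<union> C n)" using n unfolding V_def k3.dependent_def by auto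
    then show False using good(4) by blast
  qed
  moreover have "\<forall>s\<in>S. \<exists>n. s \<in> forms3 n" using good(3) by (auto simp: S_def)
  moreover have "\<nu> \<in> S" using good(7) by (auto simp: S_def)
  ultimately show ?thesis using span unfolding minimal_generator_def minimal_gen_set_def by blast
qed

lemma minimal_generator_nonzero:
  assumes "minimal_generator M \<nu>"
  shows "\<nu> \<noteq> 0" "\<nu> \<in> M"
proof -
  obtain S where S: "minimal_gen_set M S" "\<nu> \<in> S" using assms by (auto simp: minimal_generator_def)
  then show "\<nu> \<in> M" using fm.span_base[of \<nu> S] by (simp add: minimal_gen_set_def)
  show "\<nu> \<noteq> 0"
  proof
    assume "\<nu> = 0"
    have "S \<subseteq> fm.span (S - {\<nu>})" using fm.span_zero[of "S - {\<nu>}"] fm.span_superset[of "S - {\<nu>}"] \<open>\<nu> = 0\<close> by auto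
    then have "fm.span S \<subseteq> fm.span (S - {\<nu>})" by (intro fm.span_minimal) auto
    moreover have "fm.span (S - {\<nu>}) \<subseteq> fm.span S" by (rule fm.span_mono) blast
    ultimately have "fm.span (S - {\<nu>}) = M" using S(1) by (simp add: minimal_gen_set_def)
    moreover have "S - {\<nu>} \<subset> S" using S(2) by blast
    ultimately show False using S(1) unfolding minimal_gen_set_def by blast
  qed
qed

section \<open>Dimensions of graded pieces of the syzygy module\<close>

text \<open>Rank-nullity speaks of maps linear on the whole space, whereas an isomorphism from the
  Bourbaki quotient is controlled on syzygies only.\<close>

lemma (in vector_space_pair) linear_on_extend:
  assumes V: "vs1.subspace V"
    and add: "\<And>u v. u \<in> V \<Longrightarrow> v \<in> V \<Longrightarrow> f (u + v) = f u + f v"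
    and scale: "\<And>c v. v \<in> V \<Longrightarrow> f (s1 c v) = s2 c (f v)"
  shows "\<exists>g. Vector_Spaces.linear s1 s2 g \<and> (\<forall>v\<in>V. g v = f v)"
proof -
  obtain B where B: "B \<subseteq> V" "vs1.independent B" "V \<subseteq> vs1.span B" "card B = vs1.dim V"
    using vs1.basis_exists .
  obtain g where g: "Vector_Spaces.linear s1 s2 g" "\<forall>v\<in>B. g v = f v"
    using linear_independent_extend[OF B(2)] by blast
  interpret g: Vector_Spaces.linear s1 s2 g by (rule g(1))
  have "f (s1 0 0) = s2 0 (f 0)" using V by (intro scale) (simp add: vs1.subspace_0)
  then have "f 0 = 0" by simp
  then have "vs1.subspace {v \<in> V. g v = f v}"
    using V add scale unfolding vs1.subspace_def by (auto simp: g.add g.scale)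
  then have "vs1.span B \<subseteq> {v \<in> V. g v = f v}" using B(1) g(2) by (intro vs1.span_minimal) auto
  then show ?thesis using B(3) g(1) by blast
qed

text \<open>Rank-nullity for the map sending a triple of forms to its combination of the generators,
  with image the part of J_d in degree m + d, of codimension 2d - 2. The identity is arranged to
  avoid subtraction.\<close>

lemma dim_syz_forms3:
  assumes d: "d \<ge> 4"
  shows "\<exists>N. \<forall>m\<ge>N. 3 * kvs.dim (forms (int m) :: ('k::field_char_0) poly3 set) + (2 * d - 2)
    = k3.dim ((syz (J_gens d) :: 'k vec3 set) \<inter> forms3 (int m)) + kvs.dim (forms (int (m + d)) :: 'k poly3 set)"
proof -
  let ?S = "syz (J_gens d) :: 'k vec3 set"
  let ?J = "ideal_J d :: 'k poly3 set"
  obtain N where N: "\<forall>n\<ge>N. kvs.dim (forms (int n) :: 'k poly3 set) = kvs.dim (?J \<inter> forms (int n)) + (2 * d - 2)"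
    using dim_ideal_J_forms[OF d] by blast
  define ev :: "'k vec3 \<Rightarrow> 'k poly3" where "ev = (\<lambda>(a, b, c). a * gen1 d + b * gen2 d + c * gen3 d)"
  have lin: "Vector_Spaces.linear kscale3 kscale ev"
    by (rule kscale3_linearI) (auto simp: ev_def kscale3_def kscale_conv_mult algebra_simps smult_add_right split: prod.splits)
  have "3 * kvs.dim (forms (int m) :: 'k poly3 set) + (2 * d - 2)
      = k3.dim (?S \<inter> forms3 (int m)) + kvs.dim (forms (int (m + d)) :: 'k poly3 set)" if m: "N \<le> m" for m
  proof -
    have ker: "{v \<in> forms3 (int m). ev v = 0} = ?S \<inter> forms3 (int m)"
      by (auto simp: ev_def mem_syz_iff split: prod.splits)
    have img: "ev ` forms3 (int m) = ?J \<inter> forms (int (m + d))"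
    proof (intro equalityI subsetI)
      fix p assume "p \<in> ev ` forms3 (int m)"
      then obtain a b c where p: "p = a * gen1 d + b * gen2 d + c * gen3 d"
        "a \<in> forms (int m)" "b \<in> forms (int m)" "c \<in> forms (int m)"
        by (auto simp: ev_def forms3_def)
      then have "p \<in> forms (int m + int d)"
        using gen_forms[OF d] by (auto intro!: forms_closed(2) forms_mult)
      then show "p \<in> ?J \<inter> forms (int (m + d))" using p(1) by (auto simp: mem_ideal_J_iff)
    next
      fix p assume "p \<in> ?J \<inter> forms (int (m + d))"
      then have p: "p \<in> ?J" "p \<in> forms (int (m + d))" by auto
      obtain u v w where "u \<in> forms (int (m + d) - int d)" "v \<in> forms (int (m + d) - int d)"
        "w \<in> forms (int (m + d) - int d)" "p = u * gen1 d + v * gen2 d + w * gen3 d"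
        using ideal_J_form_cases[OF d p] .
      then show "p \<in> ev ` forms3 (int m)"
        by (intro image_eqI[of _ _ "(u, v, w)"]) (simp_all add: ev_def forms3_def)
    qed
    have "k3.dim (forms3 (int m) :: 'k vec3 set) = k3.dim (?S \<inter> forms3 (int m)) + kvs.dim (?J \<inter> forms (int (m + d)))"
      using k3_k.rank_nullity[OF lin forms3_subspace forms3_finite_span, of "int m"] unfolding ker img .
    moreover have "kvs.dim (forms (int (m + d)) :: 'k poly3 set) = kvs.dim (?J \<inter> forms (int (m + d))) + (2 * d - 2)"
      using N[rule_format, of "m + d"] m by simp
    ultimately show ?thesis by (simp add: dim_forms3)
  qed
  then show ?thesis by blast
qed

section \<open>The Bourbaki degree does not depend on the choices\<close>

lemma gens_var_x:
  assumes d: "d \<ge> 4"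
  shows "\<not> var_x dvd (gen2 d :: ('k::field) poly3)"
proof
  assume "var_x dvd (gen2 d :: 'k poly3)"
  then have "cf (gen2 d :: 'k poly3) 0 (d - 1) 1 = 0"
    using mem_prime_x_iff[of "gen2 d :: 'k poly3"] by (simp add: prime_x_def)
  then show False using d by (simp add: gen2_def cf_mon)
qed

lemma gen1_conv: "gen1 d = var_x ^ d"
  by (simp add: gen1_def mon_conv_var)

lemma gen1_dvd_cancel:
  assumes d: "d \<ge> 4" and "gen1 d dvd a * gen2 d"
  shows "gen1 d dvd (a :: ('k::field) poly3)"
proof -
  have "var_x ^ d dvd gen2 d * a" using assms(2) by (simp add: gen1_conv mult.commute)
  then have "var_x ^ d dvd a"
    using prime_power_dvd_multD[OF prime_elem_var(1), of d "gen2 d" a] gens_var_x[OF d] d by simp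
  then show ?thesis by (simp add: gen1_conv)
qed

definition cross :: "('k::field) vec3 \<Rightarrow> 'k vec3 \<Rightarrow> 'k vec3" where
  "cross = (\<lambda>(a1, a2, a3) (b1, b2, b3). (a2 * b3 - a3 * b2, a3 * b1 - a1 * b3, a1 * b2 - a2 * b1))"

text \<open>Both factors are orthogonal to the generators, so their cross product is parallel to them.\<close>

lemma cross_syzygies:
  fixes s \<nu> :: "('k::field) vec3"
  assumes d: "d \<ge> 4" and s: "s \<in> syz (J_gens d)" and \<nu>: "\<nu> \<in> syz (J_gens d)"
  shows "\<exists>h. cross s \<nu> = scale3 h (J_gens d)"
proof -
  obtain s1 s2 s3 where s': "s = (s1, s2, s3)" by (cases s)
  obtain n1 n2 n3 where \<nu>': "\<nu> = (n1, n2, n3)" by (cases \<nu>)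
  let ?g1 = "gen1 d :: 'k poly3" and ?g2 = "gen2 d :: 'k poly3" and ?g3 = "gen3 d :: 'k poly3"
  have es: "s1 * ?g1 + s2 * ?g2 = - (s3 * ?g3)" and en: "n1 * ?g1 + n2 * ?g2 = - (n3 * ?g3)"
    and es': "s1 * ?g1 + s3 * ?g3 = - (s2 * ?g2)" and en': "n1 * ?g1 + n3 * ?g3 = - (n2 * ?g2)"
    using s \<nu> by (simp_all add: s' \<nu>' mem_syz_iff eq_neg_iff_add_eq_0 algebra_simps)
  have g0: "?g1 \<noteq> 0" by (rule gens_nonzero(1)[OF d])
  define c1 where "c1 = s2 * n3 - s3 * n2"
  define c2 where "c2 = s3 * n1 - s1 * n3"
  define c3 where "c3 = s1 * n2 - s2 * n1"
  have "c1 * ?g2 - c2 * ?g1 = n3 * (s1 * ?g1 + s2 * ?g2) - s3 * (n1 * ?g1 + n2 * ?g2)"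
    by (simp add: c1_def c2_def algebra_simps)
  then have 12: "c1 * ?g2 = c2 * ?g1" unfolding es en by (simp add: algebra_simps)
  have "c3 * ?g1 - c1 * ?g3 = n2 * (s1 * ?g1 + s3 * ?g3) - s2 * (n1 * ?g1 + n3 * ?g3)"
    by (simp add: c1_def c3_def algebra_simps)
  then have 13: "c1 * ?g3 = c3 * ?g1" unfolding es' en' by (simp add: algebra_simps)
  \<comment> \<open>The first two generators are coprime, so the common ratio \<open>h\<close> is a
    polynomial.\<close>
  have "?g1 dvd c1 * ?g2" unfolding 12 by simp
  then have "?g1 dvd c1" by (rule gen1_dvd_cancel[OF d])
  then obtain h where h: "c1 = h * ?g1" by (metis dvdE mult.commute)
  have "c2 * ?g1 = (h * ?g2) * ?g1" unfolding 12[symmetric] h by (simp only: mult_ac)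
  then have "c2 = h * ?g2" using g0 by (metis mult_right_cancel)
  moreover have "c3 * ?g1 = (h * ?g3) * ?g1" unfolding 13[symmetric] h by (simp only: mult_ac)
  then have "c3 = h * ?g3" using g0 by (metis mult_right_cancel)
  ultimately show ?thesis using h
    by (intro exI[of _ h]) (simp add: s' \<nu>' cross_def J_gens_eq scale3_def c1_def c2_def c3_def)
qed

text \<open>The Koszul syzygy of two generators, crossed with \<nu>, has as ratio the coordinate of
  \<nu> at the third. A nonzero coordinate thus gives a test syzygy whose ratio is a nonzero form of
  degree d.\<close>

lemma koszul_cross:
  fixes \<nu> :: "('k::field) vec3"
  assumes d: "d \<ge> 4" and \<nu>: "\<nu> \<in> syz (J_gens d)" "\<nu> \<in> forms3 (int d)" "\<nu> \<noteq> 0"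
  shows "\<exists>t b. t \<in> syz (J_gens d) \<and> t \<in> forms3 (int d) \<and> b \<in> forms (int d) \<and> b \<noteq> 0
    \<and> cross t \<nu> = scale3 b (J_gens d)"
proof -
  obtain n1 n2 n3 where \<nu>': "\<nu> = (n1, n2, n3)" by (cases \<nu>)
  let ?g1 = "gen1 d :: 'k poly3" and ?g2 = "gen2 d :: 'k poly3" and ?g3 = "gen3 d :: 'k poly3"
  have rel: "n1 * ?g1 + n2 * ?g2 + n3 * ?g3 = 0" using \<nu>(1) by (simp add: \<nu>' mem_syz_iff)
  have "a = (a + b + c) - b - c" "b = (a + b + c) - a - c" "c = (a + b + c) - a - b" for a b c :: "'k poly3"
    by simp_all
  from this[of "n1 * ?g1" "n2 * ?g2" "n3 * ?g3"]
  have r: "n1 * ?g1 = - (n2 * ?g2) - n3 * ?g3" "n2 * ?g2 = - (n1 * ?g1) - n3 * ?g3"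
    "n3 * ?g3 = - (n1 * ?g1) - n2 * ?g2"
    unfolding rel by simp_all
  have nf: "n1 \<in> forms (int d)" "n2 \<in> forms (int d)" "n3 \<in> forms (int d)"
    using \<nu>(2) by (auto simp: \<nu>' forms3_def)
  note g = gen_forms[OF d]
  consider "n1 \<noteq> 0" | "n2 \<noteq> 0" | "n3 \<noteq> 0" using \<nu>(3) by (auto simp: \<nu>' zero_prod_def)
  then show ?thesis
  proof cases
    case 1
    have "(0, - ?g3, ?g2) \<in> syz (J_gens d)" "(0, - ?g3, ?g2) \<in> forms3 (int d)"
      using g by (auto simp: mem_syz_iff forms3_def mult.commute intro: forms_closed)
    moreover have "cross (0, - ?g3, ?g2) \<nu> = scale3 n1 (J_gens d)"
      using r(1) by (simp add: cross_def \<nu>' J_gens_eq scale3_def mult.commute)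
    ultimately show ?thesis using nf(1) 1 by blast
  next
    case 2
    have "(?g3, 0, - ?g1) \<in> syz (J_gens d)" "(?g3, 0, - ?g1) \<in> forms3 (int d)"
      using g by (auto simp: mem_syz_iff forms3_def mult.commute intro: forms_closed)
    moreover have "cross (?g3, 0, - ?g1) \<nu> = scale3 n2 (J_gens d)"
      using r(2) by (simp add: cross_def \<nu>' J_gens_eq scale3_def mult.commute)
    ultimately show ?thesis using nf(2) 2 by blast
  next
    case 3
    have "(- ?g2, ?g1, 0) \<in> syz (J_gens d)" "(- ?g2, ?g1, 0) \<in> forms3 (int d)"
      using g by (auto simp: mem_syz_iff forms3_def mult.commute intro: forms_closed)
    moreover have "cross (- ?g2, ?g1, 0) \<nu> = scale3 n3 (J_gens d)"
      using r(3) by (simp add: cross_def \<nu>' J_gens_eq scale3_def mult.commute)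
    ultimately show ?thesis using nf(3) 3 by blast
  qed
qed

lemma cross_linear:
  "cross (scale3 a s - scale3 b t) \<nu> = scale3 a (cross s \<nu>) - scale3 b (cross t \<nu>)"
  "cross (scale3 r \<nu>) \<nu> = 0"
  by (cases s; cases t; cases \<nu>; simp add: cross_def scale3_def algebra_simps)
    (cases \<nu>; simp add: cross_def scale3_def zero_prod_def algebra_simps)

text \<open>Each prime of the right-hand factor misses some value of \<phi>, so it divides
  \<open>b\<close> and can be cancelled, one prime after another.\<close>

lemma common_prime_divisor:
  fixes b :: "'a::idom" and \<phi> h :: "'b \<Rightarrow> 'a"
  assumes "u dvd 1" "\<forall>p\<in>#ps. prime_elem p" "\<And>s. s \<in> M \<Longrightarrow> b * \<phi> s = u * prod_mset ps * h s"
    and "\<And>p. p \<in># ps \<Longrightarrow> \<exists>s\<in>M. \<not> p dvd \<phi> s"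
  shows "prod_mset ps dvd b"
  using assms(2-4)
proof (induction ps arbitrary: b)
  case (add p ps)
  obtain s where s: "s \<in> M" "\<not> p dvd \<phi> s" using add.prems(3)[of p] by auto
  have p: "prime_elem p" "p \<noteq> 0" using add.prems(1) by auto
  have "b * \<phi> s = p * (u * prod_mset ps * h s)" using add.prems(2)[OF s(1)] by (simp add: mult_ac)
  then have "p dvd b * \<phi> s" by simp
  then have "p dvd b" using prime_elem_dvd_multD[OF p(1)] s(2) by blast
  then obtain b' where b': "b = p * b'" by (auto elim: dvdE)
  have "b' * \<phi> s = u * prod_mset ps * h s" if "s \<in> M" for s
  proof -
    have "p * (b' * \<phi> s) = p * (u * prod_mset ps * h s)"
      using add.prems(2)[OF that] by (simp add: b' mult_ac)
    then show ?thesis using p(2) by simp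
  qed
  then have "prod_mset ps dvd b'" using add.IH add.prems(1,3) by simp
  then show ?case by (simp add: b' mult_dvd_mono)
qed simp

lemma ideal_height_le_1:
  fixes I :: "('k::field) poly3 set"
  assumes "prime_elem p" "\<And>a. a \<in> I \<Longrightarrow> p dvd a"
  shows "ideal_height R3 I \<noteq> 2"
proof -
  have "ideal_height R3 I \<le> prime_height R3 {a. p dvd a}"
    unfolding ideal_height_def
    using type_principal_primeideal[OF assms(1)] assms(2) by (intro INF_lower) auto
  also have "\<dots> \<le> 1" by (rule prime_height_principal_le[OF factorial_type_poly3 assms(1)])
  finally show ?thesis by (auto simp: one_enat_def numeral_eq_enat)
qed

text \<open>An isomorphism from the quotient of the syzygies by R\<nu> to \<open>I\<close>,
  homogeneous of degree \<open>c\<close>, given through its lift \<phi> to the syzygy module.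
  Neither the sign of \<open>c\<close> nor the height of \<open>I\<close> is fixed.\<close>

locale bourbaki_iso =
  fixes d :: nat and \<nu> :: "('k::field_char_0) vec3" and I :: "'k poly3 set" and \<phi> :: "'k vec3 \<Rightarrow> 'k poly3" and c :: int
  assumes d: "d \<ge> 4"
    and nu_syz: "\<nu> \<in> syz (J_gens d)" and nu_forms: "\<nu> \<in> forms3 (int d)" and nu_nz: "\<nu> \<noteq> 0"
    and phi_add: "s \<in> syz (J_gens d) \<Longrightarrow> t \<in> syz (J_gens d) \<Longrightarrow> \<phi> (s + t) = \<phi> s + \<phi> t"
    and phi_scale: "s \<in> syz (J_gens d) \<Longrightarrow> \<phi> (scale3 r s) = r * \<phi> s"
    and phi_ker: "s \<in> syz (J_gens d) \<Longrightarrow> \<phi> s = 0 \<longleftrightarrow> (\<exists>r. s = scale3 r \<nu>)"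
    and phi_img: "\<phi> ` syz (J_gens d) = I"
    and phi_forms: "s \<in> syz (J_gens d) \<Longrightarrow> s \<in> forms3 n \<Longrightarrow> \<phi> s \<in> forms (n + c)"
begin

abbreviation "S \<equiv> syz (J_gens d) :: 'k vec3 set"

lemmas S_closed = graded_submoduleD[OF graded_submodule_syz[OF d]]

lemma phi_0: "\<phi> 0 = 0"
proof -
  have "\<phi> (0 + 0) = \<phi> 0 + \<phi> 0" by (rule phi_add) (rule S_closed)+
  then show ?thesis by simp
qed

lemma phi_sum: "(\<And>i. i \<in> A \<Longrightarrow> f i \<in> S) \<Longrightarrow> \<phi> (sum f A) = (\<Sum>i\<in>A. \<phi> (f i))"
proof (induction A rule: infinite_finite_induct)
  case (insert x A)
  have "graded_submodule S" by (rule graded_submodule_syz[OF d])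
  then have "fm.subspace S" by (simp add: graded_submodule_def)
  then have "sum f A \<in> S" using insert.prems by (intro fm.subspace_sum) auto
  then show ?case using insert phi_add by simp
qed (simp_all add: phi_0)

text \<open>The component of degree m + c of \<phi> s is \<phi> of the component of degree m of s,
  so every form in \<open>I\<close> has a homogeneous preimage.\<close>

lemma phi_image_forms: "\<phi> ` (S \<inter> forms3 (int m)) = I \<inter> forms (int m + c)"
proof (intro equalityI subsetI)
  fix g assume "g \<in> \<phi> ` (S \<inter> forms3 (int m))"
  then show "g \<in> I \<inter> forms (int m + c)" using phi_img phi_forms by blast
next
  fix g assume g: "g \<in> I \<inter> forms (int m + c)"
  then obtain s where s: "s \<in> S" "g = \<phi> s" using phi_img by blast
  obtain N where "\<forall>M\<ge>N. s = (\<Sum>n\<le>M. hc3 (int n) s)" using sum_hc3 by blast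
  then have sN: "s = (\<Sum>n\<le>N + m. hc3 (int n) s)" by (meson le_add1)
  have mem: "hc3 n s \<in> S" for n using s(1) by (rule S_closed)
  have "g = hc (int m + c) (\<phi> s)" using g s hc_of_form[of g "int m + c" "int m + c"] by simp
  also have "\<phi> s = (\<Sum>n\<le>N + m. \<phi> (hc3 (int n) s))" using phi_sum[of "{..N + m}" "\<lambda>n. hc3 (int n) s"] sN mem by simp
  also have "hc (int m + c) \<dots> = (\<Sum>n\<le>N + m. if n = m then \<phi> (hc3 (int n) s) else 0)"
    unfolding hc_sum by (intro sum.cong refl) (simp add: hc_of_form[OF phi_forms[OF mem hc3_forms3]])
  also have "\<dots> = \<phi> (hc3 (int m) s)" by simp
  finally show "g \<in> \<phi> ` (S \<inter> forms3 (int m))" using mem by simp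
qed

text \<open>The factor \<open>r\<close> of a homogeneous multiple of \<nu> can be replaced by its
  component of degree n - d.\<close>

lemma multiples_nu: "{s \<in> S \<inter> forms3 n. \<phi> s = 0} = (\<lambda>r. scale3 r \<nu>) ` forms (n - int d)"
proof (intro equalityI subsetI)
  fix s assume s: "s \<in> {s \<in> S \<inter> forms3 n. \<phi> s = 0}"
  then obtain r where r: "s = scale3 r \<nu>" using phi_ker by blast
  obtain n1 n2 n3 where nu: "\<nu> = (n1, n2, n3)" by (cases \<nu>)
  have key: "hc (n - int d) r * p = r * p" if "p \<in> forms (int d)" "r * p \<in> forms n" for p
  proof -
    have "hc n (r * p) = hc (n - int d) r * p" using hc_mult_form[OF that(1), of "n - int d" r] by simp
    moreover have "hc n (r * p) = r * p" using hc_of_form[OF that(2), of n] by simp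
    ultimately show ?thesis by (simp only:)
  qed
  have "scale3 r \<nu> \<in> forms3 n" using s r by blast
  then have rn: "r * n1 \<in> forms n" "r * n2 \<in> forms n" "r * n3 \<in> forms n"
    by (simp_all add: nu scale3_def forms3_def)
  have "n1 \<in> forms (int d)" "n2 \<in> forms (int d)" "n3 \<in> forms (int d)"
    using nu_forms by (simp_all add: nu forms3_def)
  then have "hc (n - int d) r * n1 = r * n1" "hc (n - int d) r * n2 = r * n2"
    "hc (n - int d) r * n3 = r * n3"
    using key[OF _ rn(1)] key[OF _ rn(2)] key[OF _ rn(3)] by simp_all
  then have "scale3 (hc (n - int d) r) \<nu> = scale3 r \<nu>"
    unfolding nu scale3_def prod.case by (simp only:)
  then have "s = scale3 (hc (n - int d) r) \<nu>" using r by (rule trans[OF _ sym, rotated])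
  then show "s \<in> (\<lambda>r. scale3 r \<nu>) ` forms (n - int d)" by (rule image_eqI) (rule hc_forms)
next
  fix s assume "s \<in> (\<lambda>r. scale3 r \<nu>) ` forms (n - int d)"
  then obtain r where r: "r \<in> forms (n - int d)" "s = scale3 r \<nu>" by blast
  then have "s \<in> S" "s \<in> forms3 n"
    using S_closed(3)[OF nu_syz] scale3_forms3[OF r(1) nu_forms] by simp_all
  then show "s \<in> {s \<in> S \<inter> forms3 n. \<phi> s = 0}" using phi_ker r(2) by blast
qed

lemma scale3_nu_eq_0: "scale3 r \<nu> = 0 \<Longrightarrow> r = 0"
  using nu_nz by (cases \<nu>) (auto simp: scale3_def zero_prod_def)

lemma dim_ideal_forms:
  "k3.dim (S \<inter> forms3 (int m)) = kvs.dim (forms (int m - int d) :: 'k poly3 set) + kvs.dim (I \<inter> forms (int m + c))"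
proof -
  have sub: "k3.subspace (S \<inter> forms3 (int m))"
    by (rule graded_submodule_k3_subspace[OF graded_submodule_syz[OF d]])
  have fin: "finitely_spanned k3.span (S \<inter> forms3 (int m))"
    by (rule k3.finite_span_mono[OF forms3_finite_span]) blast
  have "\<exists>g. Vector_Spaces.linear kscale3 kscale g \<and> (\<forall>v\<in>S \<inter> forms3 (int m). g v = \<phi> v)"
    by (rule k3_k.linear_on_extend[OF sub])
      (auto simp: phi_add phi_scale kscale3_conv_scale3 kscale_conv_mult)
  then obtain g where g: "Vector_Spaces.linear kscale3 kscale g" "\<And>v. v \<in> S \<inter> forms3 (int m) \<Longrightarrow> g v = \<phi> v"
    by blast
  have "{v \<in> S \<inter> forms3 (int m). g v = 0} = {v \<in> S \<inter> forms3 (int m). \<phi> v = 0}" using g(2) by auto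
  moreover have "g ` (S \<inter> forms3 (int m)) = \<phi> ` (S \<inter> forms3 (int m))"
    by (rule image_cong[OF refl g(2)])
  moreover have lin: "Vector_Spaces.linear kscale kscale3 (\<lambda>r. scale3 r \<nu>)"
    by (rule kscale_3_linearI) (simp_all add: fm.scale_left_distrib kscale3_conv_scale3 kscale_conv_mult[symmetric] kscale_conv_mult)
  have "k3.dim ((\<lambda>r. scale3 r \<nu>) ` forms (int m - int d)) = kvs.dim (forms (int m - int d) :: 'k poly3 set)"
    by (rule k_k3.dim_image_injective[OF lin forms_subspace forms_finite_span scale3_nu_eq_0])
  ultimately show ?thesis
    using k3_k.rank_nullity[OF g(1) sub fin] by (simp only: multiples_nu phi_image_forms)
qed

text \<open>With D(n) = dim R_n, exactness and \<open>dim_syz_forms3\<close> give 3 D(m) + 2d - 2 -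
  D(m-d) - D(m+d) for the dimension of \<open>I\<close> in degree m + c. Since D(m-d) + D(m+d) = 2
  D(m) + d^2, this is D(m) - (d^2 - 2d + 2).\<close>

lemma dim_ideal_eventually:
  "\<exists>N. \<forall>m\<ge>N. kvs.dim (I \<inter> forms (int m + c)) + (d * d - (2 * d - 2)) = kvs.dim (forms (int m) :: 'k poly3 set)"
proof -
  obtain N where N: "\<forall>m\<ge>N. 3 * kvs.dim (forms (int m) :: 'k poly3 set) + (2 * d - 2)
    = k3.dim (S \<inter> forms3 (int m)) + kvs.dim (forms (int (m + d)) :: 'k poly3 set)"
    using dim_syz_forms3[OF d] by blast
  have "kvs.dim (I \<inter> forms (int m + c)) + (d * d - (2 * d - 2)) = kvs.dim (forms (int m) :: 'k poly3 set)"
    if m: "N + d \<le> m" for m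
  proof -
    define D where "D = (\<lambda>n. kvs.dim (forms (int n) :: 'k poly3 set))"
    have D: "2 * int (D n) = (int n + 1) * (int n + 2)" for n
    proof -
      have "int (2 * D n) = int ((n + 1) * (n + 2))" unfolding D_def two_dim_forms ..
      then show ?thesis by (simp only: of_nat_mult of_nat_add of_nat_numeral of_nat_1)
    qed
    obtain k where k: "m = k + d" using m by (metis add.commute add_leD2 le_iff_add)
    have "int m - int d = int k" using k by simp
    then have "3 * D m + (2 * d - 2) = D k + kvs.dim (I \<inter> forms (int m + c)) + D (m + d)"
      using N m dim_ideal_forms[of m] by (simp add: D_def)
    then have "int (3 * D m + (2 * d - 2)) = int (D k + kvs.dim (I \<inter> forms (int m + c)) + D (m + d))" by simp
    then have e: "3 * int (D m) + (2 * int d - 2) = int (D k) + int (kvs.dim (I \<inter> forms (int m + c))) + int (D (m + d))"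
      using d by (simp add: of_nat_diff)
    have "int (D k) + int (D (m + d)) = 2 * int (D m) + int d * int d"
      using D[of k] D[of "m + d"] D[of m] by (simp add: k algebra_simps)
    with e have "int (kvs.dim (I \<inter> forms (int m + c))) + (int d * int d - (2 * int d - 2)) = int (D m)"
      by linarith
    moreover have "2 * d \<le> d * d" using d by (intro mult_le_mono1) simp
    then have "2 * d - 2 \<le> d * d" by linarith
    ultimately have "int (kvs.dim (I \<inter> forms (int m + c)) + (d * d - (2 * d - 2))) = int (D m)"
      using d by (simp add: of_nat_diff)
    then show ?thesis by (simp add: D_def)
  qed
  then show ?thesis by blast
qed

text \<open>For c < 0 the dimension D(m) up to a constant would have to fit into R_(m+c), while D(m)
  - D(m+c) grows at least like m.\<close>

lemma shift_nonneg: "c \<ge> 0"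
proof (rule ccontr)
  assume c: "\<not> c \<ge> 0"
  obtain N where N: "\<And>m. m \<ge> N \<Longrightarrow> kvs.dim (I \<inter> forms (int m + c)) + (d * d - (2 * d - 2)) = kvs.dim (forms (int m) :: 'k poly3 set)"
    using dim_ideal_eventually by blast
  define m where "m = N + d * d + nat (- c)"
  define k where "k = nat (int m + c)"
  have "int m + c = int (N + d * d)" using c by (simp add: m_def)
  then have "k = N + d * d" by (simp only: k_def nat_int)
  then have k: "int k = int m + c" "k < m" using c by (simp_all add: m_def)
  have "kvs.dim (I \<inter> forms (int k)) \<le> kvs.dim (forms (int k) :: 'k poly3 set)"
    by (rule kvs.dim_mono_finite_span[OF forms_finite_span]) blast
  then have "kvs.dim (forms (int m) :: 'k poly3 set) \<le> kvs.dim (forms (int k) :: 'k poly3 set) + d * d"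
    using N[of m] k(1) by (simp add: m_def)
  then have 1: "(m + 1) * (m + 2) \<le> (k + 1) * (k + 2) + 2 * (d * d)"
    using two_dim_forms[of m, where ?'k = 'k] two_dim_forms[of k, where ?'k = 'k] by linarith
  have "(k + 1) * (k + 2) \<le> m * (m + 1)" using k(2) by (intro mult_le_mono) auto
  then have "(m + 1) * (m + 2) \<le> m * (m + 1) + 2 * (d * d)"
    using 1 by (meson add_le_mono1 le_trans)
  moreover have "(m + 1) * (m + 2) = m * (m + 1) + 2 * (m + 1)" by (simp add: algebra_simps)
  ultimately have "2 * (m + 1) \<le> 2 * (d * d)" by (simp only: add_le_cancel_left)
  then have "m + 1 \<le> d * d" by simp
  then show False by (simp add: m_def)
qed

text \<open>Let b be the ratio of the test syzygy t and a = \<phi> t. Then b \<phi>(s) = a h(s) for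
  all syzygies s. No prime factor of a divides all of \<open>I\<close>, as the height is two; so
  each of them divides b, and a divides b. For c > 0 the degree d + c of a exceeds the degree d of
  b.\<close>

lemma shift_nonpos:
  assumes ht: "ideal_height R3 I = 2"
  shows "c \<le> 0"
proof (rule ccontr)
  assume c: "\<not> c \<le> 0"
  obtain t b where t: "t \<in> S" "t \<in> forms3 (int d)" "b \<in> forms (int d)" "b \<noteq> 0" "cross t \<nu> = scale3 b (J_gens d)"
    using koszul_cross[OF d nu_syz nu_forms nu_nz] by blast
  define a where "a = \<phi> t"
  have a: "a \<in> forms (int d + c)" unfolding a_def by (rule phi_forms[OF t(1,2)])
  have "\<exists>h. b * \<phi> s = a * h" if s: "s \<in> S" for s
  proof -
    obtain h where h: "cross s \<nu> = scale3 h (J_gens d)" using cross_syzygies[OF d s nu_syz] by blast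
    \<comment> \<open>\<phi> kills this combination, so it is a multiple of \<nu>; the cross product
      with \<nu> then removes it and leaves a relation between the ratios.\<close>
    have mem: "scale3 (\<phi> s) t - scale3 a s \<in> S"
      using S_closed(2)[OF S_closed(3)[OF t(1), of "\<phi> s"] S_closed(3)[OF s, of "- a"]] by simp
    have "\<phi> (scale3 (\<phi> s) t + scale3 (- a) s) = 0"
      using S_closed(3)[OF t(1)] S_closed(3)[OF s] by (simp only: phi_add phi_scale[OF t(1)] phi_scale[OF s]) (simp add: a_def)
    then have "\<phi> (scale3 (\<phi> s) t - scale3 a s) = 0" by simp
    then obtain r where "scale3 (\<phi> s) t - scale3 a s = scale3 r \<nu>" using phi_ker[OF mem] by blast
    then have "scale3 (\<phi> s) (cross t \<nu>) - scale3 a (cross s \<nu>) = 0"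
      using cross_linear(1)[of "\<phi> s" t a s \<nu>] cross_linear(2)[of r \<nu>] by simp
    then have "\<phi> s * (b * gen1 d) = a * (h * gen1 d)"
      unfolding t(5) h by (simp add: J_gens_eq scale3_def zero_prod_def)
    then have "(b * \<phi> s) * gen1 d = (a * h) * gen1 d" by (simp only: mult_ac)
    then show ?thesis using gens_nonzero(1)[OF d, where ?'k = 'k] by auto
  qed
  then obtain h where h: "\<And>s. s \<in> S \<Longrightarrow> b * \<phi> s = a * h s" by metis
  show False
  proof (cases "a = 0")
    case True
    then have "\<phi> s = 0" if "s \<in> S" for s using h[OF that] t(4) by simp
    then have "var_x dvd g" if "g \<in> I" for g using that phi_img by auto
    then show False using ideal_height_le_1[OF prime_elem_var(1)] ht by blast
  next
    case False
    obtain u ps where u: "u dvd 1" "\<forall>p\<in>#ps. prime_elem p" "a = u * prod_mset ps"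
      using factorial_typeE[OF factorial_type_poly3 False] .
    have "\<exists>s\<in>S. \<not> p dvd \<phi> s" if "p \<in># ps" for p
    proof (rule ccontr)
      assume "\<not> (\<exists>s\<in>S. \<not> p dvd \<phi> s)"
      then have "p dvd g" if "g \<in> I" for g using that phi_img by auto
      then show False using ideal_height_le_1[of p I] ht u(2) \<open>p \<in># ps\<close> by blast
    qed
    then have "prod_mset ps dvd b"
      using common_prime_divisor[OF u(1,2), of S b \<phi> h] h u(3) by blast
    moreover have "a dvd prod_mset ps" using u(1,3) by (metis mult_dvd_mono dvd_refl mult_1_left)
    ultimately have "a dvd b" by (rule dvd_trans[rotated])
    then obtain w where "b = w * a" by (metis dvdE mult.commute)
    \<comment> \<open>Comparison in degree d: the cofactor would have a component of negative degree
      -c, which is zero.\<close>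
    then have "hc (- c + (int d + c)) b = hc (- c) w * a" using hc_mult_form[OF a, of "- c" w] by simp
    moreover have "hc (- c + (int d + c)) b = b" using hc_of_form[OF t(3), of "int d"] by simp
    ultimately show False using hc_neg[of "- c" w] c t(4) by simp
  qed
qed

lemma quot_multiplicity_ideal:
  assumes ht: "ideal_height R3 I = 2"
  shows "quot_multiplicity I = of_nat ((d - 1) ^ 2 + 1)"
proof -
  have c: "c = 0" using shift_nonneg shift_nonpos[OF ht] by simp
  obtain N where N: "\<And>m. m \<ge> N \<Longrightarrow> kvs.dim (I \<inter> forms (int m + c)) + (d * d - (2 * d - 2)) = kvs.dim (forms (int m) :: 'k poly3 set)"
    using dim_ideal_eventually by blast
  obtain e where "d = e + 4" using d by (metis add.commute le_iff_add)
  then have dd: "d * d - (2 * d - 2) = (d - 1) ^ 2 + 1" by (simp add: power2_eq_square algebra_simps)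
  have "hilbert_fun I m = (d - 1) ^ 2 + 1" if "m \<ge> N" for m
    unfolding hilbert_fun_def dd[symmetric] using N[OF that] c by simp
  then show ?thesis
    by (intro quot_multiplicity_eventually_const) (auto simp: eventually_sequentially)
qed

end

lemma quot_iso_shift_bourbaki_iso:
  fixes \<nu> :: "('k::field_char_0) vec3"
  assumes d: "d \<ge> 4" and \<nu>: "\<nu> \<in> syz (J_gens d)" "\<nu> \<in> forms3 (int d)" "\<nu> \<noteq> 0"
    and iso: "quot_iso_shift (syz (J_gens d)) \<nu> I"
  shows "\<exists>\<phi> c. bourbaki_iso d \<nu> I \<phi> c"
proof -
  let ?S = "syz (J_gens d) :: 'k vec3 set"
  obtain \<psi> :: "'k vec3 set \<Rightarrow> 'k poly3" and c where bij: "bij_betw \<psi> (coset3 \<nu> ` ?S) I"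
    and add: "\<forall>s\<in>?S. \<forall>t\<in>?S. \<psi> (coset3 \<nu> (s + t)) = \<psi> (coset3 \<nu> s) + \<psi> (coset3 \<nu> t)"
    and scale: "\<forall>r. \<forall>s\<in>?S. \<psi> (coset3 \<nu> (scale3 r s)) = r * \<psi> (coset3 \<nu> s)"
    and forms: "\<forall>n. \<forall>s\<in>?S \<inter> forms3 n. \<psi> (coset3 \<nu> s) \<in> forms (n + c)"
    using iso unfolding quot_iso_shift_def by blast
  define \<phi> where "\<phi> = (\<lambda>s. \<psi> (coset3 \<nu> s))"
  have zero: "(0 :: 'k vec3) \<in> ?S" by (rule graded_submoduleD[OF graded_submodule_syz[OF d]])
  have phi0: "\<phi> 0 = 0" using add zero unfolding \<phi>_def by (metis add_0 add_cancel_right_left)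
  have ker: "\<phi> s = 0 \<longleftrightarrow> (\<exists>r. s = scale3 r \<nu>)" if s: "s \<in> ?S" for s
  proof
    assume "\<phi> s = 0"
    then have "\<psi> (coset3 \<nu> s) = \<psi> (coset3 \<nu> 0)" using phi0 by (simp add: \<phi>_def)
    then have "coset3 \<nu> s = coset3 \<nu> 0"
      using bij_betw_imp_inj_on[OF bij] s zero by (auto dest: inj_onD)
    moreover have "s + scale3 0 \<nu> \<in> coset3 \<nu> s" unfolding coset3_def by blast
    ultimately have "s \<in> coset3 \<nu> 0" by simp
    then show "\<exists>r. s = scale3 r \<nu>" by (auto simp: coset3_def)
  next
    assume "\<exists>r. s = scale3 r \<nu>"
    then obtain r where r: "s = scale3 r \<nu>" by blast
    have "coset3 \<nu> s = coset3 \<nu> 0"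
    proof (intro equalityI subsetI)
      fix v assume "v \<in> coset3 \<nu> s"
      then obtain q where "v = s + scale3 q \<nu>" by (auto simp: coset3_def)
      then have "v = 0 + scale3 (r + q) \<nu>" by (simp add: r fm.scale_left_distrib)
      then show "v \<in> coset3 \<nu> 0" unfolding coset3_def by blast
    next
      fix v assume "v \<in> coset3 \<nu> 0"
      then obtain q where "v = 0 + scale3 q \<nu>" by (auto simp: coset3_def)
      then have "v = s + scale3 (q - r) \<nu>" by (simp add: r fm.scale_left_diff_distrib)
      then show "v \<in> coset3 \<nu> s" unfolding coset3_def by blast
    qed
    then show "\<phi> s = 0" using phi0 by (simp add: \<phi>_def)
  qed
  have "bourbaki_iso d \<nu> I \<phi> c"
  proof
    show "\<phi> ` ?S = I" using bij_betw_imp_surj_on[OF bij] by (simp add: \<phi>_def image_image)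
    show "\<phi> s \<in> forms (n + c)" if "s \<in> ?S" "s \<in> forms3 n" for s n
      using forms that by (simp add: \<phi>_def)
  qed (use d \<nu> add scale ker in \<open>simp_all add: \<phi>_def\<close>)
  then show ?thesis by blast
qed

section \<open>The Bourbaki ideal of a Koszul syzygy\<close>

text \<open>The substitution x = 0 as an endomorphism of k[x,y,z], so that results stay in the same
  type.\<close>

definition at_x0 :: "('k::field) poly3 \<Rightarrow> 'k poly3" where
  "at_x0 = map_poly (map_poly (\<lambda>r. [:Polynomial.coeff r 0:]))"

lemma cf_at_x0: "cf (at_x0 p) i j l = (if i = 0 then cf p 0 j l else 0)"
  by (cases i) (simp_all add: at_x0_def coeff_map_poly)

lemma at_x0_mult: "at_x0 (p * q) = at_x0 p * at_x0 q"
proof (intro poly3_eqI)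
  fix i j l
  show "cf (at_x0 (p * q)) i j l = cf (at_x0 p * at_x0 q) i j l"
  proof (cases "i = 0")
    case True
    then show ?thesis by (simp add: cf_at_x0 cf_mult)
  next
    case False
    have "cf (at_x0 p) a b c * cf (at_x0 q) (i - a) (j - b) (l - c) = 0" for a b c
      using False by (simp add: cf_at_x0)
    then have "cf (at_x0 p * at_x0 q) i j l = 0" unfolding cf_mult by (intro sum.neutral ballI)
    then show ?thesis using False by (simp add: cf_at_x0)
  qed
qed

lemma at_x0_add: "at_x0 (p + q) = at_x0 p + at_x0 q"
  by (intro poly3_eqI) (simp add: cf_at_x0)

lemma at_x0_var_x: "at_x0 (var_x * p) = 0"
  by (intro poly3_eqI) (simp add: cf_at_x0 cf_var_x)

lemma at_x0_decompose: "p = at_x0 p + var_x * shift_x p"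
  by (intro poly3_eqI) (auto simp: cf_at_x0 cf_var_x cf_shift split: nat.split)

lemma gen2_conv:
  "(gen2 d :: ('k::field) poly3) = mon 0 (d - 1) 1 - var_x * kscale (of_nat (d - 2)) (mon 0 1 (d - 2))"
proof -
  have "mon 1 1 (d - 2) = var_x * (mon 0 1 (d - 2) :: 'k poly3)" by (simp add: mon_conv_var mult.assoc)
  then show ?thesis by (simp only: gen2_def kscale_conv_mult mult.left_commute)
qed

text \<open>Off the two primes \<open>(x,y)\<close> and \<open>(x,z)\<close> an element is a nonzerodivisor modulo the complete
  intersection \<open>(x\<^bsup>i\<^esup>, g\<^sub>2)\<close>: modulo \<open>x\<close> it is coprime to \<open>g\<^sub>2 = y\<^bsup>d-1\<^esup>z\<close>.\<close>

lemma nonzerodivisor_mod_gens: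
  fixes w :: "('k::field) poly3"
  assumes d: "d \<ge> 4" and w: "w \<notin> prime_xy" "w \<notin> prime_xz"
    and eq: "w * a = var_x ^ i * u + gen2 d * v"
  shows "\<exists>u' v'. a = var_x ^ i * u' + gen2 d * v'"
  using eq
proof (induction i arbitrary: a u v)
  case 0
  have "a = var_x ^ 0 * a + gen2 d * 0" by simp
  then show ?case by blast
next
  case (Suc i)
  define m :: "'k poly3" where "m = mon 0 (d - 1) 1"
  define r :: "'k poly3" where "r = kscale (of_nat (d - 2)) (mon 0 1 (d - 2))"
  have g2: "gen2 d = m - var_x * r" unfolding m_def r_def by (rule gen2_conv)
  have m: "m = var_y ^ (d - 1) * var_z" by (simp add: m_def mon_conv_var)
  have "at_x0 (gen2 d) = m"
    by (intro poly3_eqI) (auto simp: cf_at_x0 g2 cf_var_x m_def cf_mon)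
  moreover have "at_x0 (var_x ^ Suc i * u) = 0" by (simp add: mult.assoc at_x0_var_x)
  \<comment> \<open>Modulo x the second generator is y^(d-1) z. Neither y nor z divides w at x = 0,
    so y^(d-1) z divides a at x = 0.\<close>
  ultimately have e0: "at_x0 w * at_x0 a = m * at_x0 v"
    using arg_cong[OF Suc.prems, of at_x0] by (simp only: at_x0_mult[symmetric] at_x0_add) (simp add: at_x0_mult)
  have wy: "\<not> var_y dvd at_x0 w" using w(1) by (auto simp: var_y_dvd_iff cf_at_x0 prime_xy_def)
  have wz: "\<not> var_z dvd at_x0 w" using w(2) by (auto simp: var_z_dvd_iff cf_at_x0 prime_xz_def)
  have "var_y ^ (d - 1) dvd at_x0 w * at_x0 a" unfolding e0 m by (simp add: mult.assoc)
  then have "var_y ^ (d - 1) dvd at_x0 a"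
    by (rule prime_power_dvd_multD[OF prime_elem_var(2) _ _ wy]) (use d in simp)
  then obtain a1 where a1: "at_x0 a = var_y ^ (d - 1) * a1" by (auto elim: dvdE)
  have "var_z dvd at_x0 w * at_x0 a" unfolding e0 m by (simp add: mult.assoc mult.left_commute)
  then have "var_z dvd at_x0 a" using prime_elem_dvd_multD[OF prime_elem_var(3)] wz by blast
  moreover have "\<not> var_z dvd (var_y ^ (d - 1) :: 'k poly3)"
  proof
    assume "var_z dvd (var_y ^ (d - 1) :: 'k poly3)"
    then have "var_z dvd (var_y :: 'k poly3)" by (rule prime_elem_dvd_power[OF prime_elem_var(3)])
    moreover have "cf (var_y :: 'k poly3) 0 1 0 = 1" by (simp add: var_y_def)
    ultimately show False unfolding var_z_dvd_iff by (metis zero_neq_one)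
  qed
  ultimately have "var_z dvd a1" unfolding a1 using prime_elem_dvd_multD[OF prime_elem_var(3)] by blast
  then obtain q where "a1 = var_z * q" by (auto elim: dvdE)
  then have am: "at_x0 a = m * q" using a1 by (simp add: m mult.assoc)
  define b where "b = r * q + shift_x a"
  have a: "a = gen2 d * q + var_x * b"
  proof -
    have "a = m * q + var_x * shift_x a" using at_x0_decompose[of a] am by simp
    then show ?thesis unfolding g2 b_def by (simp add: algebra_simps)
  qed
  have "var_x * (w * b) = w * a - w * (gen2 d * q)" unfolding a by (simp add: algebra_simps)
  then have xb: "var_x * (w * b) = var_x * (var_x ^ i * u) + gen2 d * (v - w * q)"
    unfolding Suc.prems by (simp add: algebra_simps)
  \<comment> \<open>x divides v - w q because it does not divide the second generator. Cancelling x
    leaves the same situation for \<open>b\<close> with the exponent \<open>i\<close>.\<close>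
  then have "gen2 d * (v - w * q) = var_x * (w * b - var_x ^ i * u)" by (simp add: algebra_simps)
  then have "var_x dvd gen2 d * (v - w * q)" by simp
  then have "var_x dvd v - w * q"
    using prime_elem_dvd_multD[OF prime_elem_var(1)] gens_var_x[OF d] by blast
  then obtain v' where v': "v - w * q = var_x * v'" by (auto elim: dvdE)
  have "var_x * (w * b) = var_x * (var_x ^ i * u + gen2 d * v')"
    using xb unfolding v' by (simp add: algebra_simps)
  moreover have "var_x \<noteq> (0 :: 'k poly3)" by (simp add: var_x_def)
  ultimately have "w * b = var_x ^ i * u + gen2 d * v'" by (simp only: mult_cancel_left) simp
  then obtain u1 v1 where "b = var_x ^ i * u1 + gen2 d * v1" using Suc.IH by blast
  then have "a = var_x ^ Suc i * u1 + gen2 d * (q + var_x * v1)"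
    using a by (simp add: algebra_simps)
  then show ?case by blast
qed

section \<open>The ideal (g1, g2) : g3 has height two, is unmixed and is homogeneous\<close>

definition colon_ideal :: "nat \<Rightarrow> ('k::field) poly3 set" where
  "colon_ideal d = {a. \<exists>u v. a * gen3 d = u * gen1 d + v * gen2 d}"

lemma ideal_colon_ideal: "ideal (colon_ideal d) R3"
proof -
  have "(0 :: 'a poly3) * gen3 d = 0 * gen1 d + 0 * gen2 d" by simp
  moreover have "(a + b) * gen3 d = (u + u') * gen1 d + (v + v') * gen2 d"
    if "a * gen3 d = u * gen1 d + v * gen2 d" "b * gen3 d = u' * gen1 d + v' * gen2 d"
    for a b u v u' v' :: "'a poly3"
    using that by (simp add: algebra_simps)
  moreover have "(r * a) * gen3 d = (r * u) * gen1 d + (r * v) * gen2 d"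
    if "a * gen3 d = u * gen1 d + v * gen2 d" for r a u v :: "'a poly3"
  proof -
    have "(r * a) * gen3 d = r * (a * gen3 d)" by (simp only: mult.assoc)
    then show ?thesis unfolding that by (simp only: distrib_left mult.assoc)
  qed
  ultimately show ?thesis unfolding type_ideal_iff colon_ideal_def by blast
qed

lemmas colon_ideal_closed = type_idealD[OF ideal_colon_ideal]

lemma nonzerodivisor_mod_colon_ideal:
  fixes w :: "('k::field) poly3"
  assumes d: "d \<ge> 4" and w: "w \<notin> prime_xy" "w \<notin> prime_xz" and "w * a \<in> colon_ideal d"
  shows "a \<in> colon_ideal d"
proof -
  obtain u v where "w * a * gen3 d = u * gen1 d + v * gen2 d" using assms(4) by (auto simp: colon_ideal_def)
  then have "w * (a * gen3 d) = var_x ^ d * u + gen2 d * v" by (simp add: gen1_conv mult_ac)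
  then obtain u' v' where "a * gen3 d = var_x ^ d * u' + gen2 d * v'"
    using nonzerodivisor_mod_gens[OF d w] by blast
  then have "a * gen3 d = u' * gen1 d + v' * gen2 d" by (simp add: gen1_conv mult.commute)
  then show ?thesis unfolding colon_ideal_def by blast
qed

lemma gens_mem_colon_ideal: "gen1 d \<in> colon_ideal d" "gen2 d \<in> colon_ideal d"
proof -
  have "gen1 d * gen3 d = gen3 d * gen1 d + 0 * gen2 d" "gen2 d * gen3 d = 0 * gen1 d + gen3 d * gen2 d"
    by (simp_all add: mult.commute)
  then show "gen1 d \<in> colon_ideal d" "gen2 d \<in> colon_ideal d" unfolding colon_ideal_def by blast+
qed

text \<open>Membership of 1 would give a syzygy (u, v, -1), whose component of degree 0 is nonzero,
  against the initial degree d.\<close>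

lemma one_not_mem_colon_ideal:
  assumes d: "d \<ge> 4"
  shows "1 \<notin> (colon_ideal d :: ('k::field_char_0) poly3 set)"
proof
  assume "1 \<in> (colon_ideal d :: 'k poly3 set)"
  then obtain u v :: "'k poly3" where uv: "1 * gen3 d = u * gen1 d + v * gen2 d" by (auto simp: colon_ideal_def)
  then have "(u, v, - 1) \<in> syz (J_gens d)" by (simp add: mem_syz_iff)
  then have "hc3 0 (u, v, - 1) \<in> syz (J_gens d)"
    by (rule graded_submoduleD(4)[OF graded_submodule_syz[OF d]])
  then have "hc3 0 (u, v, - 1) = 0" by (rule small_syzygy_zero[OF d _ hc3_forms3]) (use d in simp)
  moreover have "hc 0 (- 1) = (- 1 :: 'k poly3)"
    using hc_of_form[OF forms_closed(4)[OF one_forms], of 0] by simp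
  ultimately show False by (simp add: hc3_def zero_prod_def)
qed

text \<open>Avoidance for two ideals; it turns an inclusion in the union of (x,y) and (x,z) into an
  inclusion in one of them.\<close>

lemma type_ideal_subset_Un:
  fixes P A B :: "'a::comm_ring_1 set"
  assumes P: "ideal P ring_of_type_algebra" and A: "ideal A ring_of_type_algebra"
    and B: "ideal B ring_of_type_algebra" and "P \<subseteq> A \<union> B"
  shows "P \<subseteq> A \<or> P \<subseteq> B"
proof (rule ccontr)
  assume "\<not> (P \<subseteq> A \<or> P \<subseteq> B)"
  then obtain a b where ab: "a \<in> P" "a \<notin> A" "b \<in> P" "b \<notin> B" by blast
  then have "a \<in> B" "b \<in> A" using assms(4) by blast+
  have "a + b \<in> P" using ab P by (intro type_idealD(2))
  then consider "a + b \<in> A" | "a + b \<in> B" using assms(4) by blast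
  then show False
  proof cases
    case 1
    then have "a + b - b \<in> A" using \<open>b \<in> A\<close> by (rule type_idealD(6)[OF A])
    then show False using ab by simp
  next
    case 2
    then have "a + b - a \<in> B" using \<open>a \<in> B\<close> by (rule type_idealD(6)[OF B])
    then show False using ab by simp
  qed
qed

lemma ideal_prime_xy_xz: "ideal prime_xy R3" "ideal prime_xz R3"
  by (rule type_primeidealD(1)[OF primeideal_prime_xy], rule type_primeidealD(1)[OF primeideal_prime_xz])

lemma primes_over_gens:
  fixes P :: "('k::field) poly3 set"
  assumes d: "d \<ge> 4" and P: "primeideal P R3" "gen1 d \<in> P" "gen2 d \<in> P"
  shows "var_x \<in> P \<and> (var_y \<in> P \<or> var_z \<in> P)"
proof -
  note PI = type_idealD[OF type_primeidealD(1)[OF P(1)]]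
  have x: "var_x \<in> P" using P(2) unfolding gen1_conv by (rule type_primeideal_powerD[OF P(1)])
  define r where "r = kscale (of_nat (d - 2)) (mon 0 1 (d - 2) :: 'k poly3)"
  have "gen2 d + var_x * r \<in> P" by (rule PI(2)[OF P(3) PI(4)[OF x]])
  moreover have "gen2 d + var_x * r = var_y ^ (d - 1) * var_z"
    using gen2_conv[of d, where ?'k = 'k] by (simp add: r_def mon_conv_var)
  ultimately have "var_y ^ (d - 1) \<in> P \<or> var_z \<in> P" using type_primeidealD(3)[OF P(1)] by simp
  then show ?thesis using x type_primeideal_powerD[OF P(1)] by blast
qed

text \<open>An element outside both primes is a nonzerodivisor modulo the colon ideal; lying in that
  ideal, it would force 1 into it.\<close>

lemma colon_ideal_subset:
  fixes d :: nat
  assumes d: "d \<ge> 4"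
  shows "colon_ideal d \<subseteq> (prime_xy :: ('k::field_char_0) poly3 set) \<or> colon_ideal d \<subseteq> (prime_xz :: 'k poly3 set)"
proof (rule type_ideal_subset_Un[OF ideal_colon_ideal ideal_prime_xy_xz], rule subsetI)
  fix w :: "'k poly3" assume w: "w \<in> colon_ideal d"
  show "w \<in> prime_xy \<union> prime_xz"
  proof (rule ccontr)
    assume "w \<notin> prime_xy \<union> prime_xz"
    then have "1 \<in> (colon_ideal d :: 'k poly3 set)"
      using nonzerodivisor_mod_colon_ideal[OF d, of w 1] w by simp
    then show False using one_not_mem_colon_ideal[OF d] by blast
  qed
qed

lemma ideal_height_colon_ideal:
  assumes d: "d \<ge> 4"
  shows "ideal_height R3 (colon_ideal d :: ('k::field_char_0) poly3 set) = 2"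
proof (rule ideal_height_eq_2)
  fix P :: "'k poly3 set" assume P: "primeideal P R3" "colon_ideal d \<subseteq> P"
  then have "gen1 d \<in> P" "gen2 d \<in> P" using gens_mem_colon_ideal by blast+
  then have "var_x \<in> P \<and> (var_y \<in> P \<or> var_z \<in> P)" by (rule primes_over_gens[OF d P(1)])
  then show "prime_xy \<subseteq> P \<or> prime_xz \<subseteq> P" using prime_xy_subset[OF P(1)] prime_xz_subset[OF P(1)] by blast
qed (rule colon_ideal_subset[OF d])

text \<open>An associated prime consists of zero divisors modulo the colon ideal, so it lies in
  (x,y) or (x,z). It also contains the first two generators, hence x and one of y and z; so it
  equals one of these two primes.\<close>

lemma unmixed_colon_ideal:
  assumes d: "d \<ge> 4"
  shows "unmixed R3 (colon_ideal d :: ('k::field_char_0) poly3 set)"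
  unfolding unmixed_def ideal_height_colon_ideal[OF d]
proof
  fix P :: "'k poly3 set" assume "P \<in> ass_primes R3 (colon_ideal d)"
  then obtain f where P: "primeideal P R3" and f: "P = {a. a * f \<in> colon_ideal d}"
    unfolding ass_primes_def by auto
  have "f \<notin> colon_ideal d" using type_primeidealD(2)[OF P] f by simp
  have "P \<subseteq> prime_xy \<union> prime_xz"
    using nonzerodivisor_mod_colon_ideal[OF d, of _ f] \<open>f \<notin> colon_ideal d\<close> f by blast
  then have sub: "P \<subseteq> prime_xy \<or> P \<subseteq> prime_xz"
    by (rule type_ideal_subset_Un[OF type_primeidealD(1)[OF P] ideal_prime_xy_xz])
  have "gen1 d \<in> P" "gen2 d \<in> P"
    using f colon_ideal_closed(4)[OF gens_mem_colon_ideal(1)] colon_ideal_closed(4)[OF gens_mem_colon_ideal(2)]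
    by simp_all
  then have mem: "var_x \<in> P" "var_y \<in> P \<or> var_z \<in> P" using primes_over_gens[OF d P] by blast+
  have "cf (var_y :: 'k poly3) 0 1 0 = 1" "cf (var_z :: 'k poly3) 0 0 1 = 1"
    by (simp_all add: var_y_def var_z_def)
  then have ny: "var_y \<notin> (prime_xz :: 'k poly3 set)" "var_z \<notin> (prime_xy :: 'k poly3 set)"
    unfolding prime_xz_def prime_xy_def by (metis (mono_tags, lifting) mem_Collect_eq zero_neq_one)+
  have "P = prime_xy \<or> P = prime_xz"
  proof (cases "var_y \<in> P")
    case True
    then show ?thesis using prime_xy_subset[OF P mem(1)] sub ny(1) by blast
  next
    case False
    then show ?thesis using prime_xz_subset[OF P mem(1)] sub mem(2) ny(2) by blast
  qed
  then show "prime_height R3 P = 2" using prime_height_prime_xy prime_height_prime_xz by blast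
qed

lemma homogeneous_ideal_colon_ideal:
  assumes d: "d \<ge> 4"
  shows "homogeneous_ideal (colon_ideal d :: ('k::field) poly3 set)"
  unfolding homogeneous_ideal_def
proof (intro conjI ideal_colon_ideal equalityI subsetI)
  let ?H = "{p \<in> colon_ideal d. \<exists>n. p \<in> forms n} :: 'k poly3 set"
  fix p :: "'k poly3" assume p: "p \<in> colon_ideal d"
  then obtain u v where uv: "p * gen3 d = u * gen1 d + v * gen2 d" by (auto simp: colon_ideal_def)
  have "hc n p \<in> ?H" for n
  proof -
    have "hc n p * gen3 d = hc (n + int d) (p * gen3 d)" by (rule hc_mult_form[OF gen_forms(3)[OF d], symmetric])
    also have "\<dots> = hc n u * gen1 d + hc n v * gen2 d"
      unfolding uv hc_add hc_mult_form[OF gen_forms(1)[OF d]] hc_mult_form[OF gen_forms(2)[OF d]] ..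
    finally show ?thesis unfolding colon_ideal_def using hc_forms by blast
  qed
  then have "hc n p \<in> genideal R3 ?H" for n using type_genideal(2)[of ?H] by blast
  then have sum: "(\<Sum>n\<le>N. hc (int n) p) \<in> genideal R3 ?H" for N
    by (intro type_ideal_sum[OF type_genideal(1)])
  obtain N where N: "p = (\<Sum>n\<le>N. hc (int n) p)" using sum_hc[of p] by blast
  show "p \<in> genideal R3 ?H" by (subst N) (rule sum)
next
  let ?H = "{p \<in> colon_ideal d. \<exists>n. p \<in> forms n} :: 'k poly3 set"
  have "genideal R3 ?H \<subseteq> colon_ideal d" by (rule type_genideal(3)[OF ideal_colon_ideal]) blast
  then show "p \<in> colon_ideal d" if "p \<in> genideal R3 ?H" for p using that by blast
qed

text \<open>Syzygies with the same third coordinate differ by a relation between the first two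
  generators, and these are coprime, so the relation is a multiple of the Koszul syzygy.\<close>

lemma coset3_koszul_eq_iff:
  fixes s t :: "('k::field) vec3"
  assumes d: "d \<ge> 4" and s: "s \<in> syz (J_gens d)" "t \<in> syz (J_gens d)"
  shows "coset3 (koszul d) s = coset3 (koszul d) t \<longleftrightarrow> snd (snd s) = snd (snd t)"
proof
  assume eq: "coset3 (koszul d) s = coset3 (koszul d) t"
  have "s + scale3 0 (koszul d) \<in> coset3 (koszul d) s" unfolding coset3_def by blast
  then have "s \<in> coset3 (koszul d) t" unfolding eq by simp
  then obtain r where "s = t + scale3 r (koszul d)" by (auto simp: coset3_def)
  then show "snd (snd s) = snd (snd t)" by (cases t) (simp add: koszul_def scale3_def)
next
  assume eq: "snd (snd s) = snd (snd t)"
  obtain s1 s2 s3 t1 t2 where st: "s = (s1, s2, s3)" "t = (t1, t2, s3)"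
    using eq by (cases s, cases t) auto
  define a b where "a = s1 - t1" and "b = s2 - t2"
  have "a * gen1 d + b * gen2 d = (s1 * gen1 d + s2 * gen2 d + s3 * gen3 d) - (t1 * gen1 d + t2 * gen2 d + s3 * gen3 d)"
    by (simp add: a_def b_def algebra_simps)
  moreover have "s1 * gen1 d + s2 * gen2 d + s3 * gen3 d = 0" "t1 * gen1 d + t2 * gen2 d + s3 * gen3 d = 0"
    using s by (simp_all add: st mem_syz_iff)
  ultimately have rel: "a * gen1 d + b * gen2 d = 0" by (simp only: diff_0_right)
  then have "b * gen2 d = (- a) * gen1 d" by (simp add: eq_neg_iff_add_eq_0 add.commute)
  then have "gen1 d dvd b * gen2 d" by (metis dvd_triv_right)
  then have "gen1 d dvd b" by (rule gen1_dvd_cancel[OF d])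
  then obtain r where r: "b = r * gen1 d" by (metis dvdE mult.commute)
  have g0: "gen1 d \<noteq> (0 :: 'k poly3)" by (rule gens_nonzero(1)[OF d])
  have "(a + r * gen2 d) * gen1 d = 0" using rel unfolding r by (simp add: algebra_simps)
  then have a: "a = - (r * gen2 d)" using g0 by (simp add: eq_neg_iff_add_eq_0)
  have s_eq: "s = t + scale3 r (koszul d)"
    using a r by (simp add: st koszul_def scale3_def a_def b_def algebra_simps)
  show "coset3 (koszul d) s = coset3 (koszul d) t"
  proof (intro equalityI subsetI)
    fix v assume "v \<in> coset3 (koszul d) s"
    then obtain q where "v = s + scale3 q (koszul d)" by (auto simp: coset3_def)
    then have "v = t + scale3 (r + q) (koszul d)" by (simp add: s_eq fm.scale_left_distrib add.assoc)
    then show "v \<in> coset3 (koszul d) t" unfolding coset3_def by blast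
  next
    fix v assume "v \<in> coset3 (koszul d) t"
    then obtain q where "v = t + scale3 q (koszul d)" by (auto simp: coset3_def)
    then have "v = s + scale3 (q - r) (koszul d)" by (simp add: s_eq fm.scale_left_diff_distrib)
    then show "v \<in> coset3 (koszul d) s" unfolding coset3_def by blast
  qed
qed

text \<open>The isomorphism is the projection to the third coordinate.\<close>

lemma quot_iso_shift_colon_ideal:
  assumes d: "d \<ge> 4"
  shows "quot_iso_shift (syz (J_gens d)) (koszul d) (colon_ideal d :: ('k::field) poly3 set)"
proof -
  let ?S = "syz (J_gens d) :: 'k vec3 set"
  \<comment> \<open>The Koszul syzygy has third coordinate 0, so the chosen representative of the
    coset does not affect the value.\<close>
  define \<psi> :: "'k vec3 set \<Rightarrow> 'k poly3" where "\<psi> = (\<lambda>C. snd (snd (SOME s. s \<in> C)))"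
  have psi: "\<psi> (coset3 (koszul d) s) = snd (snd s)" for s
  proof -
    have "s + scale3 0 (koszul d) \<in> coset3 (koszul d) s" unfolding coset3_def by blast
    then have "(SOME t. t \<in> coset3 (koszul d) s) \<in> coset3 (koszul d) s" by (rule someI)
    then obtain r where "(SOME t. t \<in> coset3 (koszul d) s) = s + scale3 r (koszul d)"
      by (auto simp: coset3_def)
    then show ?thesis unfolding \<psi>_def by (cases s) (simp add: koszul_def scale3_def)
  qed
  have "bij_betw \<psi> (coset3 (koszul d) ` ?S) (colon_ideal d)"
    unfolding bij_betw_def
  proof
    show "inj_on \<psi> (coset3 (koszul d) ` ?S)"
    proof (rule inj_onI)
      fix C D assume "C \<in> coset3 (koszul d) ` ?S" "D \<in> coset3 (koszul d) ` ?S" "\<psi> C = \<psi> D"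
      then obtain s t where "s \<in> ?S" "t \<in> ?S" "C = coset3 (koszul d) s" "D = coset3 (koszul d) t"
        "snd (snd s) = snd (snd t)"
        using psi by (metis imageE)
      then show "C = D" using coset3_koszul_eq_iff[OF d] by blast
    qed
    have "snd (snd s) \<in> colon_ideal d" if mem: "s \<in> ?S" for s
    proof -
      obtain s1 s2 s3 where s: "s = (s1, s2, s3)" by (cases s)
      have "s3 * gen3 d = (s1 * gen1 d + s2 * gen2 d + s3 * gen3 d) + (- s1 * gen1 d + - s2 * gen2 d)" by simp
      moreover have "s1 * gen1 d + s2 * gen2 d + s3 * gen3 d = 0" using mem by (simp add: s mem_syz_iff)
      ultimately have "s3 * gen3 d = - s1 * gen1 d + - s2 * gen2 d" by (simp only: add_0_left)
      then show ?thesis unfolding s colon_ideal_def snd_conv by blast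
    qed
    moreover have "\<exists>s\<in>?S. snd (snd s) = a" if a: "a \<in> colon_ideal d" for a
    proof -
      obtain u v where "a * gen3 d = u * gen1 d + v * gen2 d" using a by (auto simp: colon_ideal_def)
      then have "(- u, - v, a) \<in> ?S" by (simp add: mem_syz_iff)
      then show ?thesis by force
    qed
    ultimately show "\<psi> ` (coset3 (koszul d) ` ?S) = colon_ideal d"
      by (force simp: image_image psi)
  qed
  moreover have "\<forall>s\<in>?S. \<forall>t\<in>?S. \<psi> (coset3 (koszul d) (s + t)) = \<psi> (coset3 (koszul d) s) + \<psi> (coset3 (koszul d) t)"
    by (simp add: psi)
  moreover have "\<forall>r. \<forall>s\<in>?S. \<psi> (coset3 (koszul d) (scale3 r s)) = r * \<psi> (coset3 (koszul d) s)"
    by (auto simp: psi scale3_def split: prod.splits)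
  moreover have "\<forall>n. \<forall>s\<in>?S \<inter> forms3 n. \<psi> (coset3 (koszul d) s) \<in> forms (n + 0)"
    by (auto simp: psi forms3_def)
  ultimately show ?thesis unfolding quot_iso_shift_def by blast
qed

lemma quot_multiplicity_bourbaki_ideal:
  fixes \<nu> :: "('k::field_char_0) vec3"
  assumes d: "d \<ge> 4" and "minimal_generator (syz (J_gens d)) \<nu>" "\<nu> \<in> forms3 (int d)"
    and "ideal_height R3 I = 2" "quot_iso_shift (syz (J_gens d)) \<nu> I"
  shows "quot_multiplicity I = of_nat ((d - 1) ^ 2 + 1)"
proof -
  obtain \<phi> c where "bourbaki_iso d \<nu> I \<phi> c"
    using quot_iso_shift_bourbaki_iso[OF d minimal_generator_nonzero(2)[OF assms(2)] assms(3)
        minimal_generator_nonzero(1)[OF assms(2)] assms(5)] by blast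
  then show ?thesis using assms(4) by (rule bourbaki_iso.quot_multiplicity_ideal)
qed

lemma minimal_generator_koszul:
  assumes d: "d \<ge> 4"
  shows "minimal_generator (syz (J_gens d)) (koszul d :: ('k::field_char_0) vec3)"
proof (rule minimal_generator_of_least_degree[OF graded_submodule_syz[OF d]])
  fix n assume "n < int d"
  then show "syz (J_gens d) \<inter> forms3 n = {0 :: 'k vec3}"
    using small_syzygy_zero[OF d] graded_submoduleD(1)[OF graded_submodule_syz[OF d]] forms3_closed(1) by blast
qed (use koszul_syz[OF d] in blast)+

lemma bourbaki_degree_J_gens:
  assumes d: "d \<ge> 4"
  shows "bourbaki_degree (J_gens d :: ('k::field_char_0) vec3) = of_nat ((d - 1) ^ 2 + 1)"
proof -
  have "\<not> cohen_macaulay (R3 Quot (gen_ideal3 (J_gens d :: 'k vec3)))"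
    using not_cohen_macaulay_R3_Quot_ideal_J[OF d] unfolding ideal_J_def .
  moreover have "(THE b. \<exists>\<nu> I. minimal_generator (syz (J_gens d :: 'k vec3)) \<nu> \<and>
      \<nu> \<in> forms3 (int (indeg (syz (J_gens d :: 'k vec3)))) \<and>
      homogeneous_ideal I \<and> ideal_height R3 I = 2 \<and> unmixed R3 I \<and>
      quot_iso_shift (syz (J_gens d)) \<nu> I \<and> b = quot_multiplicity I) = of_nat ((d - 1) ^ 2 + 1)"
    unfolding indeg_syz[OF d]
  proof (rule the_equality)
    have "quot_multiplicity (colon_ideal d :: 'k poly3 set) = of_nat ((d - 1) ^ 2 + 1)"
      by (rule quot_multiplicity_bourbaki_ideal[OF d minimal_generator_koszul[OF d] koszul_syz(2)[OF d]
            ideal_height_colon_ideal[OF d] quot_iso_shift_colon_ideal[OF d]])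
    then show "\<exists>\<nu> I. minimal_generator (syz (J_gens d :: 'k vec3)) \<nu> \<and> \<nu> \<in> forms3 (int d) \<and>
      homogeneous_ideal I \<and> ideal_height R3 I = 2 \<and> unmixed R3 I \<and>
      quot_iso_shift (syz (J_gens d)) \<nu> I \<and> of_nat ((d - 1) ^ 2 + 1) = quot_multiplicity I"
      using minimal_generator_koszul[OF d] koszul_syz(2)[OF d] homogeneous_ideal_colon_ideal[OF d]
        ideal_height_colon_ideal[OF d] unmixed_colon_ideal[OF d] quot_iso_shift_colon_ideal[OF d]
      by (intro exI[of _ "koszul d"] exI[of _ "colon_ideal d"]) simp
  next
    fix b assume "\<exists>\<nu> I. minimal_generator (syz (J_gens d :: 'k vec3)) \<nu> \<and> \<nu> \<in> forms3 (int d) \<and>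
      homogeneous_ideal I \<and> ideal_height R3 I = 2 \<and> unmixed R3 I \<and>
      quot_iso_shift (syz (J_gens d)) \<nu> I \<and> b = quot_multiplicity I"
    then show "b = of_nat ((d - 1) ^ 2 + 1)" using quot_multiplicity_bourbaki_ideal[OF d] by blast
  qed
  ultimately show ?thesis unfolding bourbaki_degree_def by (simp only: if_False)
qed

theorem proposition3p3:
  fixes d :: nat and f :: "('k :: {alg_closed_field, field_char_0}) vec3" and J :: "'k poly3 set"
  assumes "d \<ge> 4"
  defines "f \<equiv> J_gens d"
  defines "J \<equiv> gen_ideal3 f"
  shows "ideal_height R3 J = 2
       \<and> quot_multiplicity J = of_nat (2 * d - 2)
       \<and> indeg (syz f) = d
       \<and> bourbaki_degree f = of_nat ((d - 1) ^ 2 + 1)"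
  using ideal_height_ideal_J[OF assms(1), where ?'k = 'k] quot_multiplicity_ideal_J[OF assms(1), where ?'k = 'k]
    indeg_syz[OF assms(1), where ?'k = 'k] bourbaki_degree_J_gens[OF assms(1), where ?'k = 'k]
  unfolding J_def f_def ideal_J_def by blast

end
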